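(* Let $a,b\in\mathbb C$ with $a\neq\pm b$ and $a^2b^2=1$, put $c=(a^2+b^2)/2$, and let $R=\mathbb C[t,t^{-1},u\mid u^2=(t^2-a^2)(t^2-b^2)]=\mathbb C[t,t^{-1},u\mid u^2=t^4-2ct^2+1]$. Let $\mathfrak g$ be a simple finite dimensional Lie algebra over $\mathbb C$ with Killing form $(\cdot,\cdot)$. Set $\omega_0=\overline{t^{-1}\,dt}$ and $\omega_{-k}=\overline{t^{-k}u\,dt}$ for $k=1,2,3,4$ in $\Omega_R^1/dR$. For $i,j\in\mathbb Z$ define $\psi_{ij}(c)\in\Omega_R^1/dR$ by $$ \psi_{ij}(c)=\begin{cases} \omega_{i+j-2} & \text{for } i+j=1,0,-1,-2,\\ P_{-3,i+j-2}(c)\,(\omega_{-3}+c\,\omega_{-1}) & \text{for } i+j=2n-1\geq 3,\ n\in\mathbb Z,\\ P_{-3,|i+j|-2}(c)\,(c\,\omega_{-3}+\omega_{-1}) & \text{for } i+j=-2n+1\leq -3,\ n\in\mathbb Z,\\ P_{-4,|i+j|-2}(c)\,\omega_{-4}+P_{-2,|i+j|-2}(c)\,\omega_{-2} & \text{for } |i+j|=2n\geq 2,\ n\in\mathbb Z. \end{cases} $$ Then the universal central extension of the Lie algebra $\mathfrak g\otimes R$ is the $\mathbb Z_2$-graded Lie algebra $\widehat{\mathfrak g}=\widehat{\mathfrak g}^0\oplus\widehat{\mathfrak g}^1$, where $$ \widehat{\mathfrak g}^0=\left(\mathfrak g\otimes\mathbb C[t,t^{-1}]\right)\oplus\mathbb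 C\omega_0,\qquad \widehat{\mathfrak g}^1=\left(\mathfrak g\otimes\mathbb C[t,t^{-1}]u\right)\oplus\mathbb C\omega_{-4}\oplus\mathbb C\omega_{-3}\oplus\mathbb C\omega_{-2}\oplus\mathbb C\omega_{-1}, $$ in which $\omega_0,\omega_{-1},\omega_{-2},\omega_{-3},\omega_{-4}$ are central, with bracket given for all $x,y\in\mathfrak g$ and $i,j\in\mathbb Z$ by \begin{align*} [x\otimes t^i,\,y\otimes t^j]&=[x,y]\otimes t^{i+j}+\delta_{i+j,0}\,j\,(x,y)\,\omega_0,\\ [x\otimes t^{i-1}u,\,y\otimes t^{j-1}u]&=[x,y]\otimes(t^{i+j+2}-2ct^{i+j}+t^{i+j-2})\\ &\quad+\left(\delta_{i+j,-2}(j+1)-2cj\,\delta_{i+j,0}+(j-1)\delta_{i+j,2}\right)(x,y)\,\omega_0,\\ [x\otimes t^{i-1}u,\,y\otimes t^{j}]&=[x,y]\otimes t^{i+j-1}u+j\,(x,y)\,\psi_{ij}(c). \end{align*}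
   Context: For a commutative $\mathbb C$-algebra $R$, $\Omega_R^1$ is the $R$-module of Kähler differentials of $R$ over $\mathbb C$, $d:R\to\Omega_R^1$ is the universal derivation, $dR$ is the subspace of exact differentials, and $\overline{f\,dg}$ is the class of $f\,dg$ in $\Omega_R^1/dR$. The Lie algebra $\mathfrak g\otimes R=\mathfrak g\otimes_{\mathbb C}R$ has bracket $[x\otimes f,y\otimes g]=[x,y]\otimes fg$; for the ring $R$ of the claim it is the Date-Jimbo-Kashiwara-Miwa (DJKM) algebra. The covering map $\widehat{\mathfrak g}\to\mathfrak g\otimes R$ is the identity on $\mathfrak g\otimes R=(\mathfrak g\otimes\mathbb C[t,t^{-1}])\oplus(\mathfrak g\otimes\mathbb C[t,t^{-1}]u)$ and kills the $\omega$'s. Polynomials: for $l\in\{-4,-3,-2\}$, the polynomials $P_{l,k}(c)$ in $c$, $k\geq -4$, are defined by the initial conditions $P_{l,l}(c)=1$ and $P_{l,k}(c)=0$ for $k\in\{-4,-3,-2,-1\}\setminus\{l\}$, together with the recursion $$(6+2k)P_{l,k}(c)=4kc\,P_{l,k-2}(c)-2(k-3)P_{l,k-4}(c)\qquad (k\geq 0).$$ For $i+j=-2$ both the first and the fourth clause in the definition of $\psi_{ij}(c)$ apply, and they give the same value since $P_{-4,0}=1$, $P_{-2,0}=0$. *)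

theory Defs
  imports
    Complex_Main
    "HOL-Library.Poly_Mapping"
    "HOL-Library.Product_Plus"
    "HOL-Computational_Algebra.Polynomial"
begin

section \<open>Complex vector spaces and commutative complex algebras\<close>

class complex_vector = ab_group_add +
  fixes scaleC :: "complex \<Rightarrow> 'a \<Rightarrow> 'a" (infixr "*\<^sub>C" 75)
  assumes scaleC_add_right: "z *\<^sub>C (x + y) = z *\<^sub>C x + z *\<^sub>C y"
    and scaleC_add_left: "(z + w) *\<^sub>C x = z *\<^sub>C x + w *\<^sub>C x"
    and scaleC_scaleC: "z *\<^sub>C w *\<^sub>C x = (z * w) *\<^sub>C x"
    and scaleC_one: "1 *\<^sub>C x = x"

global_interpretation cvec: vector_space "scaleC :: complex \<Rightarrow> 'a \<Rightarrow> 'a::complex_vector"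
  by unfold_locales
    (auto simp: scaleC_add_right scaleC_add_left scaleC_scaleC scaleC_one)

definition clinear :: "('a::complex_vector \<Rightarrow> 'b::complex_vector) \<Rightarrow> bool" where
  "clinear f \<longleftrightarrow> (\<forall>x y. f (x + y) = f x + f y) \<and> (\<forall>z x. f (z *\<^sub>C x) = z *\<^sub>C f x)"

definition cbilinear ::
    "('a::complex_vector \<Rightarrow> 'b::complex_vector \<Rightarrow> 'c::complex_vector) \<Rightarrow> bool" where
  "cbilinear h \<longleftrightarrow> (\<forall>x. clinear (h x)) \<and> (\<forall>y. clinear (\<lambda>x. h x y))"

class complex_comm_algebra = comm_ring_1 + complex_vector +
  assumes scaleC_mult_left: "(z *\<^sub>C x) * y = z *\<^sub>C (x * y)"

lemma scaleC_mult_right: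
  "x * (z *\<^sub>C y) = z *\<^sub>C (x * y)" for x y :: "'a::complex_comm_algebra"
  by (metis mult.commute scaleC_mult_left)

instantiation complex :: complex_comm_algebra
begin
definition scaleC_complex :: "complex \<Rightarrow> complex \<Rightarrow> complex" where
  "scaleC_complex z w = z * w"
instance
  by standard (auto simp: scaleC_complex_def algebra_simps)
end

instantiation prod :: (complex_vector, complex_vector) complex_vector
begin
definition scaleC_prod :: "complex \<Rightarrow> 'a \<times> 'b \<Rightarrow> 'a \<times> 'b" where
  "scaleC_prod z p = (z *\<^sub>C fst p, z *\<^sub>C snd p)"
instance
  by standard
    (auto simp: scaleC_prod_def scaleC_add_right scaleC_add_left scaleC_scaleC scaleC_one)
end

instantiation poly_mapping :: (type, complex_vector) complex_vector
begin
lift_definition scaleC_poly_mapping :: "complex \<Rightarrow> ('a \<Rightarrow>\<^sub>0 'b) \<Rightarrow> 'a \<Rightarrow>\<^sub>0 'b"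
  is "\<lambda>z p k. z *\<^sub>C p k"
  by (rule finite_subset[rotated]) auto
instance
  by standard
    (transfer, auto simp: fun_eq_iff scaleC_add_right scaleC_add_left scaleC_scaleC scaleC_one)+
end

lemma lookup_scaleC [simp]: "Poly_Mapping.lookup (z *\<^sub>C p) k = z *\<^sub>C Poly_Mapping.lookup p k"
  by transfer simp


section \<open>Lie algebras and their universal central extensions\<close>

text \<open>A Lie algebra is a subspace \<open>L\<close> of a complex vector space together with a bracket, of which
  only the values on \<open>L\<close> matter.\<close>

definition bilinear_on ::
    "'a::complex_vector set \<Rightarrow> ('a \<Rightarrow> 'a \<Rightarrow> 'b::complex_vector) \<Rightarrow> bool" where
  "bilinear_on L br \<longleftrightarrow>
    (\<forall>x\<in>L. \<forall>y\<in>L. \<forall>z\<in>L. br (x + y) z = br x z + br y z \<and> br x (y + z) = br x y + br x z) \<and>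
    (\<forall>w. \<forall>x\<in>L. \<forall>y\<in>L. br (w *\<^sub>C x) y = w *\<^sub>C br x y \<and> br x (w *\<^sub>C y) = w *\<^sub>C br x y)"

locale lie_algebra =
  fixes L :: "'a::complex_vector set" and br :: "'a \<Rightarrow> 'a \<Rightarrow> 'a"
  assumes subspace: "cvec.subspace L"
    and closed: "x \<in> L \<Longrightarrow> y \<in> L \<Longrightarrow> br x y \<in> L"
    and bilinear: "bilinear_on L br"
    and alternating: "x \<in> L \<Longrightarrow> br x x = 0"
    and jacobi: "x \<in> L \<Longrightarrow> y \<in> L \<Longrightarrow> z \<in> L \<Longrightarrow>
      br x (br y z) + br y (br z x) + br z (br x y) = 0"

definition lie_ideal ::
    "'a::complex_vector set \<Rightarrow> 'a set \<Rightarrow> ('a \<Rightarrow> 'a \<Rightarrow> 'a) \<Rightarrow> bool" where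
  "lie_ideal I L br \<longleftrightarrow> cvec.subspace I \<and> I \<subseteq> L \<and> (\<forall>x\<in>L. \<forall>y\<in>I. br x y \<in> I)"

definition simple_lie_algebra :: "'a::complex_vector set \<Rightarrow> ('a \<Rightarrow> 'a \<Rightarrow> 'a) \<Rightarrow> bool" where
  "simple_lie_algebra L br \<longleftrightarrow> lie_algebra L br \<and>
    (\<exists>x\<in>L. \<exists>y\<in>L. br x y \<noteq> 0) \<and> (\<forall>I. lie_ideal I L br \<longrightarrow> I = {0} \<or> I = L)"

definition finite_dimensional :: "'a::complex_vector set \<Rightarrow> bool" where
  "finite_dimensional V \<longleftrightarrow> (\<exists>B. finite B \<and> cvec.span B = V)"

definition lie_hom :: "'a::complex_vector set \<Rightarrow> ('a \<Rightarrow> 'a \<Rightarrow> 'a) \<Rightarrow>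
    'b::complex_vector set \<Rightarrow> ('b \<Rightarrow> 'b \<Rightarrow> 'b) \<Rightarrow> ('a \<Rightarrow> 'b) \<Rightarrow> bool" where
  "lie_hom L br M br' \<phi> \<longleftrightarrow>
    (\<forall>x\<in>L. \<phi> x \<in> M) \<and>
    (\<forall>x\<in>L. \<forall>y\<in>L. \<phi> (x + y) = \<phi> x + \<phi> y) \<and>
    (\<forall>z. \<forall>x\<in>L. \<phi> (z *\<^sub>C x) = z *\<^sub>C \<phi> x) \<and>
    (\<forall>x\<in>L. \<forall>y\<in>L. \<phi> (br x y) = br' (\<phi> x) (\<phi> y))"

definition central_extension :: "'a::complex_vector set \<Rightarrow> ('a \<Rightarrow> 'a \<Rightarrow> 'a) \<Rightarrow>
    'b::complex_vector set \<Rightarrow> ('b \<Rightarrow> 'b \<Rightarrow> 'b) \<Rightarrow> ('a \<Rightarrow> 'b) \<Rightarrow> bool" where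
  "central_extension E brE L brL \<pi> \<longleftrightarrow>
    lie_algebra E brE \<and> lie_algebra L brL \<and> lie_hom E brE L brL \<pi> \<and> \<pi> ` E = L \<and>
    (\<forall>z\<in>E. \<pi> z = 0 \<longrightarrow> (\<forall>x\<in>E. brE z x = 0))"

text \<open>HOL cannot quantify over types inside a definition, so the type in which the competing
  central extensions \<open>F\<close> live is an explicit parameter. A theorem about
  \<open>universal_central_extension TYPE('f)\<close> with \<open>'f\<close> a type variable covers all of them.\<close>

definition universal_central_extension :: "'f::complex_vector itself \<Rightarrow>
    'a::complex_vector set \<Rightarrow> ('a \<Rightarrow> 'a \<Rightarrow> 'a) \<Rightarrow>
    'b::complex_vector set \<Rightarrow> ('b \<Rightarrow> 'b \<Rightarrow> 'b) \<Rightarrow> ('a \<Rightarrow> 'b) \<Rightarrow> bool" where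
  "universal_central_extension _ E brE L brL \<pi> \<longleftrightarrow>
    central_extension E brE L brL \<pi> \<and>
    (\<forall>(F :: 'f set) brF \<rho>. central_extension F brF L brL \<rho> \<longrightarrow>
      (\<exists>\<phi>. lie_hom E brE F brF \<phi> \<and> (\<forall>x\<in>E. \<rho> (\<phi> x) = \<pi> x) \<and>
        (\<forall>\<phi>'. lie_hom E brE F brF \<phi>' \<and> (\<forall>x\<in>E. \<rho> (\<phi>' x) = \<pi> x) \<longrightarrow>
          (\<forall>x\<in>E. \<phi>' x = \<phi> x))))"

definition subspace_sum :: "'a::complex_vector set \<Rightarrow> 'a set \<Rightarrow> 'a set" where
  "subspace_sum V W = {v + w | v w. v \<in> V \<and> w \<in> W}"

definition z2_graded :: "'a::complex_vector set \<Rightarrow> 'a set \<Rightarrow> 'a set \<Rightarrow> ('a \<Rightarrow> 'a \<Rightarrow> 'a) \<Rightarrow> bool" where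
  "z2_graded L L0 L1 br \<longleftrightarrow>
    cvec.subspace L0 \<and> cvec.subspace L1 \<and> L = subspace_sum L0 L1 \<and> L0 \<inter> L1 = {0} \<and>
    (\<forall>x\<in>L0. \<forall>y\<in>L0. br x y \<in> L0) \<and>
    (\<forall>x\<in>L0. \<forall>y\<in>L1. br x y \<in> L1) \<and>
    (\<forall>x\<in>L1. \<forall>y\<in>L0. br x y \<in> L1) \<and>
    (\<forall>x\<in>L1. \<forall>y\<in>L1. br x y \<in> L0)"


subsection \<open>The Killing form\<close>

definition trace_wrt :: "'a::complex_vector set \<Rightarrow> ('a \<Rightarrow> 'a) \<Rightarrow> complex" where
  "trace_wrt B f = (\<Sum>b\<in>B. cvec.representation B (f b) b)"

lemma trace_wrt_basis_independent:
  fixes B C :: "'a::complex_vector set"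
  assumes B: "finite B" "cvec.independent B" "cvec.span B = UNIV"
    and C: "finite C" "cvec.independent C" "cvec.span C = UNIV"
    and f: "clinear f"
  shows "trace_wrt B f = trace_wrt C f"
proof -
  have f_sum: "f (\<Sum>c\<in>S. k c *\<^sub>C c) = (\<Sum>c\<in>S. k c *\<^sub>C f c)" if "finite S" for S k
  proof -
    have "f 0 = 0"
      using f by (metis add_cancel_right_right clinear_def)
    with that show ?thesis
      by (induction S rule: finite_induct) (use f in \<open>auto simp: clinear_def\<close>)
  qed
  have "trace_wrt B f = (\<Sum>b\<in>B. \<Sum>c\<in>C. cvec.representation C b c * cvec.representation B (f c) b)"
    unfolding trace_wrt_def
  proof (rule sum.cong[OF refl])
    fix b assume "b \<in> B"
    have "b = (\<Sum>c\<in>C. cvec.representation C b c *\<^sub>C c)"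
      using C by (simp add: cvec.sum_representation_eq)
    then have "f b = (\<Sum>c\<in>C. cvec.representation C b c *\<^sub>C f c)"
      using f_sum[OF C(1)] by metis
    then show "cvec.representation B (f b) b =
        (\<Sum>c\<in>C. cvec.representation C b c * cvec.representation B (f c) b)"
      using B by (simp add: cvec.representation_sum cvec.representation_scale)
  qed
  also have "\<dots> = (\<Sum>c\<in>C. \<Sum>b\<in>B. cvec.representation B (f c) b * cvec.representation C b c)"
    by (subst sum.swap) (simp add: mult.commute)
  also have "\<dots> = trace_wrt C f"
    unfolding trace_wrt_def
  proof (rule sum.cong[OF refl])
    fix c assume "c \<in> C"
    have "f c = (\<Sum>b\<in>B. cvec.representation B (f c) b *\<^sub>C b)"
      using B by (simp add: cvec.sum_representation_eq)
    then have "cvec.representation C (f c) c =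
        cvec.representation C (\<Sum>b\<in>B. cvec.representation B (f c) b *\<^sub>C b) c"
      by metis
    then show "(\<Sum>b\<in>B. cvec.representation B (f c) b * cvec.representation C b c) =
        cvec.representation C (f c) c"
      using C by (simp add: cvec.representation_sum cvec.representation_scale)
  qed
  finally show ?thesis .
qed

definition killing_form :: "('a::complex_vector \<Rightarrow> 'a \<Rightarrow> 'a) \<Rightarrow> 'a \<Rightarrow> 'a \<Rightarrow> complex" where
  "killing_form br x y =
    trace_wrt (SOME B. cvec.independent B \<and> cvec.span B = UNIV) (\<lambda>z. br x (br y z))"


section \<open>Tensor products over the complex numbers\<close>

text \<open>The tensor product is the free vector space on \<open>'a \<times> 'b\<close> modulo the bilinearity relations.\<close>

abbreviation formal_tensor :: "'a \<Rightarrow> 'b \<Rightarrow> ('a \<times> 'b) \<Rightarrow>\<^sub>0 complex" where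
  "formal_tensor x y \<equiv> Poly_Mapping.single (x, y) 1"

definition tensor_relations ::
    "(('a::complex_vector \<times> 'b::complex_vector) \<Rightarrow>\<^sub>0 complex) set" where
  "tensor_relations =
    {formal_tensor (x + x') y - formal_tensor x y - formal_tensor x' y | x x' y. True} \<union>
    {formal_tensor x (y + y') - formal_tensor x y - formal_tensor x y' | x y y'. True} \<union>
    {formal_tensor (z *\<^sub>C x) y - z *\<^sub>C formal_tensor x y | z x y. True} \<union>
    {formal_tensor x (z *\<^sub>C y) - z *\<^sub>C formal_tensor x y | z x y. True}"

lemma equivp_mod_subgroup:
  fixes S :: "'a::ab_group_add set"
  assumes "0 \<in> S" "\<And>p. p \<in> S \<Longrightarrow> - p \<in> S" "\<And>p q. p \<in> S \<Longrightarrow> q \<in> S \<Longrightarrow> p + q \<in> S"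
  shows "equivp (\<lambda>p q. p - q \<in> S)"
proof (rule equivpI)
  show "reflp (\<lambda>p q. p - q \<in> S)"
    using assms(1) by (auto intro: reflpI)
  show "symp (\<lambda>p q. p - q \<in> S)"
    by (rule sympI) (use assms(2) in fastforce)
  show "transp (\<lambda>p q. p - q \<in> S)"
    by (rule transpI) (use assms(3) in fastforce)
qed

lemma diff_diff_mem:
  fixes S :: "'a::ab_group_add set"
  assumes "p - q \<in> S" "r - s \<in> S" "\<And>p q. p \<in> S \<Longrightarrow> q \<in> S \<Longrightarrow> p - q \<in> S"
  shows "p - r - (q - s) \<in> S"
  using assms(3)[OF assms(1,2)] by (simp add: algebra_simps)

quotient_type (overloaded) ('a, 'b) tensor =
    "('a::complex_vector \<times> 'b::complex_vector) \<Rightarrow>\<^sub>0 complex"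
  / "\<lambda>p q. p - q \<in> cvec.span tensor_relations"
  by (rule equivp_mod_subgroup) (auto intro: cvec.span_zero cvec.span_neg cvec.span_add)

instantiation tensor :: (complex_vector, complex_vector) complex_vector
begin

lift_definition zero_tensor :: "('a, 'b) tensor" is 0 .
lift_definition plus_tensor :: "('a, 'b) tensor \<Rightarrow> ('a, 'b) tensor \<Rightarrow> ('a, 'b) tensor" is "(+)"
  by (metis add_diff_add cvec.span_add)
lift_definition minus_tensor :: "('a, 'b) tensor \<Rightarrow> ('a, 'b) tensor \<Rightarrow> ('a, 'b) tensor" is "(-)"
  by (rule diff_diff_mem) (auto intro: cvec.span_diff)
lift_definition uminus_tensor :: "('a, 'b) tensor \<Rightarrow> ('a, 'b) tensor" is uminus
  by (metis cvec.span_neg minus_diff_minus)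
lift_definition scaleC_tensor :: "complex \<Rightarrow> ('a, 'b) tensor \<Rightarrow> ('a, 'b) tensor" is scaleC
  by (metis cvec.scale_right_diff_distrib cvec.span_scale)

instance
  by standard
    (transfer, simp add: algebra_simps scaleC_add_right scaleC_add_left scaleC_scaleC scaleC_one
      cvec.span_zero)+

end

lift_definition tensor_of ::
    "'a::complex_vector \<Rightarrow> 'b::complex_vector \<Rightarrow> ('a, 'b) tensor" (infixl "\<otimes>\<^sub>C" 70)
  is formal_tensor .

lemma tensor_of_add_left: "(x + x') \<otimes>\<^sub>C y = x \<otimes>\<^sub>C y + x' \<otimes>\<^sub>C y"
  by transfer (rule cvec.span_base, unfold tensor_relations_def diff_diff_eq[symmetric], blast)

lemma tensor_of_add_right: "x \<otimes>\<^sub>C (y + y') = x \<otimes>\<^sub>C y + x \<otimes>\<^sub>C y'"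
  by transfer (rule cvec.span_base, unfold tensor_relations_def diff_diff_eq[symmetric], blast)

lemma tensor_of_scale_left: "(z *\<^sub>C x) \<otimes>\<^sub>C y = z *\<^sub>C (x \<otimes>\<^sub>C y)"
  by transfer (rule cvec.span_base, unfold tensor_relations_def, blast)

lemma tensor_of_scale_right: "x \<otimes>\<^sub>C (z *\<^sub>C y) = z *\<^sub>C (x \<otimes>\<^sub>C y)"
  by transfer (rule cvec.span_base, unfold tensor_relations_def, blast)

lemmas tensor_of_bilinear =
  tensor_of_add_left tensor_of_add_right tensor_of_scale_left tensor_of_scale_right

text \<open>The linear map induced by a bilinear map \<open>h\<close>. It is evaluated on a chosen representative; for
  bilinear \<open>h\<close> the choice is immaterial, see \<open>tensor_lift_tensor_of\<close> and
  \<open>clinear_tensor_lift\<close> below.\<close>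

definition formal_lift ::
    "('a \<Rightarrow> 'b \<Rightarrow> 'c::complex_vector) \<Rightarrow> (('a \<times> 'b) \<Rightarrow>\<^sub>0 complex) \<Rightarrow> 'c" where
  "formal_lift h p =
    (\<Sum>(x, y)\<in>Poly_Mapping.keys p. Poly_Mapping.lookup p (x, y) *\<^sub>C h x y)"

definition tensor_lift :: "('a::complex_vector \<Rightarrow> 'b::complex_vector \<Rightarrow> 'c::complex_vector) \<Rightarrow>
    ('a, 'b) tensor \<Rightarrow> 'c" where
  "tensor_lift h X = formal_lift h (rep_tensor X)"

lemma formal_lift_superset:
  assumes "finite S" "Poly_Mapping.keys p \<subseteq> S"
  shows "formal_lift h p = (\<Sum>(x, y)\<in>S. Poly_Mapping.lookup p (x, y) *\<^sub>C h x y)"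
  unfolding formal_lift_def using assms
  by (intro sum.mono_neutral_left) (auto simp: in_keys_iff)

lemma formal_lift_add: "formal_lift h (p + q) = formal_lift h p + formal_lift h q"
proof -
  define S where "S = Poly_Mapping.keys p \<union> Poly_Mapping.keys q \<union> Poly_Mapping.keys (p + q)"
  have S: "finite S" "Poly_Mapping.keys p \<subseteq> S" "Poly_Mapping.keys q \<subseteq> S"
    "Poly_Mapping.keys (p + q) \<subseteq> S"
    by (auto simp: S_def)
  show ?thesis
    using S by (simp add: formal_lift_superset[of S] lookup_add scaleC_add_left sum.distrib
        case_prod_unfold)
qed

lemma formal_lift_scaleC: "formal_lift h (z *\<^sub>C p) = z *\<^sub>C formal_lift h p"
proof -
  define S where "S = Poly_Mapping.keys p \<union> Poly_Mapping.keys (z *\<^sub>C p)"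
  have S: "finite S" "Poly_Mapping.keys p \<subseteq> S" "Poly_Mapping.keys (z *\<^sub>C p) \<subseteq> S"
    by (auto simp: S_def)
  show ?thesis
    using S by (simp add: formal_lift_superset[of S] cvec.scale_sum_right scaleC_complex_def
        case_prod_unfold)
qed

lemma formal_lift_diff: "formal_lift h (p - q) = formal_lift h p - formal_lift h q"
  by (metis add_diff_cancel_right' diff_add_cancel formal_lift_add)

lemma formal_lift_formal_tensor [simp]: "formal_lift h (formal_tensor x y) = h x y"
  by (simp add: formal_lift_def scaleC_one)

lemma formal_lift_relations:
  assumes h: "cbilinear h" and p: "p \<in> cvec.span tensor_relations"
  shows "formal_lift h p = 0"
  using p
proof (induction rule: cvec.span_induct_alt)
  case base
  show ?case by (simp add: formal_lift_def)
next
  case (step z p q)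
  have "formal_lift h p = 0"
    using step(1) h unfolding tensor_relations_def
    by (auto simp: formal_lift_diff formal_lift_scaleC cbilinear_def clinear_def)
  then show ?case
    using step by (simp add: formal_lift_add formal_lift_scaleC)
qed

lemma tensor_lift_abs:
  assumes "cbilinear h"
  shows "tensor_lift h (abs_tensor p) = formal_lift h p"
proof -
  have "rep_tensor (abs_tensor p) - p \<in> cvec.span tensor_relations"
    by (rule Quotient3_rep_abs[OF Quotient3_tensor]) (simp add: cvec.span_zero)
  then have "formal_lift h (rep_tensor (abs_tensor p) - p) = 0"
    using formal_lift_relations[OF assms] by blast
  then show ?thesis
    by (simp add: tensor_lift_def formal_lift_diff)
qed

lemma tensor_lift_tensor_of: "cbilinear h \<Longrightarrow> tensor_lift h (x \<otimes>\<^sub>C y) = h x y"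
  by (simp add: tensor_of.abs_eq tensor_lift_abs)

lemma clinear_tensor_lift:
  assumes h: "cbilinear h"
  shows "clinear (tensor_lift h)"
proof -
  have "tensor_lift h (X + Y) = tensor_lift h X + tensor_lift h Y" for X Y
    by (induction X rule: tensor.abs_induct, induction Y rule: tensor.abs_induct)
      (simp add: plus_tensor.abs_eq tensor_lift_abs[OF h] formal_lift_add)
  moreover have "tensor_lift h (z *\<^sub>C X) = z *\<^sub>C tensor_lift h X" for z X
    by (induction X rule: tensor.abs_induct)
      (simp add: scaleC_tensor.abs_eq tensor_lift_abs[OF h] formal_lift_scaleC)
  ultimately show ?thesis
    by (simp add: clinear_def)
qed

text \<open>The bilinear bracket with \<open>[x \<otimes> f, y \<otimes> g] = [x, y] \<otimes> f g\<close>; for bilinear \<open>br\<close> this equation is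
  \<open>current_bracket_tensor_of\<close> below.\<close>

definition current_bracket :: "('g::complex_vector \<Rightarrow> 'g \<Rightarrow> 'g) \<Rightarrow>
    ('g, 'r::complex_comm_algebra) tensor \<Rightarrow> ('g, 'r) tensor \<Rightarrow> ('g, 'r) tensor" where
  "current_bracket br X Y =
    tensor_lift (\<lambda>x f. tensor_lift (\<lambda>y g. br x y \<otimes>\<^sub>C (f * g)) Y) X"

lemma cbilinear_current:
  fixes f :: "'r::complex_comm_algebra"
  assumes "cbilinear br"
  shows "cbilinear (\<lambda>y g. br x y \<otimes>\<^sub>C (f * g))"
  using assms unfolding cbilinear_def clinear_def
  by (simp add: tensor_of_bilinear distrib_left scaleC_mult_right)

lemma clinear_eqI:
  assumes f: "clinear f" and g: "clinear g"
    and eq: "\<And>x y. f (x \<otimes>\<^sub>C y) = g (x \<otimes>\<^sub>C y)"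
  shows "f X = g X"
proof -
  have "f (abs_tensor p) = g (abs_tensor p)" for p
  proof (induction p rule: update_induct)
    case const
    have "f 0 = 0" "g 0 = 0"
      using f g by (metis add_cancel_right_right clinear_def)+
    then show ?case by (simp add: zero_tensor_def)
  next
    case (update p k v)
    have "Poly_Mapping.update k v p = p + v *\<^sub>C formal_tensor (fst k) (snd k)"
      using update(1) by (intro poly_mapping_eqI)
        (auto simp: lookup_update lookup_add lookup_single scaleC_complex_def when_def in_keys_iff)
    then have "abs_tensor (Poly_Mapping.update k v p) = abs_tensor p + v *\<^sub>C (fst k \<otimes>\<^sub>C snd k)"
      by (simp only: tensor_of.abs_eq scaleC_tensor.abs_eq plus_tensor.abs_eq)
    then show ?case
      using f g eq update(3) by (simp add: clinear_def)
  qed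
  then show ?thesis
    by (induction X rule: tensor.abs_induct)
qed

lemma cbilinear_current_outer:
  fixes br :: "'g::complex_vector \<Rightarrow> 'g \<Rightarrow> 'g" and Y :: "('g, 'r::complex_comm_algebra) tensor"
  assumes br: "cbilinear br"
  shows "cbilinear (\<lambda>x f. tensor_lift (\<lambda>y g. br x y \<otimes>\<^sub>C (f * g)) Y)"
proof -
  define G where "G x f = tensor_lift (\<lambda>y g. br x y \<otimes>\<^sub>C (f * g))" for x and f :: 'r
  have L: "clinear (G x f)" for x f
    unfolding G_def by (rule clinear_tensor_lift[OF cbilinear_current[OF br]])
  have T: "G x f (y \<otimes>\<^sub>C g) = br x y \<otimes>\<^sub>C (f * g)" for x f y g
    unfolding G_def by (rule tensor_lift_tensor_of[OF cbilinear_current[OF br]])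
  have add: "clinear (\<lambda>Y. F Y + H Y)" if "clinear F" "clinear H"
    for F H :: "('g, 'r) tensor \<Rightarrow> ('g, 'r) tensor"
    using that by (simp add: clinear_def scaleC_add_right)
  have scale: "clinear (\<lambda>Y. z *\<^sub>C F Y)" if "clinear F"
    for z and F :: "('g, 'r) tensor \<Rightarrow> ('g, 'r) tensor"
    using that by (simp add: clinear_def scaleC_add_right scaleC_scaleC mult.commute)
  have b: "br (u + v) w = br u w + br v w" "br (z *\<^sub>C u) w = z *\<^sub>C br u w" for u v w z
    using br unfolding cbilinear_def clinear_def by blast+
  have "G (x + x') f Y = G x f Y + G x' f Y" for x x' f
    by (rule clinear_eqI[OF L add[OF L L]]) (simp only: T b tensor_of_bilinear)
  moreover have "G x (f + f') Y = G x f Y + G x f' Y" for x f f'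
    by (rule clinear_eqI[OF L add[OF L L]]) (simp only: T tensor_of_bilinear distrib_right)
  moreover have "G (z *\<^sub>C x) f Y = z *\<^sub>C G x f Y" for z x f
    by (rule clinear_eqI[OF L scale[OF L]]) (simp only: T b tensor_of_bilinear)
  moreover have "G x (z *\<^sub>C f) Y = z *\<^sub>C G x f Y" for z x f
    by (rule clinear_eqI[OF L scale[OF L]]) (simp only: T tensor_of_bilinear scaleC_mult_left)
  ultimately have "cbilinear (\<lambda>x f. G x f Y)"
    unfolding cbilinear_def clinear_def by blast
  then show ?thesis
    by (simp only: G_def)
qed

lemma current_bracket_tensor_of:
  assumes "cbilinear br"
  shows "current_bracket br (x \<otimes>\<^sub>C f) (y \<otimes>\<^sub>C g) = br x y \<otimes>\<^sub>C (f * g)"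
  unfolding current_bracket_def
  by (rule trans[OF tensor_lift_tensor_of[OF cbilinear_current_outer[OF assms]]
      tensor_lift_tensor_of[OF cbilinear_current[OF assms]]])


section \<open>Kaehler differentials\<close>

text \<open>\<open>\<Omega>\<close> is the free \<open>R\<close>-module on symbols \<open>df\<close> (\<open>f \<in> R\<close>) modulo the \<open>R\<close>-submodule generated by
  the relations of a \<open>\<complex>\<close>-linear derivation.\<close>

abbreviation formal_scale ::
    "'r::comm_ring_1 \<Rightarrow> ('r \<Rightarrow>\<^sub>0 'r) \<Rightarrow> ('r \<Rightarrow>\<^sub>0 'r)" where
  "formal_scale r p \<equiv> Poly_Mapping.map ((*) r) p"

lemma lookup_formal_scale:
  "Poly_Mapping.lookup (formal_scale r p) k = r * Poly_Mapping.lookup p k"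
  by (simp add: Poly_Mapping.map.rep_eq when_def)

global_interpretation formal_diff: module "formal_scale :: 'r::comm_ring_1 \<Rightarrow> _"
  by unfold_locales
    (auto intro!: poly_mapping_eqI simp: lookup_formal_scale lookup_add algebra_simps)

abbreviation formal_d :: "'r \<Rightarrow> ('r \<Rightarrow>\<^sub>0 'r::comm_ring_1)" where
  "formal_d f \<equiv> Poly_Mapping.single f 1"

definition kaehler_relations :: "('r::complex_comm_algebra \<Rightarrow>\<^sub>0 'r) set" where
  "kaehler_relations =
    {formal_d (f + g) - formal_d f - formal_d g | f g. True} \<union>
    {formal_d (z *\<^sub>C f) - formal_scale (z *\<^sub>C 1) (formal_d f) | z f. True} \<union>
    {formal_d (f * g) - formal_scale f (formal_d g) - formal_scale g (formal_d f) | f g. True}"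

quotient_type (overloaded) 'r kaehler =
    "'r::complex_comm_algebra \<Rightarrow>\<^sub>0 'r"
  / "\<lambda>p q. p - q \<in> formal_diff.span kaehler_relations"
  by (rule equivp_mod_subgroup)
    (auto intro: formal_diff.span_zero formal_diff.span_neg formal_diff.span_add)

lift_definition kaehler_scale ::
    "'r::complex_comm_algebra \<Rightarrow> 'r kaehler \<Rightarrow> 'r kaehler" (infixr "*\<^sub>\<Omega>" 75)
  is formal_scale
  by (metis formal_diff.scale_right_diff_distrib formal_diff.span_scale)

instantiation kaehler :: (complex_comm_algebra) complex_vector
begin

lift_definition zero_kaehler :: "'a kaehler" is 0 .
lift_definition plus_kaehler :: "'a kaehler \<Rightarrow> 'a kaehler \<Rightarrow> 'a kaehler" is "(+)"
  by (metis add_diff_add formal_diff.span_add)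
lift_definition minus_kaehler :: "'a kaehler \<Rightarrow> 'a kaehler \<Rightarrow> 'a kaehler" is "(-)"
  by (rule diff_diff_mem) (auto intro: formal_diff.span_diff)
lift_definition uminus_kaehler :: "'a kaehler \<Rightarrow> 'a kaehler" is uminus
  by (metis formal_diff.span_neg minus_diff_minus)
definition scaleC_kaehler :: "complex \<Rightarrow> 'a kaehler \<Rightarrow> 'a kaehler" where
  "scaleC_kaehler z \<omega> = (z *\<^sub>C 1) *\<^sub>\<Omega> \<omega>"

instance
proof
  fix \<omega> \<eta> \<theta> :: "'a kaehler" and z w :: complex
  show "\<omega> + \<eta> + \<theta> = \<omega> + (\<eta> + \<theta>)" "\<omega> + \<eta> = \<eta> + \<omega>" "0 + \<omega> = \<omega>" "- \<omega> + \<omega> = 0" "\<omega> - \<eta> = \<omega> + - \<eta>"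
    by (transfer, simp add: algebra_simps formal_diff.span_zero)+
  show "z *\<^sub>C (\<omega> + \<eta>) = z *\<^sub>C \<omega> + z *\<^sub>C \<eta>"
    unfolding scaleC_kaehler_def
    by transfer (simp add: formal_diff.scale_right_distrib formal_diff.span_zero)
  show "(z + w) *\<^sub>C \<omega> = z *\<^sub>C \<omega> + w *\<^sub>C \<omega>"
    unfolding scaleC_kaehler_def scaleC_add_left
    by transfer (simp add: formal_diff.scale_left_distrib formal_diff.span_zero)
  show "z *\<^sub>C w *\<^sub>C \<omega> = (z * w) *\<^sub>C \<omega>"
    unfolding scaleC_kaehler_def
    by transfer (simp add: scaleC_mult_left scaleC_scaleC formal_diff.span_zero)
  show "1 *\<^sub>C \<omega> = \<omega>"
    unfolding scaleC_kaehler_def scaleC_one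
    by transfer (metis cancel_comm_monoid_add_class.diff_cancel formal_diff.scale_one
        formal_diff.span_zero)
qed

end

lift_definition kaehler_d :: "'r::complex_comm_algebra \<Rightarrow> 'r kaehler" is formal_d .

lemma kaehler_d_add: "kaehler_d (f + g) = kaehler_d f + kaehler_d g"
  by transfer
    (rule formal_diff.span_base, unfold kaehler_relations_def diff_diff_eq[symmetric], blast)

lemma kaehler_d_scaleC: "kaehler_d (z *\<^sub>C f) = z *\<^sub>C kaehler_d f"
  unfolding scaleC_kaehler_def
  by transfer (rule formal_diff.span_base, unfold kaehler_relations_def, blast)

lemma kaehler_d_mult: "kaehler_d (f * g) = f *\<^sub>\<Omega> kaehler_d g + g *\<^sub>\<Omega> kaehler_d f"
  by transfer
    (rule formal_diff.span_base, unfold kaehler_relations_def diff_diff_eq[symmetric], blast)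

lemma subspace_exact: "cvec.subspace (range kaehler_d)"
proof (rule cvec.subspaceI)
  show "0 \<in> range kaehler_d"
    using kaehler_d_scaleC[of 0 0] by (metis cvec.scale_zero_left rangeI)
qed (auto simp flip: kaehler_d_add kaehler_d_scaleC)

quotient_type (overloaded) 'r kaehler_mod_exact =
    "'r::complex_comm_algebra kaehler" / "\<lambda>\<omega> \<eta>. \<omega> - \<eta> \<in> range kaehler_d"
  by (rule equivp_mod_subgroup)
    (auto intro: cvec.subspace_0 cvec.subspace_neg cvec.subspace_add subspace_exact)

instantiation kaehler_mod_exact :: (complex_comm_algebra) complex_vector
begin

lift_definition zero_kaehler_mod_exact :: "'a kaehler_mod_exact" is 0 .
lift_definition plus_kaehler_mod_exact ::
    "'a kaehler_mod_exact \<Rightarrow> 'a kaehler_mod_exact \<Rightarrow> 'a kaehler_mod_exact" is "(+)"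
  by (metis add_diff_add cvec.subspace_add subspace_exact)
lift_definition minus_kaehler_mod_exact ::
    "'a kaehler_mod_exact \<Rightarrow> 'a kaehler_mod_exact \<Rightarrow> 'a kaehler_mod_exact" is "(-)"
  by (rule diff_diff_mem) (auto intro: cvec.subspace_diff[OF subspace_exact])
lift_definition uminus_kaehler_mod_exact :: "'a kaehler_mod_exact \<Rightarrow> 'a kaehler_mod_exact"
  is uminus
  by (metis cvec.subspace_neg minus_diff_minus subspace_exact)
lift_definition scaleC_kaehler_mod_exact ::
    "complex \<Rightarrow> 'a kaehler_mod_exact \<Rightarrow> 'a kaehler_mod_exact" is scaleC
  by (metis cvec.scale_right_diff_distrib cvec.subspace_scale subspace_exact)

instance
  by standard
    (transfer, simp add: algebra_simps scaleC_add_right scaleC_add_left scaleC_scaleC scaleC_one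
      cvec.subspace_0[OF subspace_exact])+

end

definition kaehler_class :: "'r::complex_comm_algebra kaehler \<Rightarrow> 'r kaehler_mod_exact" where
  "kaehler_class = abs_kaehler_mod_exact"


section \<open>The Date-Jimbo-Kashiwara-Miwa ring\<close>

text \<open>The Laurent polynomial ring \<open>\<complex>[t, t\<^sup>-\<^sup>1]\<close> is the type \<open>int \<Rightarrow>\<^sub>0 complex\<close> with the convolution
  product.\<close>

type_synonym laurent = "int \<Rightarrow>\<^sub>0 complex"

definition djkm_relation :: "complex \<Rightarrow> complex \<Rightarrow> laurent poly" where
  "djkm_relation a b =
    (let t = Poly_Mapping.single 1 1; const = Poly_Mapping.single 0; u = [:0, 1:]
     in u ^ 2 - [:(t ^ 2 - const (a ^ 2)) * (t ^ 2 - const (b ^ 2)):])"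

text \<open>A type cannot depend on the complex numbers \<open>a\<close> and \<open>b\<close>. The quotient ring
  \<open>\<complex>[t, t\<^sup>-\<^sup>1][u] / (u\<^sup>2 - (t\<^sup>2 - a\<^sup>2) (t\<^sup>2 - b\<^sup>2))\<close> is therefore given, up to isomorphism, as a type
  \<open>'r\<close> together with its quotient map \<open>q\<close>: a surjective homomorphism of \<open>\<complex>\<close>-algebras whose
  kernel is the principal ideal generated by the relation.\<close>

locale djkm_ring =
  fixes a b :: complex and q :: "laurent poly \<Rightarrow> 'r::complex_comm_algebra"
  assumes q_surj: "surj q"
    and q_add: "q (f + g) = q f + q g"
    and q_mult: "q (f * g) = q f * q g"
    and q_scalar: "q [:Poly_Mapping.single 0 z:] = z *\<^sub>C 1"
    and q_kernel: "q f = 0 \<longleftrightarrow> djkm_relation a b dvd f"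

definition tpow :: "(laurent poly \<Rightarrow> 'r) \<Rightarrow> int \<Rightarrow> 'r" where
  "tpow q i = q [:Poly_Mapping.single i 1:]"

definition uvar :: "(laurent poly \<Rightarrow> 'r) \<Rightarrow> 'r" where
  "uvar q = q [:0, 1:]"

text \<open>\<open>omega q k\<close> is meant for \<open>-4 \<le> k \<le> 0\<close> only.\<close>

definition omega ::
    "(laurent poly \<Rightarrow> 'r::complex_comm_algebra) \<Rightarrow> int \<Rightarrow> 'r kaehler_mod_exact" where
  "omega q k = kaehler_class
    ((if k = 0 then tpow q (-1) else tpow q k * uvar q) *\<^sub>\<Omega> kaehler_d (tpow q 1))"

text \<open>The polynomials \<open>P\<^sub>l\<^sub>,\<^sub>k\<close> in \<open>c\<close>; the values for \<open>k < -4\<close> are irrelevant.\<close>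

function djkm_P :: "int \<Rightarrow> int \<Rightarrow> complex poly" where
  "djkm_P l k =
    (if k < 0 then (if k = l then 1 else 0)
     else smult (1 / of_int (6 + 2 * k))
       (smult (of_int (4 * k)) ([:0, 1:] * djkm_P l (k - 2))
        - smult (of_int (2 * (k - 3))) (djkm_P l (k - 4))))"
  by pat_completeness auto
termination
  by (relation "Wellfounded.measure (\<lambda>(l, k). nat (k + 4))") auto

declare djkm_P.simps [simp del]

definition psi ::
    "(laurent poly \<Rightarrow> 'r::complex_comm_algebra) \<Rightarrow> complex \<Rightarrow> int \<Rightarrow> int \<Rightarrow> 'r kaehler_mod_exact"
  where
  "psi q c i j =
    (let s = i + j; P = (\<lambda>l k. poly (djkm_P l k) c) in
      if s \<in> {1, 0, -1, -2} then omega q (s - 2)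
      else if odd s \<and> s \<ge> 3 then
        P (-3) (s - 2) *\<^sub>C (omega q (-3) + c *\<^sub>C omega q (-1))
      else if odd s \<and> s \<le> -3 then
        P (-3) (\<bar>s\<bar> - 2) *\<^sub>C (c *\<^sub>C omega q (-3) + omega q (-1))
      else
        P (-4) (\<bar>s\<bar> - 2) *\<^sub>C omega q (-4) + P (-2) (\<bar>s\<bar> - 2) *\<^sub>C omega q (-2))"


section \<open>The extended algebra\<close>

text \<open>The extension lives in \<open>(\<gg> \<otimes> R) \<times> (\<Omega> / dR)\<close>, with covering map \<open>fst\<close>. Its even and odd parts
  are \<open>hat0\<close> and \<open>hat1\<close>.\<close>

definition hat0 :: "(laurent poly \<Rightarrow> 'r::complex_comm_algebra) \<Rightarrow>
    (('g::complex_vector, 'r) tensor \<times> 'r kaehler_mod_exact) set" where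
  "hat0 q = cvec.span {x \<otimes>\<^sub>C q [:f:] | x f. True} \<times> cvec.span {omega q 0}"

definition hat1 :: "(laurent poly \<Rightarrow> 'r::complex_comm_algebra) \<Rightarrow>
    (('g::complex_vector, 'r) tensor \<times> 'r kaehler_mod_exact) set" where
  "hat1 q = cvec.span {x \<otimes>\<^sub>C (q [:f:] * uvar q) | x f. True} \<times>
    cvec.span {omega q (-4), omega q (-3), omega q (-2), omega q (-1)}"

definition hat :: "(laurent poly \<Rightarrow> 'r::complex_comm_algebra) \<Rightarrow>
    (('g::complex_vector, 'r) tensor \<times> 'r kaehler_mod_exact) set" where
  "hat q = subspace_sum (hat0 q) (hat1 q)"

definition is_hat_bracket ::
    "(laurent poly \<Rightarrow> 'r::complex_comm_algebra) \<Rightarrow> complex \<Rightarrow> ('g::complex_vector \<Rightarrow> 'g \<Rightarrow> 'g) \<Rightarrow>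
     (('g, 'r) tensor \<times> 'r kaehler_mod_exact \<Rightarrow> ('g, 'r) tensor \<times> 'r kaehler_mod_exact \<Rightarrow>
      ('g, 'r) tensor \<times> 'r kaehler_mod_exact) \<Rightarrow> bool" where
  "is_hat_bracket q c br B \<longleftrightarrow>
    bilinear_on (hat q) B \<and>
    (\<forall>X\<in>hat q. B X X = 0) \<and>
    (\<forall>k\<in>{-4..0}. \<forall>X\<in>hat q. B (0, omega q k) X = 0) \<and>
    (\<forall>x y i j.
      B (x \<otimes>\<^sub>C tpow q i, 0) (y \<otimes>\<^sub>C tpow q j, 0) =
        (br x y \<otimes>\<^sub>C tpow q (i + j),
         ((if i + j = 0 then of_int j else 0) * killing_form br x y) *\<^sub>C omega q 0) \<and>
      B (x \<otimes>\<^sub>C (tpow q (i - 1) * uvar q), 0) (y \<otimes>\<^sub>C (tpow q (j - 1) * uvar q), 0) =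
        (br x y \<otimes>\<^sub>C (tpow q (i + j + 2) - (2 * c) *\<^sub>C tpow q (i + j) + tpow q (i + j - 2)),
         (((if i + j = -2 then of_int (j + 1) else 0)
           - (if i + j = 0 then 2 * c * of_int j else 0)
           + (if i + j = 2 then of_int (j - 1) else 0)) * killing_form br x y) *\<^sub>C omega q 0) \<and>
      B (x \<otimes>\<^sub>C (tpow q (i - 1) * uvar q), 0) (y \<otimes>\<^sub>C tpow q j, 0) =
        (br x y \<otimes>\<^sub>C (tpow q (i + j - 1) * uvar q),
         (of_int j * killing_form br x y) *\<^sub>C psi q c i j))"

end

(*
A central extension F of the current algebra is a module over g, because central elements act
trivially. The Casimir operator of the Killing form acts on the adjoint representation by 1 and on the
kernel of F by 0, so it splits F equivariantly. The defect of the splitting from being a homomorphism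
is a g-invariant bilinear form for fixed ring elements r and s, hence by Schur's lemma the Killing
form times some lambda(r, s); the cocycle identity says precisely that lambda factors through
r ds in Omega/dR. So the cocycle (x,y) r ds is universal (Kassel). This needs the Killing form
to be nondegenerate: if it vanished, every ad x would be nilpotent, contradicting Engel's theorem.

For the DJKM ring the classes I_k of t^k u dt satisfy the recursion defining P_{l,k} because
d(t^{k-3} u^3) = 0, so psi_ij is the class of t^{i+j-2} u dt. The omegas are independent because
r ds -> r D(s), with D the derivation D(t) = u, maps Omega/dR to R/D(R), on which enough
linear functionals can be written down; the determinant that occurs is c^2 - 1, nonzero for a and b
distinct up to sign.
*)

theory Submission
  imports Defs "HOL-Computational_Algebra.Fundamental_Theorem_Algebra"
begin

text \<open>The competing extension \<open>F\<close> may have infinite dimension, so complete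
  reducibility is not at hand. All that is wanted from it is a section of \<open>\<rho>\<close>
  commuting with \<open>\<gg> \<otimes> 1\<close>, and the Casimir operator yields one by a finite
  sum. Equivariance does double duty: it makes the defect invariant, and it makes the defect vanish
  when its first argument lies in \<open>\<gg> \<otimes> 1\<close>. The latter is the relation
  \<open>lam 1 f = 0\<close>, which kills exact differentials; the product rule comes from the
  cocycle identity. The derivation D comes from the curve u^2 = t^4 - 2ct^2 + 1, smooth for c^2
  \<noteq> 1: its differentials are free on dt/u, and r ds = r D(s) dt/u. So a functional on
  Omega/dR is a functional on R that vanishes on D(R). On the Laurent part this is a three-term
  recursion in steps of two whose outer coefficients vanish at n = 1 and n = -1; solving it outwards
  leaves the values at -1, 0, 1, 2 free. Matching them to the classes of t^k u dt splits by parity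
  into two 2 by 2 systems, each with determinant 1 - c^2 up to a scalar.\<close>

section \<open>Complex linear and bilinear maps\<close>

lemma clinearI:
  assumes "\<And>x y. f (x + y) = f x + f y" "\<And>z x. f (z *\<^sub>C x) = z *\<^sub>C f x"
  shows "clinear f"
  using assms by (simp add: clinear_def)

lemma clinear_add: "clinear f \<Longrightarrow> f (x + y) = f x + f y"
  and clinear_scale: "clinear f \<Longrightarrow> f (z *\<^sub>C x) = z *\<^sub>C f x"
  by (simp_all add: clinear_def)

lemma clinear_zero: "clinear f \<Longrightarrow> f 0 = 0"
  by (metis add_cancel_right_right clinear_add)

lemma clinear_neg: "clinear f \<Longrightarrow> f (- x) = - f x"
  using clinear_add[of f x "- x"] by (simp add: clinear_zero eq_neg_iff_add_eq_0 add.commute)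

lemma clinear_diff: "clinear f \<Longrightarrow> f (x - y) = f x - f y"
  using clinear_add[of f x "- y"] by (simp add: clinear_neg)

lemma clinear_sum: "clinear f \<Longrightarrow> f (\<Sum>i\<in>S. g i) = (\<Sum>i\<in>S. f (g i))"
  by (induction S rule: infinite_finite_induct) (auto simp: clinear_zero clinear_add)

lemmas clinear_simps = clinear_add clinear_scale clinear_zero clinear_neg clinear_diff clinear_sum

lemma clinear_comp: "clinear f \<Longrightarrow> clinear g \<Longrightarrow> clinear (\<lambda>x. f (g x))"
  by (simp add: clinear_def)

lemma clinear_ident: "clinear (\<lambda>x. x)"
  by (simp add: clinear_def)

lemma clinear_const_zero: "clinear (\<lambda>x. 0)"
  by (simp add: clinear_def)

lemma clinear_plus: "clinear f \<Longrightarrow> clinear g \<Longrightarrow> clinear (\<lambda>x. f x + g x)"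
  by (simp add: clinear_def scaleC_add_right)

lemma clinear_uminus: "clinear f \<Longrightarrow> clinear (\<lambda>x. - f x)"
  by (simp add: clinear_def)

lemma clinear_scaleC: "clinear f \<Longrightarrow> clinear (\<lambda>x. z *\<^sub>C f x)"
  by (simp add: clinear_def scaleC_add_right scaleC_scaleC mult.commute)

lemma clinear_scale_left: "clinear (f :: _ \<Rightarrow> complex) \<Longrightarrow> clinear (\<lambda>x. f x *\<^sub>C v)"
  by (simp add: clinear_def scaleC_add_left scaleC_scaleC scaleC_complex_def)

lemma clinear_sum_fun: "(\<And>i. i \<in> S \<Longrightarrow> clinear (f i)) \<Longrightarrow> clinear (\<lambda>x. \<Sum>i\<in>S. f i x)"
  by (induction S rule: infinite_finite_induct) (auto intro: clinear_plus clinear_const_zero)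

lemma clinear_funpow: "clinear (f :: 'a::complex_vector \<Rightarrow> 'a) \<Longrightarrow> clinear (f ^^ n)"
  by (induction n) (auto simp: clinear_def)

lemma cbilinearI:
  assumes "\<And>x. clinear (h x)" "\<And>y. clinear (\<lambda>x. h x y)"
  shows "cbilinear h"
  using assms by (simp add: cbilinear_def)

lemma cbilinearD:
  assumes "cbilinear h"
  shows "clinear (h x)" "clinear (\<lambda>x. h x y)"
  using assms by (simp_all add: cbilinear_def)

lemma subspace_clinear_eq:
  assumes "clinear f" "clinear g"
  shows "cvec.subspace {x. f x = g x}"
  using assms by (auto simp: cvec.subspace_def clinear_simps)

lemma clinear_eq_on_span:
  assumes "clinear f" "clinear g" "\<And>x. x \<in> S \<Longrightarrow> f x = g x" "x \<in> cvec.span S"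
  shows "f x = g x"
  using cvec.span_minimal[OF _ subspace_clinear_eq[OF assms(1,2)], of S] assms(3,4) by auto

lemma subspace_clinear_vimage:
  assumes "clinear f" "cvec.subspace U"
  shows "cvec.subspace {x. f x \<in> U}"
  using assms by (auto simp: cvec.subspace_def clinear_simps)

lemma clinear_span_subset:
  assumes "clinear f" "cvec.subspace U" "\<And>x. x \<in> S \<Longrightarrow> f x \<in> U" "x \<in> cvec.span S"
  shows "f x \<in> U"
  using cvec.span_minimal[OF _ subspace_clinear_vimage[OF assms(1,2)], of S] assms(3,4) by auto

lemma cbilinear_span_mem:
  assumes "cbilinear h" "cvec.subspace U" "\<And>x y. x \<in> S \<Longrightarrow> y \<in> T \<Longrightarrow> h x y \<in> U"
    "X \<in> cvec.span S" "Y \<in> cvec.span T"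
  shows "h X Y \<in> U"
  using cbilinearD(2)[OF assms(1)] assms(2) _ assms(4)
proof (rule clinear_span_subset)
  show "h x Y \<in> U" if "x \<in> S" for x
    using cbilinearD(1)[OF assms(1)] assms(2) _ assms(5)
    by (rule clinear_span_subset) (rule assms(3)[OF that])
qed


section \<open>Bases and traces\<close>

definition is_basis :: "'a::complex_vector set \<Rightarrow> bool" where
  "is_basis B \<longleftrightarrow> finite B \<and> cvec.independent B \<and> cvec.span B = UNIV"

lemma finite_independent:
  assumes "finite_dimensional (UNIV :: 'a::complex_vector set)"
    and "cvec.independent (B :: 'a set)"
  shows "finite B"
  using assms cvec.independent_span_bound unfolding finite_dimensional_def by blast

lemma clinear_representation:
  assumes "is_basis B"
  shows "clinear (\<lambda>v. cvec.representation B v b)"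
  using assms by (auto simp: is_basis_def clinear_def cvec.representation_add
      cvec.representation_scale scaleC_complex_def)

lemma basis_expansion:
  assumes "is_basis B"
  shows "(\<Sum>b\<in>B. cvec.representation B v b *\<^sub>C b) = v"
  using assms by (auto simp: is_basis_def cvec.sum_representation_eq)

lemma representation_basis_apply:
  assumes "is_basis B" "b \<in> B"
  shows "cvec.representation B b c = (if c = b then 1 else 0)"
  using assms by (simp add: is_basis_def cvec.representation_basis)

lemma representation_comp:
  assumes B: "is_basis B" and f: "clinear f"
  shows "cvec.representation B (f v) b =
    (\<Sum>c\<in>B. cvec.representation B v c * cvec.representation B (f c) b)"
proof -
  have "clinear (\<lambda>v. cvec.representation B (f v) b)"
    by (rule clinear_comp[OF clinear_representation[OF B] f])
  from clinear_sum[OF this, of "\<lambda>c. cvec.representation B v c *\<^sub>C c" B] show ?thesis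
    by (simp add: basis_expansion[OF B] clinear_scale[OF \<open>clinear (\<lambda>v. cvec.representation B (f v) b)\<close>]
        scaleC_complex_def)
qed

lemma trace_wrt_comp:
  assumes "is_basis B" "clinear f"
  shows "trace_wrt B (\<lambda>x. f (g x)) =
    (\<Sum>b\<in>B. \<Sum>c\<in>B. cvec.representation B (g b) c * cvec.representation B (f c) b)"
  unfolding trace_wrt_def using representation_comp[OF assms] by (intro sum.cong) blast+

lemma trace_wrt_commute:
  assumes "is_basis B" "clinear f" "clinear g"
  shows "trace_wrt B (\<lambda>x. f (g x)) = trace_wrt B (\<lambda>x. g (f x))"
proof -
  let ?r = "cvec.representation B"
  have "(\<Sum>b\<in>B. \<Sum>c\<in>B. ?r (g b) c * ?r (f c) b) = (\<Sum>c\<in>B. \<Sum>b\<in>B. ?r (g b) c * ?r (f c) b)"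
    by (rule sum.swap)
  also have "\<dots> = (\<Sum>c\<in>B. \<Sum>b\<in>B. ?r (f c) b * ?r (g b) c)"
    by (intro sum.cong refl) (rule mult.commute)
  finally show ?thesis
    by (simp only: trace_wrt_comp[OF assms(1,2)] trace_wrt_comp[OF assms(1,3)])
qed

lemma trace_wrt_add:
  assumes "is_basis B"
  shows "trace_wrt B (\<lambda>x. f x + g x) = trace_wrt B f + trace_wrt B g"
  by (simp add: trace_wrt_def clinear_simps(1)[OF clinear_representation[OF assms]] sum.distrib)

lemma trace_wrt_scale:
  assumes "is_basis B"
  shows "trace_wrt B (\<lambda>x. z *\<^sub>C f x) = z * trace_wrt B f"
  by (simp add: trace_wrt_def clinear_simps(2)[OF clinear_representation[OF assms]]
      sum_distrib_left scaleC_complex_def)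

lemma trace_wrt_diff:
  assumes "is_basis B"
  shows "trace_wrt B (\<lambda>x. f x - g x) = trace_wrt B f - trace_wrt B g"
  by (simp add: trace_wrt_def clinear_diff[OF clinear_representation[OF assms]] sum_subtractf)


section \<open>Generalized eigenspaces\<close>

definition shift :: "('a::complex_vector \<Rightarrow> 'a) \<Rightarrow> complex \<Rightarrow> 'a \<Rightarrow> 'a" where
  "shift T l v = T v - l *\<^sub>C v"

text \<open>The exponent depends on \<open>v\<close>, so membership is witnessed vector by vector;
  induction on the exponent drives \<open>geig_solve\<close> and
  \<open>geig_bracket\<close>.\<close>

definition geig :: "('a::complex_vector \<Rightarrow> 'a) \<Rightarrow> complex \<Rightarrow> 'a set" where
  "geig T l = {v. \<exists>n. (shift T l ^^ n) v = 0}"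

lemma geigI: "(shift T l ^^ n) v = 0 \<Longrightarrow> v \<in> geig T l"
  by (auto simp: geig_def)

lemma funpow_zero_mono:
  fixes f :: "'a::complex_vector \<Rightarrow> 'a"
  assumes "clinear f" "(f ^^ n) v = 0" "n \<le> m"
  shows "(f ^^ m) v = 0"
proof -
  have "(f ^^ m) v = (f ^^ (m - n)) ((f ^^ n) v)"
    using assms(3) by (metis comp_apply funpow_add le_add_diff_inverse2)
  then show ?thesis
    by (simp add: assms(2) clinear_zero[OF clinear_funpow[OF assms(1)]])
qed

lemma clinear_shift: "clinear T \<Longrightarrow> clinear (shift T l)"
  by (simp add: clinear_def shift_def scaleC_add_right scaleC_scaleC mult.commute cvec.scale_right_diff_distrib)

lemma geig_shift_iff: "shift T l v \<in> geig T l \<longleftrightarrow> v \<in> geig T l" if T: "clinear T"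
proof
  assume "shift T l v \<in> geig T l"
  then obtain n where "(shift T l ^^ n) (shift T l v) = 0"
    by (auto simp: geig_def)
  then have "(shift T l ^^ Suc n) v = 0"
    by (simp only: funpow_Suc_right comp_apply)
  then show "v \<in> geig T l"
    by (rule geigI)
next
  assume "v \<in> geig T l"
  then obtain n where "(shift T l ^^ n) v = 0"
    by (auto simp: geig_def)
  then have "(shift T l ^^ Suc n) v = 0"
    by (rule funpow_zero_mono[OF clinear_shift[OF T]]) simp
  then have "(shift T l ^^ n) (shift T l v) = 0"
    by (simp only: funpow_Suc_right comp_apply)
  then show "shift T l v \<in> geig T l"
    by (rule geigI)
qed

lemma subspace_geig:
  assumes "clinear T"
  shows "cvec.subspace (geig T l)"
proof -
  let ?N = "shift T l"
  have N: "clinear ?N" by (rule clinear_shift[OF assms])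
  note P = clinear_funpow[OF N]
  have "0 \<in> geig T l"
    by (auto simp: geig_def intro!: exI[of _ 0])
  moreover have "v + w \<in> geig T l" if vw: "v \<in> geig T l" "w \<in> geig T l" for v w
  proof -
    obtain n where "(?N ^^ n) v = 0"
      using vw by (auto simp: geig_def)
    moreover obtain m where "(?N ^^ m) w = 0"
      using vw by (auto simp: geig_def)
    ultimately have "(?N ^^ (n + m)) v = 0" "(?N ^^ (n + m)) w = 0"
      by (auto intro: funpow_zero_mono[OF N])
    then have "(?N ^^ (n + m)) (v + w) = 0"
      by (simp add: clinear_add[OF P])
    then show ?thesis by (rule geigI)
  qed
  moreover have "z *\<^sub>C v \<in> geig T l" if "v \<in> geig T l" for z v
    using that clinear_scale[OF P] by (force simp: geig_def)
  ultimately show ?thesis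
    by (auto simp: cvec.subspace_def)
qed

text \<open>T - l is the nonzero scalar m - l plus the locally nilpotent T - m, hence invertible on
  this space. The induction on the exponent builds the preimage one term of the geometric series at
  a time.\<close>

lemma geig_solve:
  assumes T: "clinear T" and "m \<noteq> l" "w \<in> geig T m"
  shows "\<exists>u\<in>geig T m. shift T l u = w"
proof -
  let ?N = "shift T m"
  have "(?N ^^ n) w = 0 \<Longrightarrow> ?thesis" for n
  proof (induction n arbitrary: w)
    case 0
    then show ?case
      by (intro bexI[of _ 0]) (auto simp: clinear_zero[OF clinear_shift[OF T]] cvec.subspace_0[OF subspace_geig[OF T]])
  next
    case (Suc n)
    from Suc.prems have "(?N ^^ n) (?N w) = 0"
      by (simp only: funpow_Suc_right comp_apply)
    from Suc.IH[OF this] obtain u where u: "u \<in> geig T m" "shift T l u = ?N w" by blast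
    have w: "w \<in> geig T m"
      using Suc.prems by (rule geigI)
    \<comment> \<open>(T - l)(w - u) = (T - l) w - (T - m) w = (m - l) w, whence the factor.\<close>
    let ?u = "(1 / (m - l)) *\<^sub>C (w - u)"
    have "?u \<in> geig T m"
      using w u(1) subspace_geig[OF T] by (intro cvec.subspace_scale cvec.subspace_diff)
    moreover have "shift T l ?u = (1 / (m - l)) *\<^sub>C (shift T l w - (shift T l u))"
      by (simp only: clinear_scale[OF clinear_shift[OF T]] clinear_diff[OF clinear_shift[OF T]])
    moreover have "shift T l w - ?N w = (m - l) *\<^sub>C w"
      by (simp add: shift_def cvec.scale_left_diff_distrib)
    ultimately show ?case
      using assms(2) u(2) by (intro bexI[of _ ?u]) (simp_all add: scaleC_scaleC scaleC_one)
  qed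
  then show ?thesis
    using assms(3) by (auto simp: geig_def)
qed

definition poly_act :: "('a::complex_vector \<Rightarrow> 'a) \<Rightarrow> complex poly \<Rightarrow> 'a \<Rightarrow> 'a" where
  "poly_act T p v = (\<Sum>i\<le>degree p. coeff p i *\<^sub>C (T ^^ i) v)"

lemma poly_act_bound:
  assumes "degree p \<le> n"
  shows "poly_act T p v = (\<Sum>i\<le>n. coeff p i *\<^sub>C (T ^^ i) v)"
  unfolding poly_act_def using assms
  by (intro sum.mono_neutral_left) (auto simp: coeff_eq_0)

text \<open>Moves a linear factor from the polynomial to the vector, so that
  \<open>span_geig\<close> can induct on the degree.\<close>

lemma poly_act_mult_linear:
  assumes T: "clinear T"
  shows "poly_act T ([:- l, 1:] * p) v = poly_act T p (shift T l v)"
proof -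
  let ?n = "degree p"
  have d: "degree ([:- l, 1:] * p) \<le> Suc ?n"
    by (rule order.trans[OF degree_mult_le]) simp
  have "[:- l, 1:] * p = pCons 0 p - smult l p"
    by simp
  then have c: "coeff ([:- l, 1:] * p) i = coeff (pCons 0 p) i - l * coeff p i" for i
    by (metis coeff_diff coeff_smult)
  have "poly_act T ([:- l, 1:] * p) v =
      (\<Sum>i\<le>Suc ?n. coeff (pCons 0 p) i *\<^sub>C (T ^^ i) v) - (\<Sum>i\<le>Suc ?n. (l * coeff p i) *\<^sub>C (T ^^ i) v)"
    unfolding poly_act_bound[OF d] c by (simp only: cvec.scale_left_diff_distrib sum_subtractf)
  also have "(\<Sum>i\<le>Suc ?n. coeff (pCons 0 p) i *\<^sub>C (T ^^ i) v) = (\<Sum>i\<le>?n. coeff p i *\<^sub>C (T ^^ i) (T v))"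
    by (subst sum.atMost_Suc_shift) (simp add: funpow_swap1)
  also have "(\<Sum>i\<le>Suc ?n. (l * coeff p i) *\<^sub>C (T ^^ i) v) = (\<Sum>i\<le>?n. coeff p i *\<^sub>C (T ^^ i) (l *\<^sub>C v))"
    by (simp add: coeff_eq_0 clinear_scale[OF clinear_funpow[OF T]] scaleC_scaleC mult.commute)
  finally show ?thesis
    by (simp only: poly_act_def shift_def clinear_diff[OF clinear_funpow[OF T]]
        cvec.scale_right_diff_distrib sum_subtractf)
qed

lemma ex_annihilating_poly:
  fixes T :: "'a::complex_vector \<Rightarrow> 'a"
  assumes fd: "finite_dimensional (UNIV :: 'a set)"
  shows "\<exists>p. p \<noteq> 0 \<and> poly_act T p v = 0"
proof -
  obtain S :: "'a set" where S: "finite S" "cvec.span S = UNIV"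
    using fd by (auto simp: finite_dimensional_def)
  let ?n = "card S" and ?f = "\<lambda>i. (T ^^ i) v"
  show ?thesis
  proof (cases "inj_on ?f {..?n}")
    case True
    then have "card (?f ` {..?n}) = Suc ?n"
      by (simp add: card_image)
    then have "cvec.dependent (?f ` {..?n})"
      using cvec.independent_span_bound[OF S(1), of "?f ` {..?n}"] S(2) by auto
    then obtain k where k: "\<exists>w\<in>?f ` {..?n}. k w \<noteq> 0" "(\<Sum>w\<in>?f ` {..?n}. k w *\<^sub>C w) = 0"
      using cvec.dependent_finite[of "?f ` {..?n}"] by auto
    define p where "p = (\<Sum>i\<le>?n. monom (k (?f i)) i)"
    have c: "coeff p i = (if i \<le> ?n then k (?f i) else 0)" for i
      by (simp add: p_def coeff_sum coeff_monom_Suc)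
    have "degree p \<le> ?n"
      by (rule degree_le) (simp add: c)
    then have "poly_act T p v = (\<Sum>i\<le>?n. k (?f i) *\<^sub>C ?f i)"
      by (subst poly_act_bound) (auto simp: c)
    also have "\<dots> = 0"
      using k(2) by (simp add: sum.reindex[OF True])
    finally show ?thesis
      using k(1) c by (metis (no_types, lifting) atMost_iff coeff_0 imageE)
  next
    \<comment> \<open>Linear dependence is a property of sets, so a repetition among the iterates is
      treated apart; it gives the polynomial x^i - x^j.\<close>
    case False
    then obtain i j where ij: "i \<noteq> j" "?f i = ?f j"
      by (auto simp: inj_on_def)
    define p :: "complex poly" where "p = monom 1 i - monom 1 j"
    have c: "coeff p k = (if k = i then 1 else 0) - (if k = j then 1 else 0)" for k
      by (simp add: p_def)
    have "coeff p i \<noteq> 0" using ij by (simp add: c)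
    then have "p \<noteq> 0" by auto
    moreover have "degree p \<le> max i j"
      by (rule degree_le) (auto simp: c)
    then have "poly_act T p v = (\<Sum>k\<le>max i j. (if k = i then ?f i else 0) - (if k = j then ?f j else 0))"
      using ij(1) by (subst poly_act_bound) (auto simp: c scaleC_one intro!: sum.cong)
    then have "poly_act T p v = 0"
      using ij(2) by (simp add: sum_subtractf)
    ultimately show ?thesis by blast
  qed
qed

text \<open>Peels off one root l of an annihilating polynomial at a time. Once (T - l) v lies in the
  span, some u in the span has (T - l)(v - u) in \<open>geig T l\<close>, and this puts v - u itself
  into \<open>geig T l\<close>.\<close>

lemma span_geig:
  fixes T :: "'a::complex_vector \<Rightarrow> 'a"
  assumes fd: "finite_dimensional (UNIV :: 'a set)" and T: "clinear T"
  shows "cvec.span (\<Union>l. geig T l) = UNIV"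
proof -
  let ?U = "cvec.span (\<Union>l. geig T l)"
  \<comment> \<open>Modulo \<open>geig T l\<close>, T - l is onto, because it is invertible on every
    other generalized eigenspace.\<close>
  have solve: "\<exists>u\<in>?U. w - (shift T l u) \<in> geig T l" if "w \<in> ?U" for w l
    using that
  proof (induction rule: cvec.span_induct_alt)
    case base
    show ?case
      using clinear_zero[OF clinear_shift[OF T]] cvec.subspace_0[OF subspace_geig[OF T]]
      by (auto intro!: bexI[of _ 0] simp: cvec.span_zero)
  next
    case (step z x y)
    from step(2) obtain u where u: "u \<in> ?U" "y - (shift T l u) \<in> geig T l" by blast
    from step(1) obtain m where m: "x \<in> geig T m" by blast
    show ?case
    proof (cases "m = l")
      case True
      then have "z *\<^sub>C x + (y - (shift T l u)) \<in> geig T l"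
        using m u(2) by (intro cvec.subspace_add cvec.subspace_scale subspace_geig[OF T]) auto
      then show ?thesis
        using u(1) by (intro bexI[of _ u]) (simp_all add: algebra_simps)
    next
      case False
      from geig_solve[OF T False m] obtain x' where x': "x' \<in> geig T m" "shift T l x' = x" by blast
      let ?u = "z *\<^sub>C x' + u"
      have "?u \<in> ?U"
        using x'(1) u(1) by (intro cvec.span_add cvec.span_scale) (auto intro: cvec.span_base)
      moreover have "shift T l ?u = z *\<^sub>C (shift T l x') + (shift T l u)"
        by (simp only: clinear_scale[OF clinear_shift[OF T]] clinear_add[OF clinear_shift[OF T]])
      then have "z *\<^sub>C x + y - (shift T l ?u) = y - (shift T l u)"
        by (simp add: x'(2))
      ultimately show ?thesis
        using u(2) by (intro bexI[of _ ?u]) (simp_all only:)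
    qed
  qed
  have main: "p \<noteq> 0 \<Longrightarrow> poly_act T p v = 0 \<Longrightarrow> v \<in> ?U" for p v
  proof (induction "degree p" arbitrary: p v)
    case 0
    then have "coeff p 0 \<noteq> 0"
      by (metis leading_coeff_0_iff)
    with 0 have "v = 0"
      by (simp add: poly_act_def)
    then show ?case by (simp add: cvec.span_zero)
  next
    case (Suc n)
    then have "\<not> constant (poly p)"
      by (simp add: constant_degree)
    then obtain l where "poly p l = 0"
      using fundamental_theorem_of_algebra by blast
    then obtain r where r: "p = [:- l, 1:] * r"
      by (auto simp: poly_eq_0_iff_dvd dvd_def)
    with Suc.prems have "r \<noteq> 0" by auto
    then have "degree r = n"
      using Suc.hyps(2) by (simp add: r degree_mult_eq del: mult_pCons_left)
    with Suc.hyps(1)[of r] \<open>r \<noteq> 0\<close> Suc.prems(2) have "shift T l v \<in> ?U"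
      by (simp add: r poly_act_mult_linear[OF T] del: mult_pCons_left)
    from solve[OF this, of l] obtain u where u: "u \<in> ?U" "shift T l v - (shift T l u) \<in> geig T l"
      by blast
    have "shift T l (v - u) \<in> geig T l"
      using u(2) by (simp only: clinear_diff[OF clinear_shift[OF T]])
    then have "v - u \<in> ?U"
      by (auto simp: geig_shift_iff[OF T] intro: cvec.span_base)
    with u(1) show ?case
      using cvec.span_add[of "v - u" _ u] by simp
  qed
  have "v \<in> ?U" for v
    using ex_annihilating_poly[OF fd, of T v] main by (elim exE conjE)
  then show ?thesis by auto
qed

text \<open>The last nonzero power of T - l on a generalized eigenvector gives an eigenvector. The
  vector \<open>x\<close> records that the space is nonzero.\<close>

lemma ex_eigenvector:
  fixes T :: "'a::complex_vector \<Rightarrow> 'a"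
  assumes fd: "finite_dimensional (UNIV :: 'a set)" and T: "clinear T" and "(x::'a) \<noteq> 0"
  shows "\<exists>l v. v \<noteq> 0 \<and> T v = l *\<^sub>C v"
proof -
  have "\<exists>l. \<exists>v\<in>geig T l. v \<noteq> 0"
  proof (rule ccontr)
    assume "\<not> ?thesis"
    then have "(\<Union>l. geig T l) \<subseteq> {0}" by blast
    then have "cvec.span (\<Union>l. geig T l) \<subseteq> {0}"
      using cvec.span_minimal[OF _ cvec.subspace_single_0] by blast
    then show False
      using span_geig[OF fd T] \<open>x \<noteq> 0\<close> by blast
  qed
  then obtain l v n where v: "v \<noteq> 0" "(shift T l ^^ n) v = 0"
    by (auto simp: geig_def)
  define m where "m = (LEAST n. (shift T l ^^ n) v = 0)"
  have m: "(shift T l ^^ m) v = 0"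
    unfolding m_def by (rule LeastI[of _ n]) (rule v(2))
  with v(1) obtain k where k: "m = Suc k"
    by (cases m) auto
  let ?w = "(shift T l ^^ k) v"
  have "?w \<noteq> 0"
    using not_less_Least[of k "\<lambda>n. (shift T l ^^ n) v = 0"] k m_def by auto
  moreover have "shift T l ?w = 0"
    using m k by simp
  ultimately show ?thesis by (auto simp: shift_def)
qed


section \<open>Triangular bases\<close>

text \<open>\<open>B\<close> consists of generalized eigenvectors (\<open>b\<close> for the eigenvalue \<open>lam b\<close>) and can be ordered so that
  \<open>T\<close> is upper triangular.\<close>

inductive tri :: "('a::complex_vector \<Rightarrow> 'a) \<Rightarrow> ('a \<Rightarrow> complex) \<Rightarrow> 'a set \<Rightarrow> bool"
  for T lam where
  empty: "tri T lam {}"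
| insert: "tri T lam B \<Longrightarrow> v \<notin> cvec.span B \<Longrightarrow> v \<in> geig T (lam v) \<Longrightarrow>
    shift T (lam v) v \<in> cvec.span B \<Longrightarrow> tri T lam (insert v B)"

text \<open>\<open>ex_tri_basis\<close> redefines \<open>lam\<close> at a vector outside
  \<open>B\<close> before inserting that vector.\<close>

lemma tri_cong:
  assumes "tri T lam B" "\<And>b. b \<in> B \<Longrightarrow> lam' b = lam b"
  shows "tri T lam' B"
  using assms
proof (induction rule: tri.induct)
  case empty
  show ?case by (rule tri.empty)
next
  case (insert B v)
  then show ?case by (intro tri.insert) auto
qed

lemma tri_finite: "tri T lam B \<Longrightarrow> finite B"
  by (induction rule: tri.induct) auto

lemma tri_independent: "tri T lam B \<Longrightarrow> cvec.independent B"
  by (induction rule: tri.induct)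
    (simp_all add: cvec.independent_empty cvec.independent_insertI)

lemma tri_geig_mem: "tri T lam B \<Longrightarrow> b \<in> B \<Longrightarrow> b \<in> geig T (lam b)"
  by (induction rule: tri.induct) auto

lemma tri_shift_span: "tri T lam B \<Longrightarrow> b \<in> B \<Longrightarrow> shift T (lam b) b \<in> cvec.span (B - {b})"
proof (induction rule: tri.induct)
  case (insert B v)
  show ?case
  proof (cases "b = v")
    case True
    have "v \<notin> B" using insert.hyps(2) cvec.span_base by blast
    then show ?thesis using True insert.hyps(4) by simp
  next
    case False
    then show ?thesis
      using insert cvec.span_mono[of "B - {b}" "insert v B - {b}"] by blast
  qed
qed auto

lemma tri_stable:
  assumes "tri T lam B" "clinear T" "u \<in> cvec.span B"
  shows "T u \<in> cvec.span B"
  using assms(2) cvec.subspace_span _ assms(3)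
proof (rule clinear_span_subset)
  fix b assume b: "b \<in> B"
  have "shift T (lam b) b \<in> cvec.span B"
    using tri_shift_span[OF assms(1) b] cvec.span_mono[of "B - {b}" B] by blast
  then have "shift T (lam b) b + lam b *\<^sub>C b \<in> cvec.span B"
    using b by (intro cvec.span_add cvec.span_scale) (auto intro: cvec.span_base)
  then show "T b \<in> cvec.span B"
    by (simp add: shift_def)
qed

lemma tri_shift_stable:
  assumes "tri T lam B" "clinear T" "u \<in> cvec.span B"
  shows "shift T l u \<in> cvec.span B"
  unfolding shift_def by (intro cvec.span_diff cvec.span_scale tri_stable[OF assms] assms(3))

lemma geig_funpow_mem:
  assumes "clinear T" "v \<in> geig T l"
  shows "(shift T l ^^ n) v \<in> geig T l"
  by (induction n) (auto simp: assms geig_shift_iff[OF assms(1)])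

text \<open>Turns nilpotency into a vector that is outside a subspace but is sent into it; used both
  for triangular bases and in Engel's theorem.\<close>

lemma funpow_last_outside:
  assumes "v \<notin> U" "(f ^^ n) v \<in> U"
  obtains k where "(f ^^ k) v \<notin> U" "f ((f ^^ k) v) \<in> U"
proof -
  have "\<exists>k. (f ^^ k) v \<notin> U \<and> (f ^^ Suc k) v \<in> U"
    using assms(2)
  proof (induction n)
    case 0
    then show ?case using assms(1) by simp
  next
    case (Suc n)
    then show ?case by blast
  qed
  then show ?thesis using that by auto
qed

text \<open>A triangular set of maximal size spans. Otherwise \<open>span_geig\<close> provides a
  generalized eigenvector outside its span, and the last iterate of it under T - l that is still
  outside can be inserted.\<close>

lemma ex_tri_basis:
  fixes T :: "'a::complex_vector \<Rightarrow> 'a"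
  assumes fd: "finite_dimensional (UNIV :: 'a set)" and T: "clinear T"
  obtains lam B where "tri T lam B" "is_basis B"
proof -
  obtain S :: "'a set" where S: "finite S" "cvec.span S = UNIV"
    using fd by (auto simp: finite_dimensional_def)
  have bound: "card B \<le> card S" if "\<exists>lam. tri T lam B" for B
    using that cvec.independent_span_bound[OF S(1)] S(2) tri_independent by blast
  have "\<exists>lam. tri T lam {}"
    using tri.empty by blast
  then have "\<exists>B. (\<exists>lam. tri T lam B) \<and> (\<forall>B'. (\<exists>lam. tri T lam B') \<longrightarrow> card B' \<le> card B)"
    using ex_has_greatest_nat[of "\<lambda>B. \<exists>lam. tri T lam B" "{}" card "Suc (card S)"] bound
    by (auto simp: less_Suc_eq_le)
  then obtain B lam where B: "tri T lam B"
    and max: "\<And>B' lam'. tri T lam' B' \<Longrightarrow> card B' \<le> card B"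
    by blast
  have "cvec.span B = UNIV"
  proof (rule ccontr)
    assume ne: "cvec.span B \<noteq> UNIV"
    have "\<exists>l. \<exists>v\<in>geig T l. v \<notin> cvec.span B"
    proof (rule ccontr)
      assume "\<not> ?thesis"
      then have "(\<Union>l. geig T l) \<subseteq> cvec.span B" by blast
      then have "cvec.span (\<Union>l. geig T l) \<subseteq> cvec.span B"
        using cvec.span_minimal[OF _ cvec.subspace_span] by blast
      then show False
        using ne span_geig[OF fd T] by auto
    qed
    then obtain l v where v: "v \<in> geig T l" "v \<notin> cvec.span B" by blast
    then obtain n where "(shift T l ^^ n) v = 0"
      by (auto simp: geig_def)
    then have "(shift T l ^^ n) v \<in> cvec.span B"
      by (simp add: cvec.span_zero)
    then obtain k where k: "(shift T l ^^ k) v \<notin> cvec.span B"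
        "shift T l ((shift T l ^^ k) v) \<in> cvec.span B"
      by (rule funpow_last_outside[OF v(2)])
    let ?w = "(shift T l ^^ k) v" and ?lam = "lam((shift T l ^^ k) v := l)"
    have w: "?w \<notin> B"
      using k(1) cvec.span_base by blast
    have "tri T ?lam B"
      using B w by (elim tri_cong) auto
    then have "tri T ?lam (insert ?w B)"
      using k geig_funpow_mem[OF T v(1), of k] by (intro tri.insert) auto
    from max[OF this] show False
      using w tri_finite[OF B] by simp
  qed
  then have "is_basis B"
    using tri_finite[OF B] tri_independent[OF B] by (simp add: is_basis_def)
  with B show ?thesis by (rule that)
qed

text \<open>Modulo \<open>cvec.span B\<close>, the map (T - l)^n multiplies the coefficient of the
  newest vector v by (lam v - l)^n. Some power kills w, so this coefficient vanishes unless lam v =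
  l. This replaces the directness of the sum of the generalized eigenspaces.\<close>

lemma tri_geig_span:
  assumes "tri T lam B" "clinear T" "w \<in> cvec.span B" "w \<in> geig T l"
  shows "w \<in> cvec.span {b \<in> B. lam b = l}"
  using assms(1,3,4)
proof (induction arbitrary: w rule: tri.induct)
  case empty
  then show ?case by simp
next
  case (insert B v)
  note N = clinear_shift[OF assms(2), of l]
  have mono: "cvec.span {b \<in> B. lam b = l} \<subseteq> cvec.span {b \<in> insert v B. lam b = l}"
    by (rule cvec.span_mono) auto
  obtain k where k: "w - k *\<^sub>C v \<in> cvec.span B"
    using insert.prems(1) by (auto simp: cvec.span_breakdown_eq)
  have pow: "(shift T l ^^ n) w - ((lam v - l) ^ n * k) *\<^sub>C v \<in> cvec.span B" for n
  proof (induction n)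
    case 0
    then show ?case using k by simp
  next
    case (Suc n)
    let ?x = "(shift T l ^^ n) w" and ?c = "(lam v - l) ^ n * k"
    have "shift T l (?x - ?c *\<^sub>C v) + ?c *\<^sub>C shift T (lam v) v \<in> cvec.span B"
      using Suc tri_shift_stable[OF insert.hyps(1) assms(2)] insert.hyps(4)
      by (intro cvec.span_add cvec.span_scale) auto
    moreover have e: "shift T (lam v) v = shift T l v - (lam v - l) *\<^sub>C v"
      by (simp add: shift_def cvec.scale_left_diff_distrib)
    have "shift T l (?x - ?c *\<^sub>C v) + ?c *\<^sub>C shift T (lam v) v =
        shift T l ?x - ((lam v - l) ^ Suc n * k) *\<^sub>C v"
      unfolding e by (simp add: clinear_diff[OF N] clinear_scale[OF N]
          cvec.scale_right_diff_distrib[of _ _ "(lam v - l) *\<^sub>C v"] scaleC_scaleC ac_simps)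
    ultimately show ?case by simp
  qed
  show ?case
  proof (cases "k = 0")
    case True
    with k have "w \<in> cvec.span B" by simp
    from insert.IH[OF this insert.prems(2)] mono show ?thesis by blast
  next
    case False
    obtain n where "(shift T l ^^ n) w = 0"
      using insert.prems(2) by (auto simp: geig_def)
    with pow[of n] have "- (((lam v - l) ^ n * k) *\<^sub>C v) \<in> cvec.span B"
      by simp
    then have c: "((lam v - l) ^ n * k) *\<^sub>C v \<in> cvec.span B"
      using cvec.span_neg by fastforce
    have "lam v = l"
    proof (rule ccontr)
      assume "lam v \<noteq> l"
      then have "(lam v - l) ^ n * k \<noteq> 0" using False by simp
      from left_inverse[OF this] have "v \<in> cvec.span B"
        using cvec.span_scale[OF c, of "inverse ((lam v - l) ^ n * k)"]
        by (simp only: scaleC_scaleC scaleC_one)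
      then show False using insert.hyps(2) by simp
    qed
    then have "w - k *\<^sub>C v \<in> geig T l"
      using insert.prems(2) insert.hyps(3)
      by (intro cvec.subspace_diff cvec.subspace_scale subspace_geig assms(2)) auto
    from insert.IH[OF k this] mono
    have "w - k *\<^sub>C v + k *\<^sub>C v \<in> cvec.span {b \<in> insert v B. lam b = l}"
      using \<open>lam v = l\<close> by (intro cvec.span_add cvec.span_scale) (auto intro: cvec.span_base)
    then show ?thesis by simp
  qed
qed

definition diag_op :: "'a::complex_vector set \<Rightarrow> ('a \<Rightarrow> complex) \<Rightarrow> 'a \<Rightarrow> 'a" where
  "diag_op B d v = (\<Sum>b\<in>B. (d b * cvec.representation B v b) *\<^sub>C b)"

lemma clinear_diag_op:
  assumes "is_basis B"
  shows "clinear (diag_op B d)"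
proof (rule clinearI)
  note R = clinear_representation[OF assms]
  show "diag_op B d (x + y) = diag_op B d x + diag_op B d y" for x y
    by (simp add: diag_op_def clinear_add[OF R] algebra_simps sum.distrib scaleC_add_left)
  show "diag_op B d (z *\<^sub>C x) = z *\<^sub>C diag_op B d x" for z x
    by (simp add: diag_op_def clinear_scale[OF R] cvec.scale_sum_right scaleC_scaleC
        scaleC_complex_def algebra_simps)
qed

lemma representation_diag_op:
  assumes "is_basis B" "b \<in> B"
  shows "cvec.representation B (diag_op B d v) b = d b * cvec.representation B v b"
proof -
  note R = clinear_representation[OF assms(1)]
  have "cvec.representation B (diag_op B d v) b =
      (\<Sum>c\<in>B. if b = c then d c * cvec.representation B v c else 0)"
    unfolding diag_op_def clinear_sum[OF R] clinear_scale[OF R] scaleC_complex_def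
    by (intro sum.cong) (simp_all add: representation_basis_apply[OF assms(1)])
  then show ?thesis
    using assms by (simp add: is_basis_def)
qed

lemma diag_op_basis:
  assumes "is_basis B" "b \<in> B"
  shows "diag_op B d b = d b *\<^sub>C b"
proof -
  have "diag_op B d b = (\<Sum>c\<in>B. if b = c then d c *\<^sub>C c else 0)"
    unfolding diag_op_def by (intro sum.cong) (simp_all add: representation_basis_apply[OF assms])
  then show ?thesis
    using assms by (simp add: is_basis_def)
qed

text \<open>Only diagonal entries count, and \<open>shift T (lam b) b\<close> has no
  \<open>b\<close> component.\<close>

lemma trace_diag_op_tri:
  assumes T: "clinear T" and tri: "tri T lam B" and B: "is_basis B"
  shows "trace_wrt B (\<lambda>v. diag_op B d (T v)) = (\<Sum>b\<in>B. d b * lam b)"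
  unfolding trace_wrt_def
proof (rule sum.cong[OF refl])
  fix b assume b: "b \<in> B"
  note R = clinear_representation[OF B, of b]
  have "cvec.representation B (shift T (lam b) b) b = 0"
    using R clinear_const_zero _ tri_shift_span[OF tri b]
    by (rule clinear_eq_on_span) (auto simp: representation_basis_apply[OF B])
  then have "cvec.representation B (T b) b = lam b"
    by (simp add: shift_def clinear_diff[OF R] clinear_scale[OF R] scaleC_complex_def
        representation_basis_apply[OF B b])
  then show "cvec.representation B (diag_op B d (T b)) b = d b * lam b"
    by (simp add: representation_diag_op[OF B b])
qed

text \<open>The scalar action is wanted on all of \<open>geig T l\<close>: the bracket of two basis
  vectors is a generalized eigenvector, but in general no basis vector.\<close>

lemma diag_op_geig:
  fixes T :: "'a::complex_vector \<Rightarrow> 'a"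
  assumes T: "clinear T" and tri: "tri T lam B" and B: "is_basis B" and v: "v \<in> geig T l"
  shows "diag_op B (\<lambda>b. f (lam b)) v = f l *\<^sub>C v"
proof (rule clinear_eq_on_span[where g = "\<lambda>v. f l *\<^sub>C v"])
  show "v \<in> cvec.span {b \<in> B. lam b = l}"
    using B by (intro tri_geig_span[OF tri T _ v]) (simp add: is_basis_def)
  show "clinear (diag_op B (\<lambda>b. f (lam b)))"
    by (rule clinear_diag_op[OF B])
  show "clinear (\<lambda>v :: 'a. f l *\<^sub>C v)"
    by (rule clinear_scaleC[OF clinear_ident])
qed (auto simp: diag_op_basis[OF B])


section \<open>Finite dimensional simple Lie algebras\<close>

context lie_algebra
begin

lemma br_add: "x \<in> L \<Longrightarrow> y \<in> L \<Longrightarrow> z \<in> L \<Longrightarrow> br (x + y) z = br x z + br y z"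
    "x \<in> L \<Longrightarrow> y \<in> L \<Longrightarrow> z \<in> L \<Longrightarrow> br x (y + z) = br x y + br x z"
  and br_scale: "x \<in> L \<Longrightarrow> y \<in> L \<Longrightarrow> br (w *\<^sub>C x) y = w *\<^sub>C br x y"
    "x \<in> L \<Longrightarrow> y \<in> L \<Longrightarrow> br x (w *\<^sub>C y) = w *\<^sub>C br x y"
  using bilinear by (simp_all add: bilinear_on_def)

lemma anti:
  assumes "x \<in> L" "y \<in> L"
  shows "br x y = - br y x"
proof -
  have xy: "x + y \<in> L"
    using assms by (rule cvec.subspace_add[OF subspace])
  have "br x x + br y x + (br x y + br y y) = 0"
    using alternating[OF xy] assms xy by (simp add: br_add)
  then show ?thesis
    using assms by (simp add: alternating eq_neg_iff_add_eq_0 add.commute)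
qed

lemma leibniz:
  assumes "x \<in> L" "y \<in> L" "z \<in> L"
  shows "br x (br y z) = br (br x y) z + br y (br x z)"
proof -
  have neg: "br y (- v) = - br y v" if "v \<in> L" for v
    using br_scale(2)[OF assms(2) that, of "- 1"] by (simp add: cvec.scale_minus_left scaleC_one)
  have "br y (br z x) = - br y (br x z)"
    using anti[OF assms(3,1)] neg[OF closed[OF assms(1,3)]] by simp
  moreover have "br z (br x y) = - br (br x y) z"
    using assms by (intro anti closed)
  ultimately have "br x (br y z) + - br y (br x z) + - br (br x y) z = 0"
    using jacobi[OF assms] by simp
  then show ?thesis
    by (simp add: diff_eq_eq)
qed

end

lemma lie_algebraD:
  assumes "lie_algebra UNIV br"
  shows "cbilinear br" "br x x = 0" "br x y = - br y x"
    "br x (br y z) = br (br x y) z + br y (br x z)"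
proof -
  interpret lie_algebra UNIV br by (rule assms)
  show "cbilinear br"
    using bilinear by (simp add: bilinear_on_def cbilinear_def clinear_def)
  show "br x x = 0"
    by (rule alternating) simp
  show "br x y = - br y x"
    by (rule anti) simp_all
  show "br x (br y z) = br (br x y) z + br y (br x z)"
    by (rule leibniz) simp_all
qed

locale simple_lie =
  fixes br :: "'g::complex_vector \<Rightarrow> 'g \<Rightarrow> 'g"
  assumes simple: "simple_lie_algebra UNIV br"
    and fd: "finite_dimensional (UNIV :: 'g set)"
begin

lemma lie: "lie_algebra UNIV br"
  using simple by (simp add: simple_lie_algebra_def)

lemmas bilinear = lie_algebraD(1)[OF lie]
  and alternating = lie_algebraD(2)[OF lie]
  and anti = lie_algebraD(3)[OF lie]
  and leibniz = lie_algebraD(4)[OF lie]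

lemmas linear_r = cbilinearD(1)[OF bilinear]
  and linear_l = cbilinearD(2)[OF bilinear]

lemmas br_simps = clinear_add[OF linear_r] clinear_add[OF linear_l]
  clinear_diff[OF linear_r] clinear_diff[OF linear_l]
  clinear_scale[OF linear_r] clinear_scale[OF linear_l]
  clinear_zero[OF linear_r] clinear_zero[OF linear_l]

lemma ideal_trivial:
  assumes "cvec.subspace I" "\<And>x y. y \<in> I \<Longrightarrow> br x y \<in> I"
  shows "I = {0} \<or> I = UNIV"
  using simple assms by (auto simp: simple_lie_algebra_def lie_ideal_def)

lemma non_abelian: "\<exists>x y. br x y \<noteq> 0"
  using simple by (auto simp: simple_lie_algebra_def)

lemma perfect: "cvec.span {br x y | x y. True} = UNIV"
proof -
  let ?I = "cvec.span {br x y | x y. True}"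
  have mem: "br x y \<in> ?I" for x y
    by (rule cvec.span_base) blast
  have "?I = {0} \<or> ?I = UNIV"
    by (rule ideal_trivial[OF cvec.subspace_span]) (rule mem)
  then show ?thesis
    using non_abelian mem by blast
qed

text \<open>By the Leibniz rule, ad x - (l + m) maps [v, w] to [(ad x - l) v, w] +
  [v, (ad x - m) w], and each summand has a smaller sum of exponents.\<close>

lemma geig_bracket:
  assumes "v \<in> geig (br x) l" "w \<in> geig (br x) m"
  shows "br v w \<in> geig (br x) (l + m)"
proof -
  note T = linear_r[of x]
  have "(shift (br x) l ^^ n) v = 0 \<Longrightarrow> (shift (br x) m ^^ k) w = 0 \<Longrightarrow> ?thesis" for n k
  proof (induction "n + k" arbitrary: n k v w)
    case 0
    then show ?case
      by (simp add: br_simps cvec.subspace_0[OF subspace_geig[OF T]])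
  next
    case (Suc N)
    show ?case
    proof (cases "n = 0 \<or> k = 0")
      case True
      then have "br v w = 0"
        using Suc.prems by (auto simp: br_simps)
      then show ?thesis
        by (simp add: cvec.subspace_0[OF subspace_geig[OF T]])
    next
      case False
      then obtain n' k' where nk: "n = Suc n'" "k = Suc k'"
        by (meson not0_implies_Suc)
      have "(shift (br x) l ^^ n') (shift (br x) l v) = 0"
        using Suc.prems(1) unfolding nk by (simp only: funpow_Suc_right comp_apply)
      then have "br (shift (br x) l v) w \<in> geig (br x) (l + m)"
        using Suc.hyps(2) Suc.prems(2) nk by (intro Suc.hyps(1)[of n' k]) auto
      moreover have "(shift (br x) m ^^ k') (shift (br x) m w) = 0"
        using Suc.prems(2) unfolding nk by (simp only: funpow_Suc_right comp_apply)
      then have "br v (shift (br x) m w) \<in> geig (br x) (l + m)"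
        using Suc.hyps(2) Suc.prems(1) nk by (intro Suc.hyps(1)[of n k']) auto
      ultimately have "br (shift (br x) l v) w + br v (shift (br x) m w) \<in> geig (br x) (l + m)"
        by (intro cvec.subspace_add subspace_geig[OF T])
      moreover have "br (shift (br x) l v) w + br v (shift (br x) m w) =
          shift (br x) (l + m) (br v w)"
        by (simp add: shift_def br_simps leibniz[of x v w] scaleC_add_left)
      ultimately show ?thesis
        by (simp add: geig_shift_iff[OF T])
    qed
  qed
  then show ?thesis
    using assms by (auto simp: geig_def)
qed

section \<open>The Killing form\<close>

abbreviation K :: "'g \<Rightarrow> 'g \<Rightarrow> complex" where
  "K \<equiv> killing_form br"

lemma ex_basis: "\<exists>B :: 'g set. is_basis B"
proof -
  obtain B :: "'g set" where "cvec.independent B" "UNIV \<subseteq> cvec.span B"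
    using cvec.basis_exists[of UNIV] by blast
  then show ?thesis
    using finite_independent[OF fd] by (auto simp: is_basis_def)
qed

text \<open>The definition selects some basis; basis independence of the trace admits any convenient
  one.\<close>

lemma killing_trace:
  assumes "is_basis B"
  shows "K x y = trace_wrt B (\<lambda>z. br x (br y z))"
proof -
  let ?C = "SOME B :: 'g set. cvec.independent B \<and> cvec.span B = UNIV"
  have "\<exists>C :: 'g set. cvec.independent C \<and> cvec.span C = UNIV"
    using assms by (auto simp: is_basis_def)
  from someI_ex[OF this] have C: "cvec.independent ?C" "cvec.span ?C = UNIV"
    by simp_all
  have B: "finite B" "cvec.independent B" "cvec.span B = UNIV"
    using assms by (auto simp: is_basis_def)
  show ?thesis
    unfolding killing_form_def
    by (rule trace_wrt_basis_independent[OF finite_independent[OF fd C(1)] C B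
          clinear_comp[OF linear_r linear_r]])
qed

lemma clinear_trace:
  assumes B: "is_basis B" and f: "cbilinear f"
  shows "clinear (\<lambda>x. trace_wrt B (f x))"
proof (rule clinearI)
  note L = cbilinearD(2)[OF f]
  show "trace_wrt B (f (x + y)) = trace_wrt B (f x) + trace_wrt B (f y)" for x y
  proof -
    have "f (x + y) = (\<lambda>z. f x z + f y z)"
      by (rule ext) (rule clinear_add[OF L])
    then show ?thesis
      by (simp only: trace_wrt_add[OF B])
  qed
  show "trace_wrt B (f (z *\<^sub>C x)) = z *\<^sub>C trace_wrt B (f x)" for z x
  proof -
    have "f (z *\<^sub>C x) = (\<lambda>v. z *\<^sub>C f x v)"
      by (rule ext) (rule clinear_scale[OF L])
    then show ?thesis
      by (simp only: trace_wrt_scale[OF B] scaleC_complex_def)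
  qed
qed

lemma killing_sym: "K x y = K y x"
proof -
  obtain B :: "'g set" where B: "is_basis B"
    using ex_basis by blast
  show ?thesis
    unfolding killing_trace[OF B] by (rule trace_wrt_commute[OF B linear_r linear_r])
qed

lemma clinear_killing_l: "clinear (\<lambda>x. K x y)"
proof -
  obtain B :: "'g set" where B: "is_basis B"
    using ex_basis by blast
  have "cbilinear (\<lambda>x z. br x (br y z))"
    by (rule cbilinearI[OF clinear_comp[OF linear_r linear_r] linear_l])
  from clinear_trace[OF B this] show ?thesis
    by (simp add: killing_trace[OF B])
qed

lemma clinear_killing_r: "clinear (K x)"
proof -
  have "K x = (\<lambda>y. K y x)"
    by (rule ext) (rule killing_sym)
  then show ?thesis
    by (simp only: clinear_killing_l)
qed

text \<open>Split ad [y, z] into a commutator, move ad y to the front by cyclicity of the trace, and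
  use that the commutator of D with ad y is ad (D y). With D inner this is the invariance of the
  Killing form; with D built from conjugate eigenvalues it gives nilpotency.\<close>

lemma trace_derivation:
  assumes B: "is_basis B" and D: "clinear D"
    and der: "\<And>x y. D (br x y) = br (D x) y + br x (D y)"
  shows "trace_wrt B (\<lambda>v. D (br (br y z) v)) = K (D y) z"
proof -
  have "trace_wrt B (\<lambda>v. D (br (br y z) v)) =
      trace_wrt B (\<lambda>v. D (br y (br z v)) - D (br z (br y v)))"
    using leibniz[of y z] by (intro arg_cong[of _ _ "trace_wrt B"] ext)
      (simp flip: clinear_diff[OF D])
  also have "\<dots> = trace_wrt B (\<lambda>v. D (br y (br z v))) - trace_wrt B (\<lambda>v. D (br z (br y v)))"
    by (rule trace_wrt_diff[OF B])
  also have "trace_wrt B (\<lambda>v. D (br z (br y v))) = trace_wrt B (\<lambda>v. br y (D (br z v)))"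
    by (rule trace_wrt_commute[OF B clinear_comp[OF D linear_r] linear_r])
  also have "trace_wrt B (\<lambda>v. D (br y (br z v))) - \<dots> =
      trace_wrt B (\<lambda>v. D (br y (br z v)) - br y (D (br z v)))"
    by (rule trace_wrt_diff[OF B, symmetric])
  also have "\<dots> = K (D y) z"
    by (simp add: killing_trace[OF B] der)
  finally show ?thesis .
qed

lemma killing_invariant: "K (br x y) z = K x (br y z)"
proof -
  obtain B :: "'g set" where B: "is_basis B"
    using ex_basis by blast
  have "trace_wrt B (\<lambda>v. br x (br (br y z) v)) = K (br x y) z"
    by (rule trace_derivation[OF B linear_r leibniz])
  then show ?thesis
    by (simp add: killing_trace[OF B])
qed

text \<open>The generalized eigenspaces of \<open>ad x\<close> grade the algebra by the additive group of \<open>\<complex>\<close>. As complex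
  conjugation is additive, the operator \<open>D\<close> that acts on them by the conjugate eigenvalues is a
  derivation. Its trace against \<open>ad x\<close> is \<open>\<Sum>\<bar>\<lambda>\<bar>\<^sup>2\<close>, and vanishes by \<open>trace_derivation\<close>.\<close>

lemma killing_zero_imp_nilpotent:
  assumes "\<And>x y. K x y = 0"
  shows "v \<in> geig (br x) 0"
proof -
  note T = linear_r[of x]
  obtain lam B where tri: "tri (br x) lam B" and B: "is_basis B"
    by (rule ex_tri_basis[OF fd T])
  define D where "D = diag_op B (\<lambda>b. cnj (lam b))"
  have D: "clinear D"
    unfolding D_def by (rule clinear_diag_op[OF B])
  have D_geig: "D v = cnj l *\<^sub>C v" if "v \<in> geig (br x) l" for v l
    unfolding D_def by (rule diag_op_geig[OF T tri B that])
  have span: "v \<in> cvec.span B" for v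
    using B by (simp add: is_basis_def)
  have "D (br y z) = br (D y) z + br y (D z)" for y z
  proof (rule clinear_eq_on_span[OF _ _ _ span[of y]])
    show "clinear (\<lambda>y. D (br y z))" "clinear (\<lambda>y. br (D y) z + br y (D z))"
      by (intro clinear_plus clinear_comp[OF D linear_l] clinear_comp[OF linear_l D] linear_l)+
    fix b assume b: "b \<in> B"
    show "D (br b z) = br (D b) z + br b (D z)"
    proof (rule clinear_eq_on_span[OF _ _ _ span[of z]])
      show "clinear (\<lambda>z. D (br b z))" "clinear (\<lambda>z. br (D b) z + br b (D z))"
        by (intro clinear_plus clinear_comp[OF D linear_r] clinear_comp[OF linear_r D] linear_r)+
      fix c assume c: "c \<in> B"
      note bc = tri_geig_mem[OF tri b] tri_geig_mem[OF tri c]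
      show "D (br b c) = br (D b) c + br b (D c)"
        by (simp add: D_geig[OF geig_bracket[OF bc]] D_geig[OF bc(1)] D_geig[OF bc(2)]
            br_simps scaleC_add_left)
    qed
  qed
  from trace_derivation[OF B D this] have tr: "trace_wrt B (\<lambda>v. D (br (br y z) v)) = 0" for y z
    by (simp add: assms)
  \<comment> \<open>The trace vanishes on brackets, and these span the algebra, so it vanishes at
    x.\<close>
  have "trace_wrt B (\<lambda>v. D (br x v)) = 0"
  proof (rule clinear_eq_on_span[where f = "\<lambda>x. trace_wrt B (\<lambda>v. D (br x v))" and g = "\<lambda>_. 0"])
    show "clinear (\<lambda>x. trace_wrt B (\<lambda>v. D (br x v)))"
      by (rule clinear_trace[OF B cbilinearI[OF clinear_comp[OF D linear_r] clinear_comp[OF D linear_l]]])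
    show "x \<in> cvec.span {br x y | x y. True}"
      by (simp only: perfect UNIV_I)
  qed (auto simp: tr clinear_const_zero)
  then have "(\<Sum>b\<in>B. cnj (lam b) * lam b) = 0"
    unfolding D_def trace_diag_op_tri[OF T tri B] .
  then have "complex_of_real (\<Sum>b\<in>B. (cmod (lam b))\<^sup>2) = 0"
    by (simp add: complex_norm_square mult.commute del: of_real_power)
  then have "(\<Sum>b\<in>B. (cmod (lam b))\<^sup>2) = 0"
    by (simp only: of_real_eq_0_iff)
  then have "lam b = 0" if "b \<in> B" for b
    using that tri_finite[OF tri] by (simp add: sum_nonneg_eq_0_iff)
  then have "B \<subseteq> geig (br x) 0"
    using tri_geig_mem[OF tri] by fastforce
  then show ?thesis
    using cvec.span_minimal[OF _ subspace_geig[OF T]] span by blast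
qed

section \<open>Engel's theorem and nondegeneracy of the Killing form\<close>

definition subalg :: "'g set \<Rightarrow> bool" where
  "subalg S \<longleftrightarrow> cvec.subspace S \<and> (\<forall>x\<in>S. \<forall>y\<in>S. br x y \<in> S)"

definition stable :: "'g set \<Rightarrow> 'g set \<Rightarrow> bool" where
  "stable S U \<longleftrightarrow> cvec.subspace U \<and> (\<forall>s\<in>S. \<forall>u\<in>U. br s u \<in> U)"

text \<open>A form of the conclusion of Engel's theorem that is relative to stable subspaces \<open>U \<subset> W\<close>, so that
  the induction needs no quotient spaces.\<close>

definition has_invariants :: "'g set \<Rightarrow> bool" where
  "has_invariants S \<longleftrightarrow> (\<forall>U W. stable S U \<and> stable S W \<and> U \<subset> W \<longrightarrow>
    (\<exists>w\<in>W - U. \<forall>s\<in>S. br s w \<in> U))"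

lemma has_invariantsD:
  assumes "has_invariants S" "stable S U" "stable S W" "U \<subset> W"
  obtains w where "w \<in> W" "w \<notin> U" "\<forall>s\<in>S. br s w \<in> U"
proof -
  have "\<exists>w\<in>W - U. \<forall>s\<in>S. br s w \<in> U"
    using assms(1)[unfolded has_invariants_def, rule_format, OF conjI[OF assms(2) conjI[OF assms(3,4)]]] .
  then show thesis using that by blast
qed

text \<open>Applied to the pair of \<open>S\<close> inside the whole algebra, the property of
  \<open>S\<close> produces an element x outside \<open>S\<close> that normalizes \<open>S\<close>.
  The larger subalgebra is the span of \<open>S\<close> and x.\<close>

lemma has_invariants_extend:
  assumes nil: "\<And>v x. v \<in> geig (br x) 0" and S: "subalg S" "has_invariants S" "S \<noteq> UNIV"
  shows "\<exists>S'. subalg S' \<and> has_invariants S' \<and> S \<subset> S'"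
proof -
  have subS: "cvec.subspace S"
    using S(1) by (simp add: subalg_def)
  have "stable S S" "stable S UNIV" "S \<subset> UNIV"
    using S(1,3) by (auto simp: subalg_def stable_def)
  then obtain x where x: "x \<notin> S" "\<And>s. s \<in> S \<Longrightarrow> br s x \<in> S"
    using has_invariantsD[OF S(2)] by metis
  let ?S' = "cvec.span (insert x S)"
  have span_S: "cvec.span S = S"
    using subS by (simp add: cvec.span_eq_iff)
  have SS': "S \<subseteq> ?S'" and xS': "x \<in> ?S'"
    by (auto intro: cvec.span_base)
  have brS': "br y z \<in> ?S'" if yz: "y \<in> ?S'" "z \<in> ?S'" for y z
    using linear_l cvec.subspace_span _ yz(1)
  proof (rule clinear_span_subset)
    fix s assume s: "s \<in> insert x S"
    show "br s z \<in> ?S'"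
      using linear_r cvec.subspace_span _ yz(2)
    proof (rule clinear_span_subset)
      fix s' assume s': "s' \<in> insert x S"
      \<comment> \<open>Since x normalizes \<open>S\<close> and [x, x] = 0, even the brackets that
        involve x fall back into \<open>S\<close>.\<close>
      have "br s s' \<in> S"
      proof (cases "s = x")
        case True
        show ?thesis
        proof (cases "s' = x")
          case s'x: True
          show ?thesis unfolding True s'x alternating
            by (rule cvec.subspace_0[OF subS])
        next
          case False
          then have "- br s' x \<in> S"
            using s' by (intro cvec.subspace_neg[OF subS] x(2)) simp
          then show ?thesis
            unfolding True by (simp add: anti[of x s'])
        qed
      next
        case False
        then show ?thesis
          using s s' x(2) S(1) by (auto simp: subalg_def)
      qed
      then show "br s s' \<in> ?S'" using SS' by blast
    qed
  qed
  then have "subalg ?S'"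
    by (simp add: subalg_def)
  moreover have "has_invariants ?S'"
    unfolding has_invariants_def
  proof (intro allI impI)
    fix U W assume UW: "stable ?S' U \<and> stable ?S' W \<and> U \<subset> W"
    then have U: "cvec.subspace U" and W: "cvec.subspace W" and "U \<subset> W"
      by (auto simp: stable_def)
    have xU: "br x u \<in> U" if "u \<in> U" for u
      using that UW xS' by (auto simp: stable_def)
    have xW: "br x u \<in> W" if "u \<in> W" for u
      using that UW xS' by (auto simp: stable_def)
    have "stable S U" "stable S W"
      using UW SS' by (auto simp: stable_def)
    then obtain w where w: "w \<in> W" "w \<notin> U" "\<forall>s\<in>S. br s w \<in> U"
      by (rule has_invariantsD[OF S(2) _ _ \<open>U \<subset> W\<close>])
    \<comment> \<open>The vectors of \<open>W\<close> on which \<open>S\<close> acts trivially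
      modulo \<open>U\<close>. They are stable under ad x because x normalizes \<open>S\<close>;
      nilpotency of ad x then finds one on which x acts trivially modulo \<open>U\<close> as
      well.\<close>
    define W' where "W' = {w \<in> W. \<forall>s\<in>S. br s w \<in> U}"
    have W': "br x v \<in> W'" if v: "v \<in> W'" for v
    proof -
      have "br s (br x v) \<in> U" if "s \<in> S" for s
        unfolding leibniz[of s x v] using that v x(2)
        by (intro cvec.subspace_add[OF U] xU) (auto simp: W'_def)
      then show ?thesis
        using v xW by (auto simp: W'_def)
    qed
    have pow: "(br x ^^ n) w \<in> W'" for n
    proof (induction n)
      case 0
      then show ?case using w by (auto simp: W'_def)
    next
      case (Suc n)
      then show ?case by (simp add: W')
    qed
    have "shift (br x) 0 = br x"
      by (rule ext) (simp add: shift_def)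
    then obtain n where "(br x ^^ n) w = 0"
      using nil[of w x] by (auto simp: geig_def)
    then have "(br x ^^ n) w \<in> U"
      using cvec.subspace_0[OF U] by simp
    then obtain k where k: "(br x ^^ k) w \<notin> U" "br x ((br x ^^ k) w) \<in> U"
      by (rule funpow_last_outside[OF w(2)])
    let ?w = "(br x ^^ k) w"
    have "br s ?w \<in> U" if "s \<in> ?S'" for s
      using linear_l U _ that
      by (rule clinear_span_subset) (use k(2) pow[of k] in \<open>auto simp: W'_def\<close>)
    moreover have "?w \<in> W - U"
      using k(1) pow[of k] by (simp add: W'_def)
    ultimately show "\<exists>w\<in>W - U. \<forall>s\<in>?S'. br s w \<in> U"
      by blast
  qed
  moreover have "S \<subset> ?S'"
    using SS' xS' x(1) by blast
  ultimately show ?thesis by blast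
qed

text \<open>A subalgebra of maximal dimension with the property must be everything, as
  \<open>has_invariants_extend\<close> enlarges any proper one. The zero subalgebra starts the
  search.\<close>

lemma engel:
  assumes nil: "\<And>v x. v \<in> geig (br x) 0"
  shows "has_invariants UNIV"
proof (rule ccontr)
  assume not_UNIV: "\<not> has_invariants UNIV"
  obtain B :: "'g set" where B: "is_basis B"
    using ex_basis by blast
  interpret fv: finite_dimensional_vector_space "scaleC :: complex \<Rightarrow> 'g \<Rightarrow> 'g" B
    using B by unfold_locales (auto simp: is_basis_def)
  let ?P = "\<lambda>S. subalg S \<and> has_invariants S"
  have "?P {0}"
    by (auto simp: subalg_def has_invariants_def stable_def br_simps cvec.subspace_0)
  then obtain S where S: "?P S" and max: "\<And>S'. ?P S' \<Longrightarrow> cvec.dim S' \<le> cvec.dim S"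
    using ex_has_greatest_nat[of ?P "{0}" cvec.dim "Suc fv.dimension"] fv.dim_subset_UNIV
    by (auto simp: less_Suc_eq_le)
  have "S \<noteq> UNIV"
    using S not_UNIV by auto
  then obtain S' where S': "?P S'" "S \<subset> S'"
    using has_invariants_extend[OF nil] S by blast
  then have "cvec.dim S < cvec.dim S'"
    using S by (intro fv.dim_psubset) (simp add: subalg_def cvec.span_eq_iff[THEN iffD2])
  with max[OF S'(1)] show False by simp
qed

text \<open>For a vanishing form, Engel's theorem with U = 0 and W the whole algebra yields a
  nonzero central element. The centre is an ideal, so by simplicity the algebra would be
  abelian.\<close>

lemma killing_nonzero: "\<exists>x y. K x y \<noteq> 0"
proof (rule ccontr)
  assume "\<not> ?thesis"
  then have "v \<in> geig (br x) 0" for v x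
    using killing_zero_imp_nilpotent by blast
  then have "has_invariants UNIV"
    by (rule engel)
  moreover obtain x y where xy: "br x y \<noteq> 0"
    using non_abelian by blast
  then have "{0} \<subset> (UNIV :: 'g set)" by blast
  moreover have "stable UNIV {0}" "stable UNIV UNIV"
    by (auto simp: stable_def br_simps)
  ultimately obtain w where w: "w \<noteq> 0" "\<And>s. br s w = 0"
    using has_invariantsD[of UNIV "{0}" UNIV] by auto
  let ?Z = "{w. \<forall>s. br s w = 0}"
  have "?Z = {0} \<or> ?Z = UNIV"
    by (rule ideal_trivial) (auto simp: cvec.subspace_def br_simps)
  with w have "?Z = UNIV" by blast
  then show False using xy by blast
qed

text \<open>Invariance makes the radical an ideal; being proper, it is zero.\<close>

lemma killing_nondegenerate:
  assumes "\<And>y. K x y = 0"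
  shows "x = 0"
proof -
  let ?R = "{x. \<forall>y. K x y = 0}"
  have "?R = {0} \<or> ?R = UNIV"
  proof (rule ideal_trivial)
    show "cvec.subspace ?R"
      by (auto simp: cvec.subspace_def clinear_simps(1-3)[OF clinear_killing_l])
    show "br x y \<in> ?R" if "y \<in> ?R" for x y
      using that by (simp add: anti[of x y] clinear_neg[OF clinear_killing_l] killing_invariant)
  qed
  with killing_nonzero assms show ?thesis by blast
qed

end


text \<open>A coordinate of a basis that extends {w}, in arbitrary dimension. It reduces forms with
  values in a competing extension to scalar ones.\<close>

lemma separating_functional:
  fixes w :: "'f::complex_vector"
  assumes "w \<noteq> 0"
  obtains f :: "'f \<Rightarrow> complex" where "clinear f" "f w \<noteq> 0"
proof -
  have ind: "cvec.independent {w}"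
    using assms by (simp add: cvec.independent_insert)
  define C where "C = cvec.extend_basis {w}"
  have C: "cvec.independent C" "cvec.span C = UNIV" "w \<in> C"
    unfolding C_def using cvec.independent_extend_basis[OF ind] cvec.span_extend_basis[OF ind]
      cvec.extend_basis_superset[OF ind] by auto
  have "clinear (\<lambda>v. cvec.representation C v w)"
    using C(1,2) by (simp add: clinear_def cvec.representation_add cvec.representation_scale
        scaleC_complex_def)
  moreover have "cvec.representation C w w \<noteq> 0"
    using C by (simp add: cvec.representation_basis)
  ultimately show thesis by (rule that)
qed

section \<open>Dual bases for the Killing form\<close>

context simple_lie
begin

lemma killing_eqI:
  assumes B: "is_basis B" and eq: "\<And>b. b \<in> B \<Longrightarrow> K x b = K y b"
  shows "x = y"
proof -
  have "K x z = K y z" for z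
    using clinear_killing_r clinear_killing_r eq
    by (rule clinear_eq_on_span) (use B in \<open>auto simp: is_basis_def\<close>)
  then have "x - y = 0"
    by (intro killing_nondegenerate) (simp add: clinear_diff[OF clinear_killing_l])
  then show ?thesis by simp
qed

lemma ex_dual_basis:
  obtains B dual where "is_basis B"
    "\<forall>b\<in>B. \<forall>c\<in>B. K b (dual c) = (if b = c then 1 else 0)"
proof -
  obtain B :: "'g set" where B: "is_basis B"
    using ex_basis by blast
  interpret fv: finite_dimensional_vector_space "scaleC :: complex \<Rightarrow> 'g \<Rightarrow> 'g" B
    using B by unfold_locales (auto simp: is_basis_def)
  \<comment> \<open>In the coordinates of \<open>B\<close>, the map sending x to the functional K x.
    It is injective by nondegeneracy, so onto in finite dimension; the preimages of the basis
    vectors form the dual basis.\<close>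
  define F where "F x = (\<Sum>b\<in>B. K x b *\<^sub>C b)" for x
  have F: "clinear F"
    unfolding F_def by (intro clinear_sum_fun clinear_scale_left clinear_killing_l)
  have rep: "cvec.representation B (F x) b = K x b" if "b \<in> B" for x b
  proof -
    note R = clinear_representation[OF B, of b]
    have "cvec.representation B (F x) b = (\<Sum>c\<in>B. if b = c then K x c else 0)"
      unfolding F_def clinear_sum[OF R] clinear_scale[OF R] scaleC_complex_def
      by (intro sum.cong) (simp_all add: representation_basis_apply[OF B])
    then show ?thesis
      using that B by (simp add: is_basis_def)
  qed
  have "inj F"
  proof (rule injI)
    fix x y assume "F x = F y"
    then show "x = y"
      using rep[of _ x] rep[of _ y] by (intro killing_eqI[OF B]) auto
  qed
  moreover have "Vector_Spaces.linear scaleC scaleC F"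
    using F by unfold_locales (auto simp: clinear_def)
  ultimately have "surj F"
    using fv.linear_inj_imp_surj by blast
  then have "F (inv F c) = c" for c
    by (rule surj_f_inv_f)
  then have "K b (inv F c) = (if b = c then 1 else 0)" if "b \<in> B" "c \<in> B" for b c
    using rep[OF that(1), of "inv F c"] representation_basis_apply[OF B that(2), of b]
    by (simp add: killing_sym[of b])
  then show thesis
    using that[OF B] by blast
qed

end

section \<open>The Casimir element and Schur's lemma\<close>

locale simple_lie_dual = simple_lie br for br :: "'g::complex_vector \<Rightarrow> 'g \<Rightarrow> 'g" +
  fixes B :: "'g set" and dual :: "'g \<Rightarrow> 'g"
  assumes basis: "is_basis B"
    and dual: "\<And>b c. b \<in> B \<Longrightarrow> c \<in> B \<Longrightarrow> K b (dual c) = (if b = c then 1 else 0)"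
begin

lemma finite_B: "finite B"
  using basis by (simp add: is_basis_def)

lemma span_B: "x \<in> cvec.span B"
  using basis by (simp add: is_basis_def)

lemma representation_killing: "b \<in> B \<Longrightarrow> cvec.representation B x b = K x (dual b)"
  using clinear_representation[OF basis] clinear_killing_l _ span_B[of x]
  by (rule clinear_eq_on_span) (auto simp: representation_basis_apply[OF basis] dual)

lemma expand_basis: "(\<Sum>b\<in>B. K x (dual b) *\<^sub>C b) = x"
  using basis_expansion[OF basis, of x] by (simp add: representation_killing)

lemma expand_dual: "(\<Sum>b\<in>B. K x b *\<^sub>C dual b) = x"
proof (rule killing_eqI[OF basis])
  fix c assume c: "c \<in> B"
  have "K (\<Sum>b\<in>B. K x b *\<^sub>C dual b) c = (\<Sum>b\<in>B. if c = b then K x b else 0)"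
    unfolding clinear_sum[OF clinear_killing_l] clinear_scale[OF clinear_killing_l]
    by (intro sum.cong) (simp_all add: killing_sym[of "dual _"] dual c scaleC_complex_def)
  then show "K (\<Sum>b\<in>B. K x b *\<^sub>C dual b) c = K x c"
    using c finite_B by simp
qed

text \<open>Invariance of the tensor formed from \<open>B\<close> and its dual, with an arbitrary
  bilinear \<open>h\<close> in the place of the tensor product: by invariance of K, the matrix of ad
  x in the dual basis is minus the transpose of its matrix in \<open>B\<close>.\<close>

lemma casimir_invariant:
  assumes h: "cbilinear h"
  shows "(\<Sum>b\<in>B. h (br x b) (dual b) + h b (br x (dual b))) = 0"
proof -
  note L = cbilinearD[OF h]
  have 1: "h (br x b) (dual b) = (\<Sum>c\<in>B. K (br x b) (dual c) *\<^sub>C h c (dual b))" for b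
    using clinear_sum[OF L(2), of "\<lambda>c. K (br x b) (dual c) *\<^sub>C c" B "dual b"]
    by (simp add: expand_basis clinear_scale[OF L(2)])
  have 2: "h c (br x (dual c)) = (\<Sum>b\<in>B. K (br x (dual c)) b *\<^sub>C h c (dual b))" for c
    using clinear_sum[OF L(1), of c "\<lambda>b. K (br x (dual c)) b *\<^sub>C dual b" B]
    by (simp add: expand_dual clinear_scale[OF L(1)])
  have 3: "K (br x (dual c)) b = - K (br x b) (dual c)" for b c
    by (simp add: killing_invariant[of x] anti[of "dual c" b] clinear_neg[OF clinear_killing_r])
  have "(\<Sum>c\<in>B. h c (br x (dual c))) = - (\<Sum>b\<in>B. \<Sum>c\<in>B. K (br x b) (dual c) *\<^sub>C h c (dual b))"
    unfolding 2 3 by (subst sum.swap) (simp add: sum_negf)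
  then show ?thesis
    by (simp add: sum.distrib 1)
qed

text \<open>Paired with y, the sum turns by invariance into the trace of ad x ad y computed in
  \<open>B\<close>, which is K x y. The eigenvalue is 1 because the dual basis is taken for the
  Killing form itself.\<close>

lemma casimir_adjoint: "(\<Sum>b\<in>B. br b (br (dual b) x)) = x"
proof (rule killing_eqI[OF basis])
  fix y
  have "K (br b (br (dual b) x)) y = K (br x (br y b)) (dual b)" for b
  proof -
    have "K (br x (br y b)) (dual b) = - K (br y b) (br x (dual b))"
      using killing_invariant[of "br y b" x "dual b"]
      by (simp add: anti[of x "br y b"] clinear_neg[OF clinear_killing_l])
    also have "\<dots> = - K (br b y) (br (dual b) x)"
      by (simp add: anti[of y b] anti[of x "dual b"] clinear_neg[OF clinear_killing_l]
          clinear_neg[OF clinear_killing_r])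
    also have "\<dots> = K b (br (br (dual b) x) y)"
      by (simp add: killing_invariant[of b y] anti[of y "br (dual b) x"] clinear_neg[OF clinear_killing_r])
    also have "\<dots> = K (br b (br (dual b) x)) y"
      by (rule killing_invariant[symmetric])
    finally show ?thesis by simp
  qed
  then show "K (\<Sum>b\<in>B. br b (br (dual b) x)) y = K x y"
    by (simp add: clinear_sum[OF clinear_killing_l] killing_trace[OF basis, of x y] trace_wrt_def
        representation_killing)
qed

text \<open>Schur's lemma: the operator T with K (T x) y = h x y commutes with the adjoint action,
  so an eigenspace of T is a nonzero ideal.\<close>

lemma scalar_invariant_form:
  fixes h :: "'g \<Rightarrow> 'g \<Rightarrow> complex"
  assumes h: "cbilinear h" and inv: "\<And>x y z. h (br x y) z = h x (br y z)"
  shows "\<exists>l. \<forall>x y. h x y = l * K x y"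
proof -
  note L = cbilinearD[OF h]
  define T where "T x = (\<Sum>b\<in>B. h x b *\<^sub>C dual b)" for x
  have T: "clinear T"
    unfolding T_def by (intro clinear_sum_fun clinear_scale_left L)
  have KT: "K (T x) y = h x y" for x y
    using clinear_killing_r L(1) _ span_B[of y]
  proof (rule clinear_eq_on_span)
    fix c assume c: "c \<in> B"
    have "K (T x) c = (\<Sum>b\<in>B. if c = b then h x b else 0)"
      unfolding T_def clinear_sum[OF clinear_killing_l] clinear_scale[OF clinear_killing_l]
      by (intro sum.cong) (simp_all add: killing_sym[of "dual _"] dual c scaleC_complex_def)
    then show "K (T x) c = h x c"
      using c finite_B by simp
  qed
  have comm: "T (br u x) = br u (T x)" for u x
  proof (rule killing_eqI[OF basis])
    fix y
    have "K (T (br u x)) y = - h (br x u) y"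
      by (simp add: KT anti[of u x] clinear_neg[OF L(2)])
    also have "\<dots> = - K (T x) (br u y)"
      by (simp only: inv KT)
    also have "\<dots> = K (br u (T x)) y"
      by (simp add: killing_invariant[symmetric] anti[of u "T x"] clinear_neg[OF clinear_killing_l])
    finally show "K (T (br u x)) y = K (br u (T x)) y" .
  qed
  obtain x :: 'g where "x \<noteq> 0"
    using non_abelian by blast
  then obtain l v where v: "v \<noteq> 0" "T v = l *\<^sub>C v"
    using ex_eigenvector[OF fd T] by blast
  let ?I = "{v. T v = l *\<^sub>C v}"
  have "?I = {0} \<or> ?I = UNIV"
  proof (rule ideal_trivial)
    show "cvec.subspace ?I"
      by (rule subspace_clinear_eq[OF T clinear_scaleC[OF clinear_ident]])
    show "br u x \<in> ?I" if "x \<in> ?I" for u x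
      using that by (simp add: comm br_simps)
  qed
  with v have "T x = l *\<^sub>C x" for x by blast
  then have "h x y = l * K x y" for x y
    by (simp add: KT[symmetric] clinear_scale[OF clinear_killing_l] scaleC_complex_def)
  then show ?thesis by blast
qed

end

context simple_lie
begin

text \<open>The target space may be infinite dimensional. If the two sides differed, some functional
  would separate them, against the scalar case.\<close>

lemma invariant_form:
  fixes h :: "'g \<Rightarrow> 'g \<Rightarrow> 'f::complex_vector"
  assumes h: "cbilinear h" and inv: "\<And>x y z. h (br x y) z = h x (br y z)"
    and one: "K x0 y0 = 1"
  shows "h x y = K x y *\<^sub>C h x0 y0"
proof (rule ccontr)
  obtain B dual where "is_basis B"
    "\<forall>b\<in>B. \<forall>c\<in>B. K b (dual c) = (if b = c then 1 else 0)"
    by (rule ex_dual_basis)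
  then interpret simple_lie_dual br B dual
    by unfold_locales auto
  assume "h x y \<noteq> K x y *\<^sub>C h x0 y0"
  then have "h x y - K x y *\<^sub>C h x0 y0 \<noteq> 0" by simp
  then obtain f :: "'f \<Rightarrow> complex" where f: "clinear f" "f (h x y - K x y *\<^sub>C h x0 y0) \<noteq> 0"
    by (rule separating_functional)
  have "cbilinear (\<lambda>x y. f (h x y))"
    by (intro cbilinearI clinear_comp[OF f(1)] cbilinearD[OF h])
  from scalar_invariant_form[OF this] inv obtain l where l: "\<And>x y. f (h x y) = l * K x y"
    by auto
  show False
    using f(2) by (simp add: clinear_diff[OF f(1)] clinear_scale[OF f(1)] l one scaleC_complex_def)
qed

lemma ex_killing_one: "\<exists>x y. K x y = 1"
proof -
  obtain x y where xy: "K x y \<noteq> 0"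
    using killing_nonzero by blast
  then have "K (inverse (K x y) *\<^sub>C x) y = 1"
    by (simp add: clinear_scale[OF clinear_killing_l] scaleC_complex_def)
  then show ?thesis by blast
qed

end


section \<open>Tensor products and current algebras\<close>

lemma span_tensor: "cvec.span {x \<otimes>\<^sub>C f | x f. True} = UNIV"
proof -
  have "abs_tensor p \<in> cvec.span {x \<otimes>\<^sub>C f | x f. True}" for p :: "('a \<times> 'b) \<Rightarrow>\<^sub>0 complex"
  proof (induction p rule: update_induct)
    case const
    then show ?case by (simp flip: zero_tensor_def add: cvec.span_zero)
  next
    case (update p k v)
    have "Poly_Mapping.update k v p = p + v *\<^sub>C formal_tensor (fst k) (snd k)"
      using update(1) by (intro poly_mapping_eqI)
        (auto simp: lookup_update lookup_add lookup_single scaleC_complex_def when_def in_keys_iff)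
    then have "abs_tensor (Poly_Mapping.update k v p) = abs_tensor p + v *\<^sub>C (fst k \<otimes>\<^sub>C snd k)"
      by (simp only: tensor_of.abs_eq scaleC_tensor.abs_eq plus_tensor.abs_eq)
    moreover have "fst k \<otimes>\<^sub>C snd k \<in> cvec.span {x \<otimes>\<^sub>C f | x f. True}"
      by (rule cvec.span_base) blast
    ultimately show ?case
      using update(3) by (simp only:) (intro cvec.span_add cvec.span_scale)
  qed
  then have "X \<in> cvec.span {x \<otimes>\<^sub>C f | x f. True}" for X :: "('a, 'b) tensor"
    by (induction X rule: tensor.abs_induct)
  then show ?thesis by blast
qed

lemma cbilinear_tensor_of: "cbilinear (\<otimes>\<^sub>C)"
  by (simp add: cbilinear_def clinear_def tensor_of_bilinear)

text \<open>Common form of the current bracket and of the Killing cocycle: both are prescribed on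
  pairs of pure tensors.\<close>

definition tensor_lift2 where
  "tensor_lift2 h X Y = tensor_lift (\<lambda>x f. tensor_lift (h x f) Y) X"

definition quadrilinear :: "('a::complex_vector \<Rightarrow> 'b::complex_vector \<Rightarrow> 'c::complex_vector \<Rightarrow>
    'd::complex_vector \<Rightarrow> 'e::complex_vector) \<Rightarrow> bool" where
  "quadrilinear h \<longleftrightarrow> (\<forall>x f. cbilinear (h x f)) \<and> (\<forall>y g. cbilinear (\<lambda>x f. h x f y g))"

lemma
  assumes "quadrilinear h"
  shows cbilinear_tensor_lift2: "cbilinear (tensor_lift2 h)"
    and tensor_lift2_tensor_of: "tensor_lift2 h (x \<otimes>\<^sub>C f) (y \<otimes>\<^sub>C g) = h x f y g"
proof -
  have h: "cbilinear (h x f)" "clinear (\<lambda>x. h x f y g)" "clinear (\<lambda>f. h x f y g)" for x f y g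
    using assms by (simp_all add: quadrilinear_def cbilinear_def)
  note L = clinear_tensor_lift[OF h(1)] and T = tensor_lift_tensor_of[OF h(1)]
  have "tensor_lift (h (x + x') f) Y = tensor_lift (h x f) Y + tensor_lift (h x' f) Y" for x x' f Y
    by (rule clinear_eqI[OF L clinear_plus[OF L L]]) (simp only: T clinear_add[OF h(2)])
  moreover have "tensor_lift (h x (f + f')) Y = tensor_lift (h x f) Y + tensor_lift (h x f') Y" for x f f' Y
    by (rule clinear_eqI[OF L clinear_plus[OF L L]]) (simp only: T clinear_add[OF h(3)])
  moreover have "tensor_lift (h (z *\<^sub>C x) f) Y = z *\<^sub>C tensor_lift (h x f) Y" for z x f Y
    by (rule clinear_eqI[OF L clinear_scaleC[OF L]]) (simp only: T clinear_scale[OF h(2)])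
  moreover have "tensor_lift (h x (z *\<^sub>C f)) Y = z *\<^sub>C tensor_lift (h x f) Y" for z x f Y
    by (rule clinear_eqI[OF L clinear_scaleC[OF L]]) (simp only: T clinear_scale[OF h(3)])
  ultimately have outer: "cbilinear (\<lambda>x f. tensor_lift (h x f) Y)" for Y
    by (simp add: cbilinear_def clinear_def)
  note L' = clinear_tensor_lift[OF outer] and T' = tensor_lift_tensor_of[OF outer]
  show "tensor_lift2 h (x \<otimes>\<^sub>C f) (y \<otimes>\<^sub>C g) = h x f y g"
    unfolding tensor_lift2_def by (rule trans[OF T' T])
  have L2: "clinear (\<lambda>X. tensor_lift2 h X Y)" for Y
    unfolding tensor_lift2_def by (rule L')
  have T2: "tensor_lift2 h (x \<otimes>\<^sub>C f) Y = tensor_lift (h x f) Y" for x f Y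
    unfolding tensor_lift2_def by (rule T')
  have "tensor_lift2 h X (Y + Y') = tensor_lift2 h X Y + tensor_lift2 h X Y'" for X Y Y'
    by (rule clinear_eqI[OF L2 clinear_plus[OF L2 L2]]) (simp only: T2 clinear_add[OF L])
  moreover have "tensor_lift2 h X (z *\<^sub>C Y) = z *\<^sub>C tensor_lift2 h X Y" for z X Y
    by (rule clinear_eqI[OF L2 clinear_scaleC[OF L2]]) (simp only: T2 clinear_scale[OF L])
  moreover note L2
  ultimately show "cbilinear (tensor_lift2 h)"
    by (simp add: cbilinear_def clinear_def)
qed

lemma clinear2_eqI:
  assumes "cbilinear F" "cbilinear G" "\<And>x f y g. F (x \<otimes>\<^sub>C f) (y \<otimes>\<^sub>C g) = G (x \<otimes>\<^sub>C f) (y \<otimes>\<^sub>C g)"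
  shows "F X Y = G X Y"
  by (rule clinear_eqI[OF cbilinearD(2)[OF assms(1)] cbilinearD(2)[OF assms(2)]],
      rule clinear_eqI[OF cbilinearD(1)[OF assms(1)] cbilinearD(1)[OF assms(2)]], rule assms(3))

lemma cbilinear_comp_linear: "cbilinear h \<Longrightarrow> clinear f \<Longrightarrow> cbilinear (\<lambda>x y. f (h x y))"
  by (simp add: cbilinear_def clinear_def)

lemma cbilinear_flip: "cbilinear h \<Longrightarrow> cbilinear (\<lambda>x y. h y x)"
  by (simp add: cbilinear_def)

lemma cbilinear_plus: "cbilinear f \<Longrightarrow> cbilinear g \<Longrightarrow> cbilinear (\<lambda>x y. f x y + g x y)"
  by (simp add: cbilinear_def clinear_plus)

lemma cbilinear_uminus: "cbilinear f \<Longrightarrow> cbilinear (\<lambda>x y. - f x y)"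
  by (simp add: cbilinear_def clinear_uminus)

lemma quadrilinear_current:
  assumes "cbilinear br"
  shows "quadrilinear (\<lambda>x (f :: 'r::complex_comm_algebra) y g. br x y \<otimes>\<^sub>C (f * g))"
  using assms by (simp add: quadrilinear_def cbilinear_def clinear_def tensor_of_bilinear
      scaleC_mult_left scaleC_mult_right distrib_left distrib_right)

lemma current_bracket_eq: "current_bracket br = tensor_lift2 (\<lambda>x f y g. br x y \<otimes>\<^sub>C (f * g))"
  by (intro ext) (simp only: current_bracket_def tensor_lift2_def)

lemma cbilinear_current_bracket: "cbilinear br \<Longrightarrow> cbilinear (current_bracket br)"
  unfolding current_bracket_eq by (rule cbilinear_tensor_lift2[OF quadrilinear_current])

lemma self_neg_zero: "x = - x \<Longrightarrow> x = (0 :: 'a::complex_vector)"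
proof -
  assume "x = - x"
  then have "x + x = 0" by (simp add: eq_neg_iff_add_eq_0)
  then have "(1 + 1) *\<^sub>C x = 0" by (simp only: scaleC_add_left scaleC_one)
  then show "x = 0" by (simp del: one_add_one)
qed

lemma lie_algebra_UNIV_I:
  assumes B: "cbilinear B" and alt: "\<And>x. B x x = 0"
    and leib: "\<And>x y z. B x (B y z) = B (B x y) z + B y (B x z)"
  shows "lie_algebra UNIV B"
proof
  note L = cbilinearD[OF B]
  show "bilinear_on UNIV B"
    by (simp add: bilinear_on_def clinear_add[OF L(1)] clinear_add[OF L(2)]
        clinear_scale[OF L(1)] clinear_scale[OF L(2)])
  have anti: "B x y = - B y x" for x y
    using alt[of "x + y"] alt[of x] alt[of y]
    by (simp add: clinear_add[OF L(1)] clinear_add[OF L(2)] eq_neg_iff_add_eq_0 add.commute)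
  show "B x (B y z) + B y (B z x) + B z (B x y) = 0" for x y z
    using leib[of x y z] anti[of z x] anti[of z "B x y"] by (simp add: clinear_neg[OF L(1)])
qed (auto simp: alt)

lemma lie_algebra_current:
  assumes lie: "lie_algebra UNIV br"
  shows "lie_algebra UNIV (current_bracket br :: ('g::complex_vector, 'r::complex_comm_algebra) tensor \<Rightarrow> _)"
proof (rule lie_algebra_UNIV_I)
  note br = lie_algebraD[OF lie]
  let ?c = "current_bracket br :: ('g, 'r) tensor \<Rightarrow> _"
  note T = current_bracket_tensor_of[OF br(1)]
  show B: "cbilinear ?c"
    by (rule cbilinear_current_bracket[OF br(1)])
  note L = cbilinearD[OF B]
  \<comment> \<open>Alternation is quadratic and cannot be tested on generators. Antisymmetry is
    bilinear, can be tested there, and implies it since 2 is invertible.\<close>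
  have "?c X Y = - ?c Y X" for X Y
  proof (rule clinear2_eqI[OF B cbilinear_uminus[OF cbilinear_flip[OF B]]])
    show "?c (x \<otimes>\<^sub>C f) (y \<otimes>\<^sub>C g) = - ?c (y \<otimes>\<^sub>C g) (x \<otimes>\<^sub>C f)" for x f y g
      using br(3)[of x y]
      by (simp add: T clinear_neg[OF cbilinearD(2)[OF cbilinear_tensor_of]] mult.commute)
  qed
  then show "?c X X = 0" for X
    by (rule self_neg_zero)
  show "?c X (?c Y Z) = ?c (?c X Y) Z + ?c Y (?c X Z)" for X Y Z
  proof (rule clinear_eqI[where X = X])
    show "clinear (\<lambda>X. ?c X (?c Y Z))" "clinear (\<lambda>X. ?c (?c X Y) Z + ?c Y (?c X Z))"
      by (intro clinear_plus L clinear_comp[OF L(1) L(2)] clinear_comp[OF L(2) L(2)])+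
    fix x f
    show "?c (x \<otimes>\<^sub>C f) (?c Y Z) = ?c (?c (x \<otimes>\<^sub>C f) Y) Z + ?c Y (?c (x \<otimes>\<^sub>C f) Z)"
    proof (rule clinear2_eqI[of "\<lambda>Y Z. ?c (x \<otimes>\<^sub>C f) (?c Y Z)"
          "\<lambda>Y Z. ?c (?c (x \<otimes>\<^sub>C f) Y) Z + ?c Y (?c (x \<otimes>\<^sub>C f) Z)"])
      show "cbilinear (\<lambda>Y Z. ?c (x \<otimes>\<^sub>C f) (?c Y Z))"
        by (rule cbilinear_comp_linear[OF B L(1)])
      show "cbilinear (\<lambda>Y Z. ?c (?c (x \<otimes>\<^sub>C f) Y) Z + ?c Y (?c (x \<otimes>\<^sub>C f) Z))"
        by (intro cbilinear_plus cbilinearI L clinear_comp[OF L(1) L(1)] clinear_comp[OF L(2) L(1)])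
      show "?c (x \<otimes>\<^sub>C f) (?c (y \<otimes>\<^sub>C g) (z \<otimes>\<^sub>C h)) =
          ?c (?c (x \<otimes>\<^sub>C f) (y \<otimes>\<^sub>C g)) (z \<otimes>\<^sub>C h) + ?c (y \<otimes>\<^sub>C g) (?c (x \<otimes>\<^sub>C f) (z \<otimes>\<^sub>C h))" for y g z h
        by (simp add: T br(4)[of x y z] tensor_of_add_left mult.assoc mult.left_commute)
    qed
  qed
qed


section \<open>Kaehler differentials modulo exact ones\<close>

lemma kaehler_scale_add_left: "(f + g) *\<^sub>\<Omega> w = f *\<^sub>\<Omega> w + g *\<^sub>\<Omega> w"
  by transfer (simp add: formal_diff.scale_left_distrib formal_diff.span_zero)

lemma kaehler_scale_add_right: "f *\<^sub>\<Omega> (w + w') = f *\<^sub>\<Omega> w + f *\<^sub>\<Omega> w'"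
  by transfer (simp add: formal_diff.scale_right_distrib formal_diff.span_zero)

lemma kaehler_scale_scale: "f *\<^sub>\<Omega> g *\<^sub>\<Omega> w = (f * g) *\<^sub>\<Omega> w"
  by transfer (simp add: formal_diff.span_zero)

lemma kaehler_scale_one: "1 *\<^sub>\<Omega> w = w"
proof -
  have "1 *\<^sub>C w = w" by (rule scaleC_one)
  then show ?thesis by (simp add: scaleC_kaehler_def scaleC_one)
qed

lemma clinear_kaehler_class: "clinear kaehler_class"
  unfolding kaehler_class_def clinear_def
  by (simp add: plus_kaehler_mod_exact.abs_eq scaleC_kaehler_mod_exact.abs_eq)

lemma kaehler_class_exact: "kaehler_class (kaehler_d f) = 0"
  unfolding kaehler_class_def zero_kaehler_mod_exact_def
  by (simp add: kaehler_mod_exact.abs_eq_iff)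

definition diff_class :: "'r::complex_comm_algebra \<Rightarrow> 'r \<Rightarrow> 'r kaehler_mod_exact" where
  "diff_class f g = kaehler_class (f *\<^sub>\<Omega> kaehler_d g)"

lemma cbilinear_diff_class: "cbilinear diff_class"
proof (rule cbilinearI)
  have s: "(z *\<^sub>C f) *\<^sub>\<Omega> w = z *\<^sub>C (f *\<^sub>\<Omega> w)" for z and f :: 'a and w
    by (simp add: scaleC_kaehler_def kaehler_scale_scale scaleC_mult_left)
  have r: "f *\<^sub>\<Omega> (z *\<^sub>C w) = z *\<^sub>C (f *\<^sub>\<Omega> w)" for z and f :: 'a and w
    by (simp add: scaleC_kaehler_def kaehler_scale_scale mult.commute)
  show "clinear (diff_class f)" for f :: 'a
    by (rule clinearI) (simp_all add: diff_class_def kaehler_d_add kaehler_d_scaleC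
      kaehler_scale_add_right clinear_simps(1,2)[OF clinear_kaehler_class] r)
  show "clinear (\<lambda>f. diff_class f g)" for g :: 'a
    by (rule clinearI) (simp_all add: diff_class_def
      kaehler_scale_add_left clinear_simps(1,2)[OF clinear_kaehler_class] s)
qed

lemma diff_class_one: "diff_class 1 f = 0"
  by (simp add: diff_class_def kaehler_scale_one kaehler_class_exact)

lemma diff_class_mult: "diff_class h (f * g) = diff_class (h * f) g + diff_class (h * g) f"
  by (simp add: diff_class_def kaehler_d_mult kaehler_scale_add_right kaehler_scale_scale
      clinear_add[OF clinear_kaehler_class])

lemma diff_class_swap: "diff_class f g = - diff_class g f"
  using diff_class_mult[of 1 f g] by (simp add: diff_class_one eq_neg_iff_add_eq_0)

lemma single_eq_formal_scale: "Poly_Mapping.single g f = formal_scale f (formal_d g)"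
  by (intro poly_mapping_eqI) (simp add: lookup_formal_scale lookup_single when_def)

lemma update_eq_add:
  fixes p :: "'a \<Rightarrow>\<^sub>0 'b::monoid_add"
  assumes "k \<notin> Poly_Mapping.keys p"
  shows "Poly_Mapping.update k v p = p + Poly_Mapping.single k v"
  using assms by (intro poly_mapping_eqI)
    (auto simp: lookup_update lookup_add lookup_single when_def in_keys_iff)

lemma span_diff_class: "cvec.span {diff_class f g | f g. True} = UNIV"
proof -
  have "kaehler_class (abs_kaehler p) \<in> cvec.span {diff_class f g | f g. True}" for p :: "'a \<Rightarrow>\<^sub>0 'a"
  proof (induction p rule: update_induct)
    case const
    have zero: "kaehler_class (abs_kaehler (0 :: 'a \<Rightarrow>\<^sub>0 'a)) = 0"
      unfolding zero_kaehler_def[symmetric] by (rule clinear_zero[OF clinear_kaehler_class])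
    show ?case
      unfolding zero by (rule cvec.span_zero)
  next
    case (update p k v)
    have "abs_kaehler (Poly_Mapping.update k v p) = abs_kaehler p + v *\<^sub>\<Omega> kaehler_d k"
      by (simp only: update_eq_add[OF update(1)] single_eq_formal_scale[of k v] plus_kaehler.abs_eq
          kaehler_scale.abs_eq kaehler_d.abs_eq)
    then have "kaehler_class (abs_kaehler (Poly_Mapping.update k v p)) =
        kaehler_class (abs_kaehler p) + diff_class v k"
      by (simp only: clinear_add[OF clinear_kaehler_class] diff_class_def)
    moreover have "diff_class v k \<in> cvec.span {diff_class f g | f g. True}"
      by (rule cvec.span_base) blast
    ultimately show ?case
      using cvec.span_add[OF update(3)] by simp
  qed
  then have "kaehler_class w \<in> cvec.span {diff_class f g | f g. True}" for w :: "'a kaehler"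
    by (induction w rule: kaehler.abs_induct)
  then have "W \<in> cvec.span {diff_class f g | f g. True}" for W :: "'a kaehler_mod_exact"
    unfolding kaehler_class_def by (induction W rule: kaehler_mod_exact.abs_induct)
  then show ?thesis by blast
qed

text \<open>The universal property of Omega/dR: the product rule passes through the relations of
  Omega, and \<open>lam 1 f = 0\<close> through the exact differentials. It serves twice, for maps
  into a competing extension and for the functionals that separate the
  \<open>omega q k\<close>.\<close>

lemma diff_class_universal:
  fixes lam :: "'r::complex_comm_algebra \<Rightarrow> 'r \<Rightarrow> 'v::complex_vector"
  assumes lam: "cbilinear lam"
    and der: "\<And>f g h. lam h (f * g) = lam (h * f) g + lam (h * g) f"
    and one: "\<And>f. lam 1 f = 0"
  obtains L where "clinear L" "\<forall>f g. L (diff_class f g) = lam f g"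
proof -
  note bl = cbilinearD[OF lam]
  define L0 where "L0 p = (\<Sum>g\<in>Poly_Mapping.keys p. lam (Poly_Mapping.lookup p g) g)" for p
  have sup: "L0 p = (\<Sum>g\<in>S. lam (Poly_Mapping.lookup p g) g)"
    if "finite S" "Poly_Mapping.keys p \<subseteq> S" for p S
    unfolding L0_def using that
    by (intro sum.mono_neutral_left) (auto simp: in_keys_iff clinear_zero[OF bl(2)])
  have add: "L0 (p + q) = L0 p + L0 q" for p q
  proof -
    define S where "S = Poly_Mapping.keys p \<union> Poly_Mapping.keys q \<union> Poly_Mapping.keys (p + q)"
    have S: "finite S" "Poly_Mapping.keys p \<subseteq> S" "Poly_Mapping.keys q \<subseteq> S"
      "Poly_Mapping.keys (p + q) \<subseteq> S"
      by (auto simp: S_def)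
    show ?thesis
      using S by (simp add: sup[of S] lookup_add clinear_add[OF bl(2)] sum.distrib)
  qed
  have scale: "L0 (formal_scale (z *\<^sub>C 1) p) = z *\<^sub>C L0 p" for z p
  proof -
    define S where "S = Poly_Mapping.keys p \<union> Poly_Mapping.keys (formal_scale (z *\<^sub>C 1) p)"
    have S: "finite S" "Poly_Mapping.keys p \<subseteq> S" "Poly_Mapping.keys (formal_scale (z *\<^sub>C 1) p) \<subseteq> S"
      by (auto simp: S_def)
    show ?thesis
      using S by (simp add: sup[of S] lookup_formal_scale scaleC_mult_left clinear_scale[OF bl(2)]
          cvec.scale_sum_right)
  qed
  have diff: "L0 (p - q) = L0 p - L0 q" for p q
    using add[of "p - q" q] by simp
  have single: "L0 (Poly_Mapping.single g f) = lam f g" for f g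
    by (subst sup[of "{g}"]) (auto simp: in_keys_iff lookup_single when_def split: if_splits)
  \<comment> \<open>The relations generate an R-submodule, so all multiples of them have to vanish;
    this is the purpose of the extra factor h in \<open>der\<close>.\<close>
  have rel: "L0 (formal_scale r p) = 0" if "p \<in> kaehler_relations" for r p
    using that unfolding kaehler_relations_def
    by (auto simp: formal_diff.scale_right_diff_distrib diff single mult.assoc
        clinear_add[OF bl(1)] clinear_scale[OF bl(1)] clinear_scale[OF bl(2)] der scaleC_mult_right)
  have zero: "L0 p = 0" if "p \<in> formal_diff.span kaehler_relations" for p
    using that
  proof (induction rule: formal_diff.span_induct_alt)
    case base
    show ?case by (simp add: L0_def)
  next
    case (step c x y)
    then show ?case by (simp add: add rel)
  qed
  define L1 where "L1 w = L0 (rep_kaehler w)" for w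
  have L1: "L1 (abs_kaehler p) = L0 p" for p
  proof -
    have "rep_kaehler (abs_kaehler p) - p \<in> formal_diff.span kaehler_relations"
      by (rule Quotient3_rep_abs[OF Quotient3_kaehler]) (simp add: formal_diff.span_zero)
    then show ?thesis
      using zero[of "rep_kaehler (abs_kaehler p) - p"] by (simp add: L1_def diff)
  qed
  have L1_add: "L1 (v + w) = L1 v + L1 w" for v w
    by (induction v rule: kaehler.abs_induct, induction w rule: kaehler.abs_induct)
      (simp add: plus_kaehler.abs_eq L1 add)
  have L1_scale: "L1 (z *\<^sub>C w) = z *\<^sub>C L1 w" for z w
    by (induction w rule: kaehler.abs_induct)
      (simp add: scaleC_kaehler_def kaehler_scale.abs_eq L1 scale)
  have L1_lin: "clinear L1"
    by (rule clinearI[OF L1_add L1_scale])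
  have L1_single: "L1 (f *\<^sub>\<Omega> kaehler_d g) = lam f g" for f g
    by (simp only: kaehler_d.abs_eq kaehler_scale.abs_eq L1 single flip: single_eq_formal_scale)
  then have L1_exact: "L1 (kaehler_d g) = 0" for g
    using one[of g] by (metis kaehler_scale_one)
  define L where "L W = L1 (rep_kaehler_mod_exact W)" for W
  have L: "L (kaehler_class w) = L1 w" for w
  proof -
    have "rep_kaehler_mod_exact (kaehler_class w) - w \<in> range kaehler_d"
      unfolding kaehler_class_def
      by (rule Quotient3_rep_abs[OF Quotient3_kaehler_mod_exact])
        (simp add: cvec.subspace_0[OF subspace_exact])
    then show ?thesis
      using clinear_diff[OF L1_lin, of "rep_kaehler_mod_exact (kaehler_class w)" w]
      by (auto simp: L_def L1_exact)
  qed
  have ind: "P W" if "\<And>w. P (kaehler_class w)" for P and W :: "'r kaehler_mod_exact"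
    using that unfolding kaehler_class_def by (rule kaehler_mod_exact.abs_induct)
  have "L (V + W) = L V + L W" for V W
    by (induction V rule: ind, induction W rule: ind)
      (simp only: clinear_add[OF clinear_kaehler_class, symmetric] L L1_add)
  moreover have "L (z *\<^sub>C W) = z *\<^sub>C L W" for z W
    by (induction W rule: ind)
      (simp only: clinear_scale[OF clinear_kaehler_class, symmetric] L L1_scale)
  ultimately have "clinear L"
    by (rule clinearI)
  moreover have "L (diff_class f g) = lam f g" for f g
    by (simp add: diff_class_def L L1_single)
  ultimately show thesis
    using that by blast
qed


section \<open>Kassel's universal central extension\<close>

definition killing_cocycle :: "('g::complex_vector \<Rightarrow> 'g \<Rightarrow> 'g) \<Rightarrow>
    ('g, 'r::complex_comm_algebra) tensor \<Rightarrow> ('g, 'r) tensor \<Rightarrow> 'r kaehler_mod_exact" where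
  "killing_cocycle br = tensor_lift2 (\<lambda>x f y g. killing_form br x y *\<^sub>C diff_class f g)"

definition kassel_bracket :: "('g::complex_vector \<Rightarrow> 'g \<Rightarrow> 'g) \<Rightarrow>
    ('g, 'r::complex_comm_algebra) tensor \<times> 'r kaehler_mod_exact \<Rightarrow>
    ('g, 'r) tensor \<times> 'r kaehler_mod_exact \<Rightarrow> ('g, 'r) tensor \<times> 'r kaehler_mod_exact" where
  "kassel_bracket br P Q =
    (current_bracket br (fst P) (fst Q), killing_cocycle br (fst P) (fst Q))"

lemma fst_scaleC [simp]: "fst (z *\<^sub>C p) = z *\<^sub>C fst p"
  and snd_scaleC [simp]: "snd (z *\<^sub>C p) = z *\<^sub>C snd p"
  by (simp_all add: scaleC_prod_def)

lemma scaleC_Pair [simp]: "z *\<^sub>C (x, y) = (z *\<^sub>C x, z *\<^sub>C y)"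
  by (simp add: scaleC_prod_def)

lemma central_kernel_bracket:
  assumes "central_extension F brF L brL \<rho>" "z \<in> F" "\<rho> z = 0" "w \<in> F"
  shows "brF z w = 0" "brF w z = 0"
proof -
  interpret lie_algebra F brF
    using assms(1) by (simp add: central_extension_def)
  show "brF z w = 0"
    using assms by (simp add: central_extension_def)
  then show "brF w z = 0"
    using anti[OF assms(4,2)] by simp
qed

lemma lie_hom_UNIV_D:
  assumes "lie_hom UNIV B F brF \<phi>"
  shows "\<phi> P \<in> F" "clinear \<phi>" "\<phi> (B P Q) = brF (\<phi> P) (\<phi> Q)"
  using assms by (simp_all add: lie_hom_def clinear_def del: split_paired_All)

context simple_lie
begin

lemma current_tensor [simp]: "current_bracket br (x \<otimes>\<^sub>C f) (y \<otimes>\<^sub>C g) = br x y \<otimes>\<^sub>C (f * g)"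
  by (rule current_bracket_tensor_of[OF bilinear])

lemma quadrilinear_killing_diff: "quadrilinear (\<lambda>x f y g. K x y *\<^sub>C diff_class f g)"
  unfolding quadrilinear_def
  by (intro conjI allI cbilinearI clinear_scaleC clinear_scale_left clinear_killing_l
      clinear_killing_r cbilinearD[OF cbilinear_diff_class])

lemma killing_cocycle_tensor [simp]:
  "killing_cocycle br (x \<otimes>\<^sub>C f) (y \<otimes>\<^sub>C g) = K x y *\<^sub>C diff_class f g"
  unfolding killing_cocycle_def by (rule tensor_lift2_tensor_of[OF quadrilinear_killing_diff])

lemma cbilinear_killing_cocycle: "cbilinear (killing_cocycle br)"
  unfolding killing_cocycle_def by (rule cbilinear_tensor_lift2[OF quadrilinear_killing_diff])

lemma killing_cocycle_swap: "killing_cocycle br X Y = - killing_cocycle br Y X"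
proof (rule clinear2_eqI[OF cbilinear_killing_cocycle cbilinear_uminus[OF cbilinear_flip[OF cbilinear_killing_cocycle]]])
  show "killing_cocycle br (x \<otimes>\<^sub>C f) (y \<otimes>\<^sub>C g) = - killing_cocycle br (y \<otimes>\<^sub>C g) (x \<otimes>\<^sub>C f)" for x f y g
    using diff_class_swap[of f g] by (simp add: killing_sym[of x y])
qed

text \<open>On pure tensors the three Killing factors agree up to sign, and what remains is f d(gh)
  - fg dh + g d(fh) = d(fgh), which is exact.\<close>

lemma killing_cocycle_leibniz:
  fixes X Y Z :: "('g, 'r::complex_comm_algebra) tensor"
  shows "killing_cocycle br X (current_bracket br Y Z) =
    killing_cocycle br (current_bracket br X Y) Z + killing_cocycle br Y (current_bracket br X Z)"
    (is "?k X (?c Y Z) = ?k (?c X Y) Z + ?k Y (?c X Z)")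
proof (rule clinear_eqI[where X = X])
  note L = cbilinearD[OF cbilinear_killing_cocycle]
  note C = cbilinearD[OF cbilinear_current_bracket[OF bilinear]]
  show "clinear (\<lambda>X. ?k X (?c Y Z))" "clinear (\<lambda>X. ?k (?c X Y) Z + ?k Y (?c X Z))"
    by (intro clinear_plus L clinear_comp[OF L(1) C(2)] clinear_comp[OF L(2) C(2)])+
  fix x and f :: 'r
  show "?k (x \<otimes>\<^sub>C f) (?c Y Z) = ?k (?c (x \<otimes>\<^sub>C f) Y) Z + ?k Y (?c (x \<otimes>\<^sub>C f) Z)"
  proof (rule clinear2_eqI[of "\<lambda>Y Z. ?k (x \<otimes>\<^sub>C f) (?c Y Z)"
        "\<lambda>Y Z. ?k (?c (x \<otimes>\<^sub>C f) Y) Z + ?k Y (?c (x \<otimes>\<^sub>C f) Z)"])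
    show "cbilinear (\<lambda>Y Z. ?k (x \<otimes>\<^sub>C f) (?c Y Z))"
      by (rule cbilinear_comp_linear[OF cbilinear_current_bracket[OF bilinear] L(1)])
    show "cbilinear (\<lambda>Y Z. ?k (?c (x \<otimes>\<^sub>C f) Y) Z + ?k Y (?c (x \<otimes>\<^sub>C f) Z))"
      by (intro cbilinear_plus cbilinearI L clinear_comp[OF L(1) C(1)] clinear_comp[OF L(2) C(1)])
    fix y z and g h :: 'r
    have "K y (br x z) = - K x (br y z)"
      using killing_invariant[of y x z] killing_invariant[of x y z] anti[of y x]
      by (simp add: clinear_neg[OF clinear_killing_l])
    moreover have "K (br x y) z = K x (br y z)"
      by (rule killing_invariant)
    moreover have "diff_class f (g * h) = diff_class (f * g) h - diff_class g (f * h)"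
      using diff_class_mult[of f g h] diff_class_mult[of g f h] diff_class_swap[of "g * h" f]
        diff_class_mult[of 1 "f * h" g] diff_class_swap[of g "f * h"]
      by (simp add: mult.commute diff_class_one)
    ultimately show "?k (x \<otimes>\<^sub>C f) (?c (y \<otimes>\<^sub>C g) (z \<otimes>\<^sub>C h)) =
        ?k (?c (x \<otimes>\<^sub>C f) (y \<otimes>\<^sub>C g)) (z \<otimes>\<^sub>C h) + ?k (y \<otimes>\<^sub>C g) (?c (x \<otimes>\<^sub>C f) (z \<otimes>\<^sub>C h))"
      by (simp add: cvec.scale_right_diff_distrib)
  qed
qed

lemma lie_algebra_kassel:
  "lie_algebra UNIV (kassel_bracket br :: ('g, 'r::complex_comm_algebra) tensor \<times> _ \<Rightarrow> _)"
proof (rule lie_algebra_UNIV_I)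
  note c = lie_algebraD[OF lie_algebra_current[OF lie]]
  note L = cbilinearD[OF cbilinear_killing_cocycle] and C = cbilinearD[OF c(1)]
  let ?B = "kassel_bracket br :: ('g, 'r) tensor \<times> _ \<Rightarrow> _"
  show "cbilinear ?B"
    by (simp add: cbilinear_def clinear_def kassel_bracket_def clinear_simps(1,2)[OF L(1)]
        clinear_simps(1,2)[OF L(2)] clinear_simps(1,2)[OF C(1)] clinear_simps(1,2)[OF C(2)])
  show "?B P P = 0" for P
    using self_neg_zero[OF killing_cocycle_swap[of "fst P" "fst P"]]
    by (simp add: kassel_bracket_def c(2) zero_prod_def)
  show "?B P (?B Q R) = ?B (?B P Q) R + ?B Q (?B P R)" for P Q R
    by (simp add: kassel_bracket_def c(4)[of "fst P"] killing_cocycle_leibniz[of "fst P"])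
qed

lemma central_extension_kassel:
  "central_extension UNIV (kassel_bracket br) UNIV
    (current_bracket br :: ('g, 'r::complex_comm_algebra) tensor \<Rightarrow> _) fst"
proof -
  note L = cbilinearD[OF cbilinear_killing_cocycle]
    and C = cbilinearD[OF cbilinear_current_bracket[OF bilinear]]
  have "lie_hom UNIV (kassel_bracket br) UNIV (current_bracket br :: ('g, 'r) tensor \<Rightarrow> _) fst"
    by (simp add: lie_hom_def kassel_bracket_def)
  then show ?thesis
    unfolding central_extension_def using lie_algebra_kassel lie_algebra_current[OF lie]
    by (auto simp: kassel_bracket_def clinear_zero[OF L(2)] clinear_zero[OF C(2)] zero_prod_def
        fst_image_times simp flip: UNIV_Times_UNIV)
qed

text \<open>Perfectness of the extension, the source of uniqueness in its universal
  property.\<close>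

lemma kassel_bracket_span:
  "cvec.span {kassel_bracket br P Q | P Q. True} =
    (UNIV :: (('g, 'r::complex_comm_algebra) tensor \<times> 'r kaehler_mod_exact) set)"
proof -
  let ?S = "cvec.span {kassel_bracket br P Q | P Q. True} ::
    (('g, 'r) tensor \<times> 'r kaehler_mod_exact) set"
  have mem: "kassel_bracket br P Q \<in> ?S" for P Q
    by (rule cvec.span_base) blast
  obtain x y where xy: "K x y = 1"
    using ex_killing_one by blast
  have lin: "clinear (\<lambda>w. (0, w) :: ('g, 'r) tensor \<times> 'r kaehler_mod_exact)"
    by (simp add: clinear_def)
  have central: "(0, w) \<in> ?S" for w
    using lin cvec.subspace_span
  proof (rule clinear_span_subset)
    show "w \<in> cvec.span {diff_class f g | f g. True}"
      by (simp only: span_diff_class UNIV_I)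
    fix w :: "'r kaehler_mod_exact" assume "w \<in> {diff_class f g | f g. True}"
    then obtain f g where w: "w = diff_class f g" by blast
    \<comment> \<open>Both brackets have the same first component, and the second one has no central
      part because 1 d(fg) is exact; the difference isolates the class of f dg.\<close>
    have "kassel_bracket br (x \<otimes>\<^sub>C f, 0) (y \<otimes>\<^sub>C g, 0) -
        kassel_bracket br (x \<otimes>\<^sub>C 1, 0) (y \<otimes>\<^sub>C (f * g), 0) = (0, w)"
      by (simp add: kassel_bracket_def xy w diff_class_one scaleC_one)
    then show "(0, w) \<in> ?S"
      using cvec.span_diff[OF mem[of "(x \<otimes>\<^sub>C f, 0)" "(y \<otimes>\<^sub>C g, 0)"]
          mem[of "(x \<otimes>\<^sub>C 1, 0)" "(y \<otimes>\<^sub>C (f * g), 0)"]] by (simp only:)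
  qed
  have lin': "clinear (\<lambda>X. (X, 0) :: ('g, 'r) tensor \<times> 'r kaehler_mod_exact)"
    by (simp add: clinear_def)
  have X: "(X, 0) \<in> ?S" for X
    using lin' cvec.subspace_span
  proof (rule clinear_span_subset)
    show "X \<in> cvec.span {x \<otimes>\<^sub>C f | x f. True}"
      by (simp only: span_tensor UNIV_I)
    fix X :: "('g, 'r) tensor" assume "X \<in> {x \<otimes>\<^sub>C f | x f. True}"
    then obtain z f where X: "X = z \<otimes>\<^sub>C f" by blast
    have "clinear (\<lambda>z. (z \<otimes>\<^sub>C f, 0) :: ('g, 'r) tensor \<times> 'r kaehler_mod_exact)"
      by (simp add: clinear_def tensor_of_bilinear)
    then show "(X, 0) \<in> ?S"
      unfolding X using cvec.subspace_span
    proof (rule clinear_span_subset)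
      show "z \<in> cvec.span {br u v | u v. True}"
        by (simp only: perfect UNIV_I)
      fix z assume "z \<in> {br u v | u v. True}"
      then obtain u v where z: "z = br u v" by blast
      have "kassel_bracket br (u \<otimes>\<^sub>C 1, 0) (v \<otimes>\<^sub>C f, 0) = (z \<otimes>\<^sub>C f, 0)"
        by (simp add: kassel_bracket_def z diff_class_one)
      then show "(z \<otimes>\<^sub>C f, 0) \<in> ?S"
        using mem[of "(u \<otimes>\<^sub>C 1, 0)" "(v \<otimes>\<^sub>C f, 0)"] by (simp only:)
    qed
  qed
  have "P \<in> ?S" for P
    using cvec.span_add[OF X[of "fst P"] central[of "snd P"]] by simp
  then show ?thesis by blast
qed

end

text \<open>A competing central extension \<open>F\<close>. As central elements act trivially, the algebra \<open>\<gg> \<otimes> 1\<close> acts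
  on \<open>F\<close>, and the Casimir operator of this action annihilates the kernel and lifts the identity of
  \<open>\<gg> \<otimes> R\<close>; it therefore induces an equivariant linear section.\<close>

locale competing_extension = simple_lie_dual br B dual
  for br :: "'g::complex_vector \<Rightarrow> 'g \<Rightarrow> 'g" and B dual +
  fixes F :: "'f::complex_vector set" and brF and \<rho> :: "'f \<Rightarrow> ('g, 'r::complex_comm_algebra) tensor"
  assumes ext: "central_extension F brF UNIV (current_bracket br) \<rho>"
begin

sublocale F: lie_algebra F brF
  using ext by (simp add: central_extension_def)

abbreviation cur :: "('g, 'r) tensor \<Rightarrow> ('g, 'r) tensor \<Rightarrow> ('g, 'r) tensor" where
  "cur \<equiv> current_bracket br"

lemmas cur_lie = lie_algebraD[OF lie_algebra_current[OF lie]]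
lemmas cur_lin = cbilinearD[OF cur_lie(1)]

lemma rho_add: "Z \<in> F \<Longrightarrow> W \<in> F \<Longrightarrow> \<rho> (Z + W) = \<rho> Z + \<rho> W"
  and rho_scale: "Z \<in> F \<Longrightarrow> \<rho> (z *\<^sub>C Z) = z *\<^sub>C \<rho> Z"
  and rho_br: "Z \<in> F \<Longrightarrow> W \<in> F \<Longrightarrow> \<rho> (brF Z W) = cur (\<rho> Z) (\<rho> W)"
  using ext by (simp_all add: central_extension_def lie_hom_def)

lemma F_add: "Z \<in> F \<Longrightarrow> W \<in> F \<Longrightarrow> Z + W \<in> F"
  and F_diff: "Z \<in> F \<Longrightarrow> W \<in> F \<Longrightarrow> Z - W \<in> F"
  and F_scale: "Z \<in> F \<Longrightarrow> z *\<^sub>C Z \<in> F"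
  and F_zero: "0 \<in> F"
  using F.subspace by (auto intro: cvec.subspace_add cvec.subspace_diff cvec.subspace_scale
      cvec.subspace_0)

lemma rho_diff: "Z \<in> F \<Longrightarrow> W \<in> F \<Longrightarrow> \<rho> (Z - W) = \<rho> Z - \<rho> W"
  using rho_add[OF F_diff, of Z W W] by simp

lemma rho_zero: "\<rho> 0 = 0"
  using rho_scale[OF F_zero, of 0] by simp

lemma F_sum: "(\<And>i. i \<in> S \<Longrightarrow> f i \<in> F) \<Longrightarrow> (\<Sum>i\<in>S. f i) \<in> F"
  by (rule cvec.subspace_sum[OF F.subspace])

lemma rho_sum: "(\<And>i. i \<in> S \<Longrightarrow> f i \<in> F) \<Longrightarrow> \<rho> (\<Sum>i\<in>S. f i) = (\<Sum>i\<in>S. \<rho> (f i))"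
  by (induction S rule: infinite_finite_induct) (auto simp: rho_zero rho_add F_sum)

lemmas kernel_br = central_kernel_bracket[OF ext]

text \<open>Brackets in \<open>F\<close> see only the images under \<open>\<rho>\<close>, so
  preimages may be exchanged freely inside a bracket.\<close>

lemma br_cong:
  assumes "Z \<in> F" "Z' \<in> F" "W \<in> F" "\<rho> Z = \<rho> Z'"
  shows "brF Z W = brF Z' W" "brF W Z = brF W Z'"
proof -
  have "brF (Z - Z') W = 0" "brF W (Z - Z') = 0"
    using assms by (auto intro: kernel_br F_diff simp: rho_diff)
  moreover have "brF Z W = brF (Z - Z') W + brF Z' W" "brF W Z = brF W (Z - Z') + brF W Z'"
    using assms F.br_add(1)[of "Z - Z'" Z' W] F.br_add(2)[of W "Z - Z'" Z'] by (simp_all add: F_diff)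
  ultimately show "brF Z W = brF Z' W" "brF W Z = brF W Z'"
    by simp_all
qed

text \<open>A mere choice of preimages, with no linearity; \<open>sect\<close> repairs this.\<close>

definition lift :: "('g, 'r) tensor \<Rightarrow> 'f" where
  "lift X = (SOME Z. Z \<in> F \<and> \<rho> Z = X)"

lemma lift: "lift X \<in> F" "\<rho> (lift X) = X"
proof -
  have "X \<in> \<rho> ` F"
    using ext by (simp add: central_extension_def)
  then have "\<exists>Z. Z \<in> F \<and> \<rho> Z = X" by blast
  from someI_ex[OF this] show "lift X \<in> F" "\<rho> (lift X) = X"
    unfolding lift_def by blast+
qed

definition act :: "'g \<Rightarrow> 'f \<Rightarrow> 'f" where
  "act x Z = brF (lift (x \<otimes>\<^sub>C 1)) Z"

lemma act_F: "Z \<in> F \<Longrightarrow> act x Z \<in> F"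
  unfolding act_def by (intro F.closed lift)

lemma rho_act: "Z \<in> F \<Longrightarrow> \<rho> (act x Z) = cur (x \<otimes>\<^sub>C 1) (\<rho> Z)"
  unfolding act_def by (simp add: rho_br lift)

lemma act_eq: "Z \<in> F \<Longrightarrow> W \<in> F \<Longrightarrow> \<rho> Z = x \<otimes>\<^sub>C 1 \<Longrightarrow> brF Z W = act x W"
  unfolding act_def by (intro br_cong) (simp_all add: lift)

lemma act_add: "Z \<in> F \<Longrightarrow> W \<in> F \<Longrightarrow> act x (Z + W) = act x Z + act x W"
  and act_scale: "Z \<in> F \<Longrightarrow> act x (z *\<^sub>C Z) = z *\<^sub>C act x Z"
  unfolding act_def by (simp_all add: F.br_add F.br_scale lift)

lemma act_zero: "act x 0 = 0"
  using act_scale[OF F_zero, of x 0] by simp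

lemma act_sum: "(\<And>i. i \<in> S \<Longrightarrow> f i \<in> F) \<Longrightarrow> act x (\<Sum>i\<in>S. f i) = (\<Sum>i\<in>S. act x (f i))"
  by (induction S rule: infinite_finite_induct) (auto simp: act_zero act_add F_sum)

text \<open>Although \<open>lift\<close> is not linear, the sum of two lifts is another lift of the
  sum, and \<open>act_eq\<close> accepts every lift.\<close>

lemma clinear_act:
  assumes "Z \<in> F"
  shows "clinear (\<lambda>x. act x Z)"
proof (rule clinearI)
  show "act (x + y) Z = act x Z + act y Z" for x y
  proof -
    have "act (x + y) Z = brF (lift (x \<otimes>\<^sub>C 1) + lift (y \<otimes>\<^sub>C 1)) Z"
      using assms by (intro act_eq[symmetric] F_add lift) (simp_all add: rho_add lift tensor_of_add_left)
    then show ?thesis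
      using assms by (simp add: F.br_add lift act_def)
  qed
  show "act (z *\<^sub>C x) Z = z *\<^sub>C act x Z" for z x
  proof -
    have "act (z *\<^sub>C x) Z = brF (z *\<^sub>C lift (x \<otimes>\<^sub>C 1)) Z"
      using assms by (intro act_eq[symmetric] F_scale lift) (simp_all add: rho_scale lift tensor_of_scale_left)
    then show ?thesis
      using assms by (simp add: F.br_scale lift act_def)
  qed
qed

lemma act_kernel: "Z \<in> F \<Longrightarrow> \<rho> Z = 0 \<Longrightarrow> act x Z = 0"
  unfolding act_def by (intro kernel_br lift)

lemma act_derivation: "Z \<in> F \<Longrightarrow> W \<in> F \<Longrightarrow> act x (brF Z W) = brF (act x Z) W + brF Z (act x W)"
  unfolding act_def by (intro F.leibniz lift)

lemma act_br:
  assumes "Z \<in> F"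
  shows "act x (act y Z) = act (br x y) Z + act y (act x Z)"
proof -
  have "act x (act y Z) = brF (act x (lift (y \<otimes>\<^sub>C 1))) Z + brF (lift (y \<otimes>\<^sub>C 1)) (act x Z)"
    unfolding act_def[of y Z] by (rule act_derivation[OF lift(1) assms])
  also have "brF (act x (lift (y \<otimes>\<^sub>C 1))) Z = act (br x y) Z"
    using assms by (intro act_eq act_F lift) (simp_all add: rho_act lift)
  finally show ?thesis by (simp add: act_def)
qed

definition casimir :: "'f \<Rightarrow> 'f" where
  "casimir Z = (\<Sum>b\<in>B. act b (act (dual b) Z))"

lemma casimir_F: "Z \<in> F \<Longrightarrow> casimir Z \<in> F"
  unfolding casimir_def by (intro F_sum act_F)

lemma casimir_add: "Z \<in> F \<Longrightarrow> W \<in> F \<Longrightarrow> casimir (Z + W) = casimir Z + casimir W"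
  and casimir_scale: "Z \<in> F \<Longrightarrow> casimir (z *\<^sub>C Z) = z *\<^sub>C casimir Z"
  by (simp_all add: casimir_def act_add act_scale act_F sum.distrib cvec.scale_sum_right)

lemma casimir_diff: "Z \<in> F \<Longrightarrow> W \<in> F \<Longrightarrow> casimir (Z - W) = casimir Z - casimir W"
  using casimir_add[OF F_diff, of Z W W] by simp

lemma casimir_kernel: "Z \<in> F \<Longrightarrow> \<rho> Z = 0 \<Longrightarrow> casimir Z = 0"
  by (simp add: casimir_def act_kernel act_zero)

lemma rho_casimir:
  assumes "Z \<in> F"
  shows "\<rho> (casimir Z) = \<rho> Z"
proof -
  have "(\<Sum>b\<in>B. cur (b \<otimes>\<^sub>C 1) (cur (dual b \<otimes>\<^sub>C 1) X)) = X" for X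
  proof (rule clinear_eqI[where X = X])
    show "clinear (\<lambda>X. \<Sum>b\<in>B. cur (b \<otimes>\<^sub>C 1) (cur (dual b \<otimes>\<^sub>C 1) X))"
      by (intro clinear_sum_fun clinear_comp[OF cur_lin(1) cur_lin(1)])
    show "(\<Sum>b\<in>B. cur (b \<otimes>\<^sub>C 1) (cur (dual b \<otimes>\<^sub>C 1) (x \<otimes>\<^sub>C f))) = x \<otimes>\<^sub>C f" for x f
      using clinear_sum[OF cbilinearD(2)[OF cbilinear_tensor_of], of "\<lambda>b. br b (br (dual b) x)" B f, symmetric]
      by (simp add: casimir_adjoint)
  qed (rule clinear_ident)
  then show ?thesis
    using assms by (simp add: casimir_def rho_sum rho_act act_F)
qed

text \<open>Moving \<open>act x\<close> through both factors of each summand leaves an error term,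
  which is \<open>casimir_invariant\<close> for the bilinear map u, v \<mapsto> u (v Z).\<close>

lemma act_casimir:
  assumes Z: "Z \<in> F"
  shows "act x (casimir Z) = casimir (act x Z)"
proof -
  let ?h = "\<lambda>u v. act u (act v Z)"
  have "cbilinear ?h"
  proof (rule cbilinearI)
    show "clinear (\<lambda>u. act u (act v Z))" for v
      by (rule clinear_act[OF act_F[OF Z]])
    show "clinear (\<lambda>v. act u (act v Z))" for u
      using Z by (intro clinearI) (simp_all add: clinear_simps(1,2)[OF clinear_act] act_add act_scale act_F)
  qed
  from casimir_invariant[OF this, of x]
  have inv: "(\<Sum>b\<in>B. act (br x b) (act (dual b) Z) + act b (act (br x (dual b)) Z)) = 0" .
  have "act x (act b (act (dual b) Z)) =
      (act (br x b) (act (dual b) Z) + act b (act (br x (dual b)) Z)) + act b (act (dual b) (act x Z))" for b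
    using Z by (simp add: act_br[of "act (dual b) Z" x b] act_br[of Z x "dual b"] act_F act_add)
  then have "act x (casimir Z) =
      (\<Sum>b\<in>B. act (br x b) (act (dual b) Z) + act b (act (br x (dual b)) Z)) + casimir (act x Z)"
    unfolding casimir_def using Z by (subst act_sum) (simp_all add: act_F sum.distrib)
  with inv show ?thesis by simp
qed

definition sect :: "('g, 'r) tensor \<Rightarrow> 'f" where
  "sect X = casimir (lift X)"

lemma sect_F: "sect X \<in> F"
  unfolding sect_def by (intro casimir_F lift)

lemma rho_sect: "\<rho> (sect X) = X"
  unfolding sect_def by (simp add: rho_casimir lift)

text \<open>Two preimages differ by an element of the kernel, which the Casimir operator kills. So
  \<open>sect\<close> can be computed from any preimage; its linearity and equivariance follow from
  this.\<close>

lemma sect_rho: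
  assumes "Z \<in> F"
  shows "sect (\<rho> Z) = casimir Z"
proof -
  have "casimir (lift (\<rho> Z) - Z) = 0"
    using assms by (intro casimir_kernel F_diff lift) (simp_all add: rho_diff lift)
  then show ?thesis
    using assms by (simp add: sect_def casimir_diff lift)
qed

lemma clinear_sect: "clinear sect"
proof (rule clinearI)
  show "sect (X + Y) = sect X + sect Y" for X Y
    using sect_rho[of "lift X + lift Y"]
    by (simp add: sect_def casimir_add rho_add F_add lift)
  show "sect (z *\<^sub>C X) = z *\<^sub>C sect X" for z X
    using sect_rho[of "z *\<^sub>C lift X"]
    by (simp add: sect_def casimir_scale rho_scale F_scale lift)
qed

lemma act_sect: "act x (sect X) = sect (cur (x \<otimes>\<^sub>C 1) X)"
  using sect_rho[of "act x (lift X)"]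
  by (simp add: rho_act lift act_F sect_def[of X] act_casimir)

text \<open>The 2-cocycle of \<open>F\<close> with respect to the section
  \<open>sect\<close>.\<close>

definition defect :: "('g, 'r) tensor \<Rightarrow> ('g, 'r) tensor \<Rightarrow> 'f" where
  "defect X Y = brF (sect X) (sect Y) - sect (cur X Y)"

lemma defect_F: "defect X Y \<in> F"
  unfolding defect_def by (intro F_diff F.closed sect_F)

lemma rho_defect: "\<rho> (defect X Y) = 0"
  unfolding defect_def by (simp add: rho_diff F.closed sect_F rho_br rho_sect)

lemma cbilinear_defect: "cbilinear defect"
  unfolding cbilinear_def clinear_def defect_def
  by (simp add: clinear_simps(1,2)[OF clinear_sect] clinear_simps(1,2)[OF cur_lin(1)]
      clinear_simps(1,2)[OF cur_lin(2)] F.br_add F.br_scale sect_F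
      cvec.scale_right_diff_distrib)

lemma defect_swap: "defect X Y = - defect Y X"
  using F.anti[OF sect_F sect_F, of X Y] cur_lie(3)[of X Y]
  by (simp add: defect_def clinear_neg[OF clinear_sect])

text \<open>The defect lies in the kernel, where \<open>act x\<close> is zero; expand
  \<open>act x\<close> of it by the derivation rule and the equivariance of
  \<open>sect\<close>.\<close>

lemma defect_invariant: "defect (cur (x \<otimes>\<^sub>C 1) X) Y + defect X (cur (x \<otimes>\<^sub>C 1) Y) = 0"
proof -
  have "act x (defect X Y) = 0"
    by (rule act_kernel[OF defect_F rho_defect])
  moreover have "act x (brF (sect X) (sect Y)) =
      act x (defect X Y + sect (cur X Y))"
    by (simp add: defect_def)
  ultimately have "act x (brF (sect X) (sect Y)) = sect (cur (x \<otimes>\<^sub>C 1) (cur X Y))"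
    by (simp add: act_add defect_F sect_F act_sect)
  then show ?thesis
    by (simp add: act_derivation sect_F act_sect defect_def
        cur_lie(4)[of "x \<otimes>\<^sub>C 1"] clinear_add[OF clinear_sect] flip: add_diff_add)
qed

text \<open>The Jacobi identity in \<open>F\<close>, once \<open>br_cong\<close> has replaced the
  section of a bracket by the bracket of sections.\<close>

lemma defect_leibniz: "defect X (cur Y Z) = defect (cur X Y) Z + defect Y (cur X Z)"
proof -
  have 1: "brF (sect X) (sect (cur Y Z)) = brF (sect X) (brF (sect Y) (sect Z))" for X Y Z
    by (rule br_cong(2)) (simp_all add: sect_F F.closed rho_sect rho_br)
  have 2: "brF (sect (cur Y Z)) (sect X) = brF (brF (sect Y) (sect Z)) (sect X)" for X Y Z
    by (rule br_cong(1)) (simp_all add: sect_F F.closed rho_sect rho_br)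
  show ?thesis
    using F.leibniz[of "sect X" "sect Y" "sect Z"] cur_lie(4)[of X Y Z]
    by (simp add: defect_def 1 2 sect_F clinear_add[OF clinear_sect])
qed

text \<open>Equivariance of the section under \<open>\<gg> \<otimes> 1\<close>, read as a vanishing
  defect.\<close>

lemma defect_one: "defect (x \<otimes>\<^sub>C 1) Y = 0"
  unfolding defect_def
  by (simp add: act_eq[of "sect (x \<otimes>\<^sub>C 1)" _ x] sect_F rho_sect act_sect)

lemma ex_central_part:
  obtains C where "clinear C" "\<forall>w. C w \<in> F" "\<forall>w. \<rho> (C w) = 0"
    "\<forall>X Y. defect X Y = C (killing_cocycle br X Y)"
proof -
  note D = cbilinearD[OF cbilinear_defect] and T = cbilinearD[OF cbilinear_tensor_of]
  obtain x0 y0 where one: "K x0 y0 = 1"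
    using ex_killing_one by blast
  define lam where "lam f g = defect (x0 \<otimes>\<^sub>C f) (y0 \<otimes>\<^sub>C g)" for f g
  have lam: "defect (x \<otimes>\<^sub>C f) (y \<otimes>\<^sub>C g) = K x y *\<^sub>C lam f g" for x f y g
    unfolding lam_def
  proof (rule invariant_form[OF _ _ one])
    show "cbilinear (\<lambda>x y. defect (x \<otimes>\<^sub>C f) (y \<otimes>\<^sub>C g))"
      by (intro cbilinearI clinear_comp[OF D(1) T(2)] clinear_comp[OF D(2) T(2)])
    show "defect (br x y \<otimes>\<^sub>C f) (z \<otimes>\<^sub>C g) = defect (x \<otimes>\<^sub>C f) (br y z \<otimes>\<^sub>C g)" for x y z
      using defect_invariant[of y "x \<otimes>\<^sub>C f" "z \<otimes>\<^sub>C g"] anti[of x y]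
      by (simp add: clinear_neg[OF T(2)] clinear_neg[OF D(2)] neg_eq_iff_add_eq_0)
  qed
  have "cbilinear lam"
    unfolding lam_def by (intro cbilinearI clinear_comp[OF D(1) T(1)] clinear_comp[OF D(2) T(1)])
  moreover have "lam h (f * g) = lam (h * f) g + lam (h * g) f" for f g h
  proof -
    \<comment> \<open>First y and z, then x are chosen to make K x (br y z) nonzero. The Killing
      factors of the cocycle identity all equal it up to sign, so they cancel.\<close>
    obtain y z where "br y z \<noteq> 0"
      using non_abelian by blast
    then obtain x where "K (br y z) x \<noteq> 0"
      using killing_nondegenerate by blast
    then have k: "K x (br y z) \<noteq> 0"
      by (simp add: killing_sym)
    have "K x (br y z) *\<^sub>C lam h (f * g) =
        K (br x y) z *\<^sub>C lam (h * f) g + K y (br x z) *\<^sub>C lam f (h * g)"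
      using defect_leibniz[of "x \<otimes>\<^sub>C h" "y \<otimes>\<^sub>C f" "z \<otimes>\<^sub>C g"] by (simp add: lam)
    moreover have "K (br x y) z = K x (br y z)" "K y (br x z) = - K x (br y z)"
      using killing_invariant[of y x z] killing_invariant[of x y z] anti[of y x]
      by (simp_all add: clinear_neg[OF clinear_killing_l])
    moreover have "lam f (h * g) = - lam (h * g) f"
      using defect_swap[of "x0 \<otimes>\<^sub>C f" "y0 \<otimes>\<^sub>C (h * g)"] one
      by (simp add: lam killing_sym[of y0] scaleC_one)
    ultimately have "K x (br y z) *\<^sub>C (lam h (f * g) - (lam (h * f) g + lam (h * g) f)) = 0"
      by (simp add: cvec.scale_right_diff_distrib scaleC_add_right)
    then show ?thesis
      using k by simp
  qed
  moreover have "lam 1 f = 0" for f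
    unfolding lam_def by (rule defect_one)
  ultimately obtain C where C: "clinear C" "\<forall>f g. C (diff_class f g) = lam f g"
    by (rule diff_class_universal)
  have ker: "cvec.subspace {Z \<in> F. \<rho> Z = 0}"
    by (auto simp: cvec.subspace_def F_zero F_add F_scale rho_zero rho_add rho_scale)
  have "C w \<in> {Z \<in> F. \<rho> Z = 0}" for w
    using C(1) ker
  proof (rule clinear_span_subset)
    show "w \<in> cvec.span {diff_class f g | f g. True}"
      by (simp only: span_diff_class UNIV_I)
    show "C w \<in> {Z \<in> F. \<rho> Z = 0}" if "w \<in> {diff_class f g | f g. True}" for w
      using that by (auto simp: C(2) lam_def defect_F rho_defect)
  qed
  moreover have "defect X Y = C (killing_cocycle br X Y)" for X Y
    by (rule clinear2_eqI[OF cbilinear_defect cbilinear_comp_linear[OF cbilinear_killing_cocycle C(1)]])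
      (simp add: lam clinear_scale[OF C(1)] C(2))
  ultimately show thesis
    using that[OF C(1)] by blast
qed

lemma ex_lie_hom:
  "\<exists>\<phi>. lie_hom UNIV (kassel_bracket br) F brF \<phi> \<and> (\<forall>P. \<rho> (\<phi> P) = fst P)"
proof -
  obtain C where C: "clinear C" "\<forall>w. C w \<in> F" "\<forall>w. \<rho> (C w) = 0"
    "\<forall>X Y. defect X Y = C (killing_cocycle br X Y)"
    by (rule ex_central_part)
  note C = C(1) C(2-4)[rule_format]
  define \<phi> where "\<phi> P = sect (fst P) + C (snd P)" for P
  have F: "\<phi> P \<in> F" for P
    unfolding \<phi>_def by (intro F_add sect_F C)
  have rho: "\<rho> (\<phi> P) = fst P" for P
    unfolding \<phi>_def by (simp add: rho_add sect_F C rho_sect)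
  have "\<phi> (kassel_bracket br P Q) = brF (\<phi> P) (\<phi> Q)" for P Q
  proof -
    have "brF (\<phi> P) (\<phi> Q) = brF (sect (fst P)) (\<phi> Q)"
      by (rule br_cong) (simp_all add: F sect_F rho rho_sect)
    also have "\<dots> = brF (sect (fst P)) (sect (fst Q))"
      by (rule br_cong) (simp_all add: F sect_F rho rho_sect)
    also have "\<dots> = sect (cur (fst P) (fst Q)) + defect (fst P) (fst Q)"
      by (simp add: defect_def)
    finally show ?thesis
      by (simp add: \<phi>_def kassel_bracket_def C(4))
  qed
  then have "lie_hom UNIV (kassel_bracket br) F brF \<phi>"
    by (simp add: lie_hom_def F) (simp add: \<phi>_def clinear_simps(1,2)[OF clinear_sect]
        clinear_simps(1,2)[OF C(1)] scaleC_add_right)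
  with rho show ?thesis by blast
qed

end

context simple_lie
begin

theorem kassel:
  "universal_central_extension TYPE('f::complex_vector) UNIV (kassel_bracket br) UNIV
    (current_bracket br :: ('g, 'r::complex_comm_algebra) tensor \<Rightarrow> _) fst"
  unfolding universal_central_extension_def
proof (intro conjI allI impI)
  show "central_extension UNIV (kassel_bracket br) UNIV
      (current_bracket br :: ('g, 'r) tensor \<Rightarrow> _) fst"
    by (rule central_extension_kassel)
  fix F :: "'f set" and brF and \<rho> :: "'f \<Rightarrow> ('g, 'r) tensor"
  assume ext: "central_extension F brF UNIV (current_bracket br) \<rho>"
  obtain B dual where "is_basis B"
    "\<forall>b\<in>B. \<forall>c\<in>B. K b (dual c) = (if b = c then 1 else 0)"
    by (rule ex_dual_basis)
  with ext interpret competing_extension br B dual F brF \<rho>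
    by unfold_locales auto
  obtain \<phi> where \<phi>: "lie_hom UNIV (kassel_bracket br) F brF \<phi>" "\<And>P. \<rho> (\<phi> P) = fst P"
    using ex_lie_hom by blast
  \<comment> \<open>Two lifts differ by values in the kernel, so by \<open>br_cong\<close> they
    agree on brackets, and brackets span the source.\<close>
  have "\<phi>' P = \<phi> P" if \<phi>': "lie_hom UNIV (kassel_bracket br) F brF \<phi>'" "\<And>P. \<rho> (\<phi>' P) = fst P" for \<phi>' P
  proof (rule clinear_eq_on_span[where f = \<phi>' and g = \<phi>])
    show "P \<in> cvec.span {kassel_bracket br P Q | P Q. True}"
      by (simp only: kassel_bracket_span UNIV_I)
    show "clinear \<phi>'" "clinear \<phi>"
      by (rule lie_hom_UNIV_D[OF \<phi>(1)] lie_hom_UNIV_D[OF \<phi>'(1)])+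
    fix R :: "('g, 'r) tensor \<times> 'r kaehler_mod_exact"
    assume "R \<in> {kassel_bracket br P Q | P Q. True}"
    then obtain P Q where R: "R = kassel_bracket br P Q" by blast
    have F: "\<phi> P \<in> F" "\<phi> Q \<in> F" "\<phi>' P \<in> F" "\<phi>' Q \<in> F"
      by (rule lie_hom_UNIV_D[OF \<phi>(1)] lie_hom_UNIV_D[OF \<phi>'(1)])+
    have "brF (\<phi>' P) (\<phi>' Q) = brF (\<phi> P) (\<phi>' Q)"
      by (rule br_cong) (simp_all add: F \<phi> \<phi>')
    also have "\<dots> = brF (\<phi> P) (\<phi> Q)"
      by (rule br_cong) (simp_all add: F \<phi> \<phi>')
    finally show "\<phi>' R = \<phi> R"
      unfolding R by (simp only: lie_hom_UNIV_D(3)[OF \<phi>(1)] lie_hom_UNIV_D(3)[OF \<phi>'(1)])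
  qed
  with \<phi> show "\<exists>\<phi>. lie_hom UNIV (kassel_bracket br) F brF \<phi> \<and> (\<forall>P\<in>UNIV. \<rho> (\<phi> P) = fst P) \<and>
      (\<forall>\<phi>'. lie_hom UNIV (kassel_bracket br) F brF \<phi>' \<and> (\<forall>P\<in>UNIV. \<rho> (\<phi>' P) = fst P) \<longrightarrow>
        (\<forall>P\<in>UNIV. \<phi>' P = \<phi> P))"
    by (intro exI[of _ \<phi>]) blast
qed

end


section \<open>The ring \<open>\<complex>[t, t\<^sup>-\<^sup>1, u]\<close>\<close>

lemma scaleC_eq_mult: "z *\<^sub>C x = (z *\<^sub>C 1) * x" for x :: "'a::complex_comm_algebra"
  by (simp add: scaleC_mult_left)

lemma scaleC_laurent: "z *\<^sub>C f = Poly_Mapping.single 0 z * f" for f :: laurent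
  by (intro poly_mapping_eqI)
    (simp add: scaleC_complex_def Poly_Mapping.map.rep_eq when_def flip: mult_map_scale_conv_mult)

locale djkm = djkm_ring a b q
  for a b :: complex and q :: "laurent poly \<Rightarrow> 'r::complex_comm_algebra" +
  fixes c :: complex
  assumes a_neq: "a \<noteq> b" "a \<noteq> - b" and ab: "a ^ 2 * b ^ 2 = 1" and c: "c = (a ^ 2 + b ^ 2) / 2"
begin

abbreviation t :: "int \<Rightarrow> 'r" where "t \<equiv> tpow q"
abbreviation u :: 'r where "u \<equiv> uvar q"

lemma q_zero: "q 0 = 0"
  using q_add[of 0 0] by simp

lemma q_diff: "q (f - g) = q f - q g"
  using q_add[of "f - g" g] by simp

lemma q_const_mult: "q [:f * g:] = q [:f:] * q [:g:]"
  using q_mult[of "[:f:]" "[:g:]"] by (simp add: mult.commute)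

lemma q_const_scale: "q [:z *\<^sub>C f:] = z *\<^sub>C q [:f:]"
  by (simp add: scaleC_laurent q_const_mult q_scalar flip: scaleC_eq_mult)

lemma q_const_add: "q [:f + g:] = q [:f:] + q [:g:]"
  using q_add[of "[:f:]" "[:g:]"] by simp

lemma clinear_q_const: "clinear (\<lambda>f. q [:f:])"
  by (rule clinearI[OF q_const_add q_const_scale])

lemma q_const_single: "q [:Poly_Mapping.single i z:] = z *\<^sub>C t i"
  using q_const_scale[of z "Poly_Mapping.single i 1"]
  by (simp add: tpow_def scaleC_laurent mult_single)

lemma t_zero: "t 0 = 1"
  using q_scalar[of 1] by (simp add: tpow_def scaleC_one)

lemma t_add: "t i * t j = t (i + j)"
  by (simp add: tpow_def mult_single flip: q_const_mult)

lemma t_add_left: "t i * (t j * x) = t (i + j) * x"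
  by (simp add: t_add flip: mult.assoc)

lemma q_const_diff: "q [:f - g:] = q [:f:] - q [:g:]"
  by (rule clinear_diff[OF clinear_q_const])

definition u_square :: laurent where
  "u_square = Poly_Mapping.single 4 1 - Poly_Mapping.single 2 (2 * c) + Poly_Mapping.single 0 1"

lemma djkm_relation_eq: "djkm_relation a b = [:0, 1:] * [:0, 1:] - [:u_square:]"
proof -
  let ?s = "Poly_Mapping.single :: int \<Rightarrow> complex \<Rightarrow> laurent"
  have c2: "a ^ 2 + b ^ 2 = 2 * c"
    by (simp add: c)
  have "(?s 1 1 ^ 2 - ?s 0 (a ^ 2)) * (?s 1 1 ^ 2 - ?s 0 (b ^ 2)) =
      ?s 4 1 - ?s 2 (a ^ 2 + b ^ 2) + ?s 0 (a ^ 2 * b ^ 2)"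
    by (simp add: power2_eq_square algebra_simps mult_single single_add)
  then show ?thesis
    unfolding djkm_relation_def Let_def u_square_def c2 ab
    by (simp only: power2_eq_square[of "[:0, 1:]"])
qed

lemma u_squared_const: "u * u = q [:u_square:]"
proof -
  have "q ([:0, 1:] * [:0, 1:] - [:u_square:]) = 0"
    using q_kernel[of "djkm_relation a b"] by (simp only: djkm_relation_eq dvd_refl simp_thms)
  then show ?thesis
    by (simp only: q_diff q_mult uvar_def) simp
qed

lemma u_squared: "u * u = t 4 - (2 * c) *\<^sub>C t 2 + 1"
  by (simp only: u_squared_const u_square_def q_const_add q_const_diff q_const_single t_zero scaleC_one)

lemma q_const_span: "q [:f:] \<in> cvec.span (range t)"
proof (induction f rule: update_induct)
  case const
  then show ?case by (simp add: q_zero cvec.span_zero)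
next
  case (update p k v)
  have "q [:Poly_Mapping.update k v p:] = q [:p:] + v *\<^sub>C t k"
    by (simp only: update_eq_add[OF update(1)] q_const_add q_const_single)
  then show ?case
    by (simp only:) (intro cvec.span_add cvec.span_scale cvec.span_base update(3) rangeI)
qed

lemma q_const_u_span: "q [:f:] * u \<in> cvec.span (range (\<lambda>i. t i * u))"
proof (rule clinear_span_subset[where f = "\<lambda>x. x * u", OF _ cvec.subspace_span _ q_const_span])
  show "clinear (\<lambda>x. x * u)"
    by (simp add: clinear_def distrib_right scaleC_mult_left)
qed (auto intro: cvec.span_base)

lemma ex_parts: "\<exists>f g. r = q [:f:] + q [:g:] * u"
proof -
  have "\<exists>f g. q P = q [:f:] + q [:g:] * u" for P
  proof (induction P rule: pCons_induct)
    case 0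
    show ?case
      by (intro exI[of _ 0]) (simp add: q_zero)
  next
    case (pCons h P)
    then obtain f g where P: "q P = q [:f:] + q [:g:] * u" by blast
    have "pCons h P = [:h:] + [:0, 1:] * P"
      by simp
    then have "q (pCons h P) = q [:h:] + u * q P"
      by (simp only: q_add q_mult uvar_def)
    also have "\<dots> = q [:h + g * u_square:] + q [:f:] * u"
      by (simp only: P q_const_add q_const_mult u_squared_const[symmetric]) (simp add: algebra_simps)
    finally show ?case by blast
  qed
  then show ?thesis
    using q_surj by (metis surjD)
qed

text \<open>The relation is monic of degree 2 in u, so a nonzero multiple of it has degree at least
  2.\<close>

lemma parts_zero:
  assumes "q [:f:] + q [:g:] * u = 0"
  shows "f = 0" "g = 0"
proof -
  have "[:f, g:] = [:f:] + [:g:] * [:0, 1:]"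
    by simp
  then have "q [:f, g:] = 0"
    using assms by (simp only: q_add q_mult uvar_def)
  then have "djkm_relation a b dvd [:f, g:]"
    by (simp only: q_kernel)
  moreover obtain p where rel: "djkm_relation a b = [:p, 0, 1:]"
    by (simp add: djkm_relation_def Let_def power2_eq_square)
  ultimately obtain h where h: "[:f, g:] = [:p, 0, 1:] * h"
    by (auto simp: dvd_def)
  have "h = 0"
  proof (rule ccontr)
    assume "h \<noteq> 0"
    then have "degree ([:p, 0, 1:] * h) = 2 + degree h"
      by (subst degree_mult_eq) auto
    moreover have "degree [:f, g:] \<le> 1"
      by simp
    ultimately show False
      unfolding h by linarith
  qed
  then show "f = 0" "g = 0"
    using h by auto
qed

lemma parts_unique:
  assumes "q [:f:] + q [:g:] * u = q [:f':] + q [:g':] * u"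
  shows "f = f'" "g = g'"
proof -
  have "q [:f - f':] + q [:g - g':] * u = 0"
    using assms unfolding q_const_diff by (simp add: algebra_simps)
  from parts_zero[OF this] show "f = f'" "g = g'" by simp_all
qed

definition basis_elems :: "'r set" where
  "basis_elems = range t \<union> range (\<lambda>i. t i * u)"

lemma span_basis_elems: "cvec.span basis_elems = UNIV"
proof -
  have "r \<in> cvec.span basis_elems" for r
  proof -
    obtain f g where "r = q [:f:] + q [:g:] * u"
      using ex_parts by blast
    moreover have "q [:f:] \<in> cvec.span basis_elems" "q [:g:] * u \<in> cvec.span basis_elems"
      using q_const_span[of f] q_const_u_span[of g] cvec.span_mono[of "range t" basis_elems]
        cvec.span_mono[of "range (\<lambda>i. t i * u)" basis_elems]
      by (auto simp: basis_elems_def)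
    ultimately show ?thesis
      by (simp only: cvec.span_add)
  qed
  then show ?thesis by blast
qed

lemma clinear_ring_eqI:
  assumes "clinear F" "clinear G" "\<And>i. F (t i) = G (t i)" "\<And>i. F (t i * u) = G (t i * u)"
  shows "F r = G r"
proof (rule clinear_eq_on_span[OF assms(1,2)])
  show "r \<in> cvec.span basis_elems"
    by (simp only: span_basis_elems UNIV_I)
qed (auto simp: basis_elems_def assms)

lemma clinear2_ring_eqI:
  assumes "cbilinear F" "cbilinear G" "\<And>x y. x \<in> basis_elems \<Longrightarrow> y \<in> basis_elems \<Longrightarrow> F x y = G x y"
  shows "F r s = G r s"
proof (rule clinear_eq_on_span[OF cbilinearD(2)[OF assms(1)] cbilinearD(2)[OF assms(2)]])
  show "r \<in> cvec.span basis_elems"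
    by (simp only: span_basis_elems UNIV_I)
  fix x assume x: "x \<in> basis_elems"
  show "F x s = G x s"
  proof (rule clinear_eq_on_span[OF cbilinearD(1)[OF assms(1)] cbilinearD(1)[OF assms(2)]])
    show "s \<in> cvec.span basis_elems"
      by (simp only: span_basis_elems UNIV_I)
  qed (rule assms(3)[OF x])
qed

definition laurent_lift :: "(int \<Rightarrow> 'v::complex_vector) \<Rightarrow> laurent \<Rightarrow> 'v" where
  "laurent_lift h f = (\<Sum>n\<in>Poly_Mapping.keys f. Poly_Mapping.lookup f n *\<^sub>C h n)"

lemma laurent_lift_superset:
  assumes "finite S" "Poly_Mapping.keys f \<subseteq> S"
  shows "laurent_lift h f = (\<Sum>n\<in>S. Poly_Mapping.lookup f n *\<^sub>C h n)"
  unfolding laurent_lift_def using assms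
  by (intro sum.mono_neutral_left) (auto simp: in_keys_iff)

lemma laurent_lift_single: "laurent_lift h (Poly_Mapping.single i z) = z *\<^sub>C h i"
  by (subst laurent_lift_superset[of "{i}"]) auto

lemma clinear_laurent_lift: "clinear (laurent_lift h)"
proof (rule clinearI)
  show "laurent_lift h (f + g) = laurent_lift h f + laurent_lift h g" for f g
    using Poly_Mapping.keys_add[of f g]
    by (simp add: laurent_lift_superset[of "Poly_Mapping.keys f \<union> Poly_Mapping.keys g"]
        lookup_add scaleC_add_left sum.distrib)
  show "laurent_lift h (z *\<^sub>C f) = z *\<^sub>C laurent_lift h f" for z f
    by (subst laurent_lift_superset[of "Poly_Mapping.keys f"])
      (auto simp: in_keys_iff scaleC_complex_def laurent_lift_def cvec.scale_sum_right scaleC_scaleC)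
qed

text \<open>The t^i and the t^i u form a basis of R, so linear maps can be prescribed on them. The
  derivation, the functionals and the parity projection are all obtained in this way.\<close>

lemma ex_linear_extension:
  fixes h0 h1 :: "int \<Rightarrow> 'v::complex_vector"
  obtains F :: "'r \<Rightarrow> 'v" where "clinear F" "\<forall>i. F (t i) = h0 i" "\<forall>i. F (t i * u) = h1 i"
proof -
  have "\<forall>r. \<exists>p. r = q [:fst p:] + q [:snd p:] * u"
    using ex_parts by auto
  then obtain p where p: "\<And>r. r = q [:fst (p r):] + q [:snd (p r):] * u"
    by metis
  have p_eq: "p r = (f, g)" if "r = q [:f:] + q [:g:] * u" for r f g
    using that p[of r] parts_unique[of "fst (p r)" "snd (p r)" f g] by (simp add: prod_eq_iff)
  define F where "F r = laurent_lift h0 (fst (p r)) + laurent_lift h1 (snd (p r))" for r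
  note L = clinear_laurent_lift
  have "clinear F"
  proof (rule clinearI)
    show "F (x + y) = F x + F y" for x y
    proof -
      have "p (x + y) = (fst (p x) + fst (p y), snd (p x) + snd (p y))"
        using p[of x] p[of y] by (intro p_eq) (simp only: q_const_add, simp add: algebra_simps)
      then show ?thesis
        by (simp add: F_def clinear_add[OF L])
    qed
    show "F (z *\<^sub>C x) = z *\<^sub>C F x" for z x
    proof -
      have "p (z *\<^sub>C x) = (z *\<^sub>C fst (p x), z *\<^sub>C snd (p x))"
        using p[of x] by (intro p_eq)
          (simp only: q_const_scale scaleC_mult_left flip: scaleC_add_right)
      then show ?thesis
        by (simp add: F_def clinear_scale[OF L] scaleC_add_right)
    qed
  qed
  moreover have "F (t i) = h0 i" for i
  proof -
    have "p (t i) = (Poly_Mapping.single i 1, 0)"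
      by (rule p_eq) (simp add: q_zero tpow_def)
    then show ?thesis
      by (simp add: F_def laurent_lift_single clinear_zero[OF L] scaleC_one)
  qed
  moreover have "F (t i * u) = h1 i" for i
  proof -
    have "p (t i * u) = (0, Poly_Mapping.single i 1)"
      by (rule p_eq) (simp add: q_zero tpow_def)
    then show ?thesis
      by (simp add: F_def laurent_lift_single clinear_zero[OF L] scaleC_one)
  qed
  ultimately show thesis
    using that by blast
qed

end


section \<open>The recursion for \<open>P\<^sub>l\<^sub>,\<^sub>k\<close>\<close>

lemma djkm_P_negative: "k < 0 \<Longrightarrow> djkm_P l k = (if k = l then 1 else 0)"
  by (subst djkm_P.simps) simp

text \<open>The defining recursion halved and freed of the division, in the shape of
  \<open>J_recursion\<close>.\<close>

lemma djkm_P_recursion: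
  assumes "0 \<le> k"
  shows "of_int (k + 3) * poly (djkm_P l k) c =
    of_int (2 * k) * c * poly (djkm_P l (k - 2)) c - of_int (k - 3) * poly (djkm_P l (k - 4)) c"
proof -
  have "(6 + 2 * of_int k :: complex) \<noteq> 0"
    using assms by (simp add: complex_eq_iff)
  then show ?thesis
    using assms by (subst djkm_P.simps) (simp add: field_simps)
qed

lemma of_int_scaleC_cancel:
  assumes "0 \<le> k" "(of_int (k + 3) :: complex) *\<^sub>C x = of_int (k + 3) *\<^sub>C y"
  shows "x = y"
proof -
  have "(of_int (k + 3) :: complex) \<noteq> 0"
    using assms(1) by (simp only: of_int_eq_0_iff)
  with assms(2) show ?thesis
    by (simp only: cvec.scale_cancel_left simp_thms)
qed

text \<open>Stated for an abstract sequence, as it is applied both to \<open>J\<close> and to its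
  reflection under k \<mapsto> -4 - k.\<close>

lemma recursion_even:
  fixes X :: "int \<Rightarrow> 'v::complex_vector"
  assumes rec: "\<And>k. 0 \<le> k \<Longrightarrow> of_int (k + 3) *\<^sub>C X k =
      (of_int (2 * k) * c) *\<^sub>C X (k - 2) - of_int (k - 3) *\<^sub>C X (k - 4)"
  shows "even k \<Longrightarrow> - 4 \<le> k \<Longrightarrow>
    X k = poly (djkm_P (- 4) k) c *\<^sub>C X (- 4) + poly (djkm_P (- 2) k) c *\<^sub>C X (- 2)"
proof (induction "nat (k + 4)" arbitrary: k rule: less_induct)
  case less
  show ?case
  proof (cases "k < 0")
    case True
    with less.prems have "k = - 4 \<or> k = - 2" by presburger
    then show ?thesis
      by (auto simp: djkm_P_negative scaleC_one)
  next
    case False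
    then have k: "0 \<le> k" by simp
    have IH: "X (k - 2) = poly (djkm_P (- 4) (k - 2)) c *\<^sub>C X (- 4) + poly (djkm_P (- 2) (k - 2)) c *\<^sub>C X (- 2)"
        "X (k - 4) = poly (djkm_P (- 4) (k - 4)) c *\<^sub>C X (- 4) + poly (djkm_P (- 2) (k - 4)) c *\<^sub>C X (- 2)"
      using k less.prems by (intro less.hyps; simp)+
    show ?thesis
      by (rule of_int_scaleC_cancel[OF k])
        (simp only: rec[OF k] IH scaleC_add_right scaleC_scaleC djkm_P_recursion[OF k]
          cvec.scale_left_diff_distrib cvec.scale_right_diff_distrib, simp add: algebra_simps)
  qed
qed

text \<open>At k = 1 the recursion gives 4 X 1 = 2 (X (-3) + c X (-1)). At k = 3 the coefficient k -
  3 removes X (-1), so from then on every term is a multiple of X 1.\<close>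

lemma recursion_odd:
  fixes X :: "int \<Rightarrow> 'v::complex_vector"
  assumes rec: "\<And>k. 0 \<le> k \<Longrightarrow> of_int (k + 3) *\<^sub>C X k =
      (of_int (2 * k) * c) *\<^sub>C X (k - 2) - of_int (k - 3) *\<^sub>C X (k - 4)"
  shows "odd k \<Longrightarrow> 1 \<le> k \<Longrightarrow> X k = poly (djkm_P (- 3) k) c *\<^sub>C (X (- 3) + c *\<^sub>C X (- 1))"
proof (induction "nat k" arbitrary: k rule: less_induct)
  case less
  then have k: "0 \<le> k" by simp
  let ?Y = "X (- 3) + c *\<^sub>C X (- 1)"
  have P1: "4 * poly (djkm_P (- 3) 1) c = 2"
    using djkm_P_recursion[of 1 "- 3" c] by (simp add: djkm_P_negative)
  have "k = 1 \<or> k = 3 \<or> 5 \<le> k"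
    using less.prems by presburger
  then consider "k = 1" | "k = 3" | "5 \<le> k"
    by blast
  then show ?case
  proof cases
    case 1
    have "4 *\<^sub>C X 1 = (4 * poly (djkm_P (- 3) 1) c) *\<^sub>C ?Y"
      unfolding P1 using rec[of 1] by (simp add: scaleC_add_right scaleC_scaleC)
    then have "of_int (1 + 3) *\<^sub>C X 1 = of_int (1 + 3) *\<^sub>C (poly (djkm_P (- 3) 1) c *\<^sub>C ?Y)"
      by (simp add: scaleC_scaleC)
    from of_int_scaleC_cancel[OF _ this] show ?thesis
      by (simp add: 1)
  next
    case 2
    have "X 1 = poly (djkm_P (- 3) 1) c *\<^sub>C ?Y"
      using less.hyps[of 1] 2 by simp
    then have "(6 :: complex) *\<^sub>C X 3 = (6 * poly (djkm_P (- 3) 3) c) *\<^sub>C ?Y"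
      using rec[of 3] djkm_P_recursion[of 3 "- 3" c] by (simp add: scaleC_scaleC)
    then have "(6 :: complex) *\<^sub>C X 3 = 6 *\<^sub>C (poly (djkm_P (- 3) 3) c *\<^sub>C ?Y)"
      by (simp only: scaleC_scaleC)
    then show ?thesis
      using of_int_scaleC_cancel[of 3 "X 3"] by (simp add: 2)
  next
    case 3
    then have IH: "X (k - 2) = poly (djkm_P (- 3) (k - 2)) c *\<^sub>C ?Y"
        "X (k - 4) = poly (djkm_P (- 3) (k - 4)) c *\<^sub>C ?Y"
      using less.prems by (intro less.hyps; simp)+
    show ?thesis
      by (rule of_int_scaleC_cancel[OF k])
        (simp only: rec[OF k] IH scaleC_scaleC djkm_P_recursion[OF k] cvec.scale_left_diff_distrib mult.assoc)
  qed
qed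


section \<open>The classes \<open>t\<^sup>k u dt\<close>\<close>

lemmas diff_class_simps =
  clinear_add[OF cbilinearD(1)[OF cbilinear_diff_class]]
  clinear_add[OF cbilinearD(2)[OF cbilinear_diff_class]]
  clinear_diff[OF cbilinearD(1)[OF cbilinear_diff_class]]
  clinear_diff[OF cbilinearD(2)[OF cbilinear_diff_class]]
  clinear_scale[OF cbilinearD(1)[OF cbilinear_diff_class]]
  clinear_scale[OF cbilinearD(2)[OF cbilinear_diff_class]]

lemma diff_class_of_one: "diff_class f 1 = 0"
  using diff_class_mult[of f 1 1] by simp

context djkm
begin

definition J :: "int \<Rightarrow> 'r kaehler_mod_exact" where
  "J k = diff_class (t k * u) (t 1)"

lemma omega_J: "k \<noteq> 0 \<Longrightarrow> omega q k = J k"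
  by (simp add: omega_def J_def diff_class_def)

lemma omega_0: "omega q 0 = diff_class (t (- 1)) (t 1)"
  by (simp add: omega_def diff_class_def)

lemma diff_class_t: "diff_class f (t j) = of_int j *\<^sub>C diff_class (f * t (j - 1)) (t 1)"
proof (induction j arbitrary: f rule: int_induct[where k = 0])
  case base
  then show ?case by (simp add: t_zero diff_class_of_one)
next
  case (step1 j)
  have "diff_class f (t (j + 1)) = diff_class (f * t j) (t 1) + diff_class (f * t 1) (t j)"
    by (simp flip: t_add diff_class_mult)
  also have "diff_class (f * t 1) (t j) = of_int j *\<^sub>C diff_class (f * t j) (t 1)"
    by (simp add: step1(2) mult.assoc t_add)
  finally show ?case
    by (simp add: scaleC_add_left scaleC_one)
next
  case (step2 j)
  \<comment> \<open>For the downward step, the product rule for t^j = t^(j-1) t with coefficient f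
    t^(-1) is solved for f d(t^(j-1)).\<close>
  have "diff_class (f * t (- 1)) (t j) =
      diff_class (f * t (- 1)) (t (j - 1) * t 1)"
    by (simp add: t_add)
  also have "\<dots> = diff_class (f * t (j - 2)) (t 1) + diff_class f (t (j - 1))"
    unfolding diff_class_mult by (simp add: mult.assoc t_add t_zero)
  finally have "diff_class f (t (j - 1)) =
      diff_class (f * t (- 1)) (t j) - diff_class (f * t (j - 2)) (t 1)"
    by simp
  also have "diff_class (f * t (- 1)) (t j) = of_int j *\<^sub>C diff_class (f * t (j - 2)) (t 1)"
    by (simp add: step2(2)[of "f * t (- 1)"] mult.assoc t_add)
  finally show ?case
    by (simp add: cvec.scale_left_diff_distrib scaleC_one)
qed

lemma diff_class_t_t: "diff_class (t k) (t 1) = (if k = - 1 then omega q 0 else 0)"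
proof (cases "k = - 1")
  case True
  then show ?thesis by (simp add: omega_0)
next
  case False
  have "of_int (k + 1) *\<^sub>C diff_class (t k) (t 1) = 0"
    using diff_class_t[of 1 "k + 1"] by (simp add: diff_class_one)
  moreover have "(of_int (k + 1) :: complex) \<noteq> 0"
    using False by (simp only: of_int_eq_0_iff)
  ultimately show ?thesis
    using False by (simp only: cvec.scale_eq_0_iff) simp
qed

text \<open>Half of f d(u^2), with u^2 expanded.\<close>

lemma diff_class_u: "diff_class (f * u) u =
  2 *\<^sub>C diff_class (f * t 3) (t 1) - (2 * c) *\<^sub>C diff_class (f * t 1) (t 1)"
proof -
  have "diff_class (f * u) u + diff_class (f * u) u = diff_class f (u * u)"
    by (simp add: diff_class_mult)
  also have "\<dots> = 4 *\<^sub>C diff_class (f * t 3) (t 1) - (4 * c) *\<^sub>C diff_class (f * t 1) (t 1)"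
    by (simp add: u_squared diff_class_simps diff_class_of_one diff_class_t[of f 4]
        diff_class_t[of f 2] scaleC_scaleC)
  finally have "(1 + 1) *\<^sub>C diff_class (f * u) u =
      2 *\<^sub>C (2 *\<^sub>C diff_class (f * t 3) (t 1) - (2 * c) *\<^sub>C diff_class (f * t 1) (t 1))"
    by (simp only: scaleC_add_left scaleC_one) (simp add: cvec.scale_right_diff_distrib scaleC_scaleC)
  then show ?thesis
    by (simp add: cvec.scale_cancel_left)
qed

text \<open>The relation is \<open>d(t\<^sup>k\<^sup>-\<^sup>3 u\<^sup>3) = 0\<close>.\<close>

lemma J_recursion: "of_int (k + 3) *\<^sub>C J k =
  (of_int (2 * k) * c) *\<^sub>C J (k - 2) - of_int (k - 3) *\<^sub>C J (k - 4)"
proof -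
  let ?g = "t (k - 3) * u * u"
  have g: "?g = t (k + 1) - (2 * c) *\<^sub>C t (k - 1) + t (k - 3)"
    by (simp add: mult.assoc u_squared distrib_left right_diff_distrib scaleC_mult_right t_add
        add.commute)
  have "0 = diff_class 1 (?g * u)"
    by (simp only: diff_class_one)
  also have "\<dots> = diff_class ?g u + diff_class u ?g"
    by (simp only: diff_class_mult mult_1_left)
  also have "diff_class ?g u = 2 *\<^sub>C J k - (2 * c) *\<^sub>C J (k - 2)"
    unfolding diff_class_u J_def by (simp add: mult.commute mult.left_commute t_add t_add_left add.commute)
  also have "diff_class u ?g =
      of_int (k + 1) *\<^sub>C J k - (2 * c * of_int (k - 1)) *\<^sub>C J (k - 2) + of_int (k - 3) *\<^sub>C J (k - 4)"
    unfolding g diff_class_simps diff_class_t[of u "k + 1"] diff_class_t[of u "k - 1"]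
      diff_class_t[of u "k - 3"] J_def
    by (simp add: mult.commute scaleC_scaleC)
  finally have "0 = 2 *\<^sub>C J k - (2 * c) *\<^sub>C J (k - 2) + (of_int (k + 1) *\<^sub>C J k -
      (2 * c * of_int (k - 1)) *\<^sub>C J (k - 2) + of_int (k - 3) *\<^sub>C J (k - 4))" .
  moreover have "(3 :: complex) *\<^sub>C J k = J k + 2 *\<^sub>C J k"
    using scaleC_add_left[of 1 2 "J k"] by (simp add: scaleC_one)
  ultimately have "of_int (k + 3) *\<^sub>C J k - ((of_int (2 * k) * c) *\<^sub>C J (k - 2) - of_int (k - 3) *\<^sub>C J (k - 4)) = 0"
    by (simp add: scaleC_add_left cvec.scale_left_diff_distrib algebra_simps)
  then show ?thesis
    by simp
qed

text \<open>The recursion is invariant under \<open>k \<mapsto> -4 - k\<close>, which comes from the substitution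
  \<open>t \<mapsto> t\<^sup>-\<^sup>1, u \<mapsto> t\<^sup>-\<^sup>2 u\<close>.\<close>

lemma J_symmetric_recursion: "of_int (k + 3) *\<^sub>C J (- 4 - k) =
  (of_int (2 * k) * c) *\<^sub>C J (- 4 - (k - 2)) - of_int (k - 3) *\<^sub>C J (- 4 - (k - 4))"
proof -
  have idx: "- 4 - k = - k - 4" "- 4 - (k - 2) = - k - 2" "- 4 - (k - 4) = - k"
    by simp_all
  show ?thesis
    unfolding idx using J_recursion[of "- k"]
    by (simp add: scaleC_add_left cvec.scale_left_diff_distrib cvec.scale_minus_left algebra_simps)
qed

text \<open>The reflection k \<mapsto> -4 - k sends -4 to 0, so for negative even i + j the
  recursion yields J 0 where \<open>psi\<close> has \<open>omega q (-4)\<close>.\<close>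

lemma J_0: "J 0 = J (- 4)"
  using J_recursion[of 0] by simp

lemma psi_J: "psi q c i j = J (i + j - 2)"
proof -
  define s where "s = i + j"
  note defs = psi_def Let_def s_def[symmetric]
  have "s = 1 \<or> s = 0 \<or> s = - 1 \<or> s = - 2 \<or> odd s \<and> 3 \<le> s \<or> odd s \<and> s \<le> - 3 \<or>
      even s \<and> 2 \<le> s \<or> even s \<and> s \<le> - 4"
    by presburger
  then consider "s \<in> {1, 0, -1, -2}" | "odd s" "3 \<le> s" | "odd s" "s \<le> - 3"
    | "even s" "2 \<le> s" | "even s" "s \<le> - 4"
    by blast
  then have "psi q c i j = J (s - 2)"
  proof cases
    case 1
    then show ?thesis
      by (auto simp: defs omega_J)
  next
    case 2
    then show ?thesis
      using recursion_odd[of J c "s - 2", OF J_recursion] by (auto simp: defs omega_J)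
  next
    \<comment> \<open>The reflection sends -s - 2 to s - 2 and exchanges J (-3) with J (-1), which
      explains the exchanged roles in the third clause of \<open>psi\<close>.\<close>
    case 3
    then show ?thesis
      using recursion_odd[of "\<lambda>k. J (- 4 - k)" c "- s - 2", OF J_symmetric_recursion]
      by (auto simp: defs omega_J add.commute)
  next
    case 4
    then show ?thesis
      using recursion_even[of J c "s - 2", OF J_recursion] by (auto simp: defs omega_J)
  next
    case 5
    then show ?thesis
      using recursion_even[of "\<lambda>k. J (- 4 - k)" c "- s - 2", OF J_symmetric_recursion]
      by (auto simp: defs omega_J J_0)
  qed
  then show ?thesis by (simp add: s_def)
qed

lemma diff_class_tu_t: "diff_class (t i * u) (t j) = of_int j *\<^sub>C J (i + j - 1)"
  unfolding diff_class_t[of _ j] J_def by (simp add: t_add algebra_simps)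

lemma diff_class_t_t': "diff_class (t i) (t j) = (if i + j = 0 then of_int j else 0) *\<^sub>C omega q 0"
  by (simp add: diff_class_t[of _ j] t_add diff_class_t_t)

text \<open>Among the t^k dt only t^(-1) dt survives modulo exact forms, so each monomial of u^2
  contributes for a single value of i + j.\<close>

lemma diff_class_tu_tu: "diff_class (t i * u) (t j * u) =
  ((if i + j = - 4 then of_int (j + 2) else 0) - (if i + j = - 2 then 2 * c * of_int (j + 1) else 0) +
    (if i + j = 0 then of_int j else 0)) *\<^sub>C omega q 0"
proof -
  let ?G = "\<lambda>k. diff_class (t k) (t 1)"
  have idx: "i + j + 3 = - 1 \<longleftrightarrow> i + j = - 4" "i + j + 1 = - 1 \<longleftrightarrow> i + j = - 2"
      "i + j - 1 = - 1 \<longleftrightarrow> i + j = 0"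
    by auto
  have "diff_class (t i * u) (t j * u) = diff_class (t (i + j) * u) u + diff_class (t i * (u * u)) (t j)"
    by (simp only: diff_class_mult mult.assoc mult.commute[of u "t j"] t_add_left)
  also have "diff_class (t (i + j) * u) u = 2 *\<^sub>C ?G (i + j + 3) - (2 * c) *\<^sub>C ?G (i + j + 1)"
    by (simp add: diff_class_u t_add)
  also have "diff_class (t i * (u * u)) (t j) =
      of_int j *\<^sub>C (?G (i + j + 3) - (2 * c) *\<^sub>C ?G (i + j + 1) + ?G (i + j - 1))"
    unfolding diff_class_t[of _ j]
    by (simp add: u_squared algebra_simps scaleC_mult_left scaleC_mult_right t_add t_add_left diff_class_simps)
  finally show ?thesis
    unfolding diff_class_t_t idx
    by (auto simp: scaleC_add_left cvec.scale_left_diff_distrib scaleC_scaleC algebra_simps)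
qed

end


section \<open>Independence of the classes \<open>\<omega>\<^sub>k\<close>\<close>

text \<open>The coefficient sequences of the linear functionals on \<open>\<complex>[t, t\<^sup>-\<^sup>1]\<close> that vanish on
  \<open>\<partial>(t\<^sup>i u)\<close>, where \<open>\<partial>\<close> is the derivation of \<open>R\<close> with \<open>\<partial> t = u\<close>. The values at \<open>-1, 0, 1, 2\<close> are free.\<close>

function functional_seq :: "complex \<Rightarrow> (int \<Rightarrow> complex) \<Rightarrow> int \<Rightarrow> complex" where
  "functional_seq c h m =
    (if 3 \<le> m then (2 * c * of_int (m - 2) * functional_seq c h (m - 2)
        - of_int (m - 3) * functional_seq c h (m - 4)) / of_int (m - 1)
     else if m \<le> - 2 then (2 * c * of_int (m + 2) * functional_seq c h (m + 2)
        - of_int (m + 3) * functional_seq c h (m + 4)) / of_int (m + 1)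
     else h m)"
  by pat_completeness auto
termination
  \<comment> \<open>Centred at 1/2, the midpoint of the free positions -1, ..., 2; with the absolute
    value of m, the call from -2 to 2 would not decrease.\<close>
  by (relation "Wellfounded.measure (\<lambda>(c, h, m). nat \<bar>2 * m - 1\<bar>)") auto

declare functional_seq.simps [simp del]

text \<open>With n = i + 1 this becomes the vanishing on D(t^i u). For n \<ge> 1 it defines the
  value at n + 2, for n \<le> 0 the value at n - 2, each time with a nonzero leading
  coefficient.\<close>

lemma functional_seq_recursion:
  "of_int (n + 1) * functional_seq c h (n + 2) - 2 * c * of_int n * functional_seq c h n
    + of_int (n - 1) * functional_seq c h (n - 2) = 0"
proof (cases "1 \<le> n")
  case True
  then have "(of_int (n + 1) :: complex) \<noteq> 0"
    by (simp only: of_int_eq_0_iff)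
  moreover have "functional_seq c h (n + 2) = (2 * c * of_int n * functional_seq c h n
      - of_int (n - 1) * functional_seq c h (n - 2)) / of_int (n + 1)"
    using True by (subst functional_seq.simps) simp
  ultimately show ?thesis
    by simp
next
  case False
  then have nz: "(of_int (n - 1) :: complex) \<noteq> 0"
    by (simp only: of_int_eq_0_iff)
  have "functional_seq c h (n - 2) = (2 * c * of_int n * functional_seq c h n
      - of_int (n + 1) * functional_seq c h (n + 2)) / of_int (n - 1)"
    using False by (subst functional_seq.simps) (simp add: add.commute)
  then have "of_int (n - 1) * functional_seq c h (n - 2) =
      2 * c * of_int n * functional_seq c h n - of_int (n + 1) * functional_seq c h (n + 2)"
    by (simp only: nonzero_eq_divide_eq[OF nz] mult.commute[of "of_int (n - 1)"])
  moreover have "x - y + (y - x) = 0" for x y :: complex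
    by simp
  ultimately show ?thesis
    by (simp only:)
qed

lemma functional_seq_values:
  "- 1 \<le> m \<Longrightarrow> m \<le> 2 \<Longrightarrow> functional_seq c h m = h m"
  "functional_seq c h 3 = c * h 1"
  "functional_seq c h (- 2) = h 2"
  "functional_seq c h (- 3) = c * h (- 1)"
  "functional_seq c h (- 4) = (4 * c * h 2 - h 0) / 3"
proof -
  show m: "functional_seq c h m = h m" if "- 1 \<le> m" "m \<le> 2" for m
    using that by (subst functional_seq.simps) simp
  show "functional_seq c h 3 = c * h 1"
    by (subst functional_seq.simps) (simp add: m)
  show 2: "functional_seq c h (- 2) = h 2"
    by (subst functional_seq.simps) (simp add: m)
  show "functional_seq c h (- 3) = c * h (- 1)"
    by (subst functional_seq.simps) (simp add: m)
  show "functional_seq c h (- 4) = (4 * c * h 2 - h 0) / 3"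
    by (subst functional_seq.simps) (simp add: m 2 field_simps)
qed

context djkm
begin

text \<open>As a^2 b^2 = 1, 4 (c^2 - 1) = (a^2 - b^2)^2. This is where a \<noteq> b and a \<noteq>
  -b enter.\<close>

lemma discriminant_nonzero: "c ^ 2 \<noteq> 1"
proof
  assume "c ^ 2 = 1"
  moreover have "4 * (c ^ 2 - a ^ 2 * b ^ 2) = ((a - b) * (a + b)) ^ 2"
    by (simp add: c field_simps power2_eq_square)
  ultimately have "(a - b) * (a + b) = 0"
    by (simp add: ab)
  then show False
    using a_neq by (auto simp: add_eq_0_iff)
qed

lemma t_u_t: "t i * u * t j = t (i + j) * u"
  by (simp only: mult.assoc mult.commute[of u "t j"] t_add_left)

lemma t_u_u: "t i * (u * u) = t (i + 4) - (2 * c) *\<^sub>C t (i + 2) + t i"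
  by (simp add: u_squared distrib_left right_diff_distrib scaleC_mult_right t_add)

lemma t_u_t_u: "t i * u * (t j * u) = t (i + j) * (u * u)"
  by (simp only: mult.assoc[symmetric] t_u_t)

text \<open>The values are forced by D t = u: from 2 u D u = D(u^2) one gets D u = 2 t^3 - 2ct, and
  the product rule gives D(t^i u). Prescribing D on the basis leaves the product rule to be checked
  on pairs of basis elements.\<close>

lemma ex_derivation:
  obtains D :: "'r \<Rightarrow> 'r" where "clinear D" "\<forall>i. D (t i) = of_int i *\<^sub>C (t (i - 1) * u)"
    "\<forall>i. D (t i * u) = of_int (i + 2) *\<^sub>C t (i + 3) - (2 * c * of_int (i + 1)) *\<^sub>C t (i + 1)
      + of_int i *\<^sub>C t (i - 1)"
    "\<forall>f g. D (f * g) = f * D g + g * D f"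
proof -
  obtain D :: "'r \<Rightarrow> 'r" where D: "clinear D" "\<forall>i. D (t i) = of_int i *\<^sub>C (t (i - 1) * u)"
    "\<forall>i. D (t i * u) = of_int (i + 2) *\<^sub>C t (i + 3) - (2 * c * of_int (i + 1)) *\<^sub>C t (i + 1)
      + of_int i *\<^sub>C t (i - 1)"
    by (rule ex_linear_extension)
  note D' = D(2)[rule_format] D(3)[rule_format]
  have tt: "D (t i * t j) = t i * D (t j) + t j * D (t i)" for i j
    by (simp add: t_add t_add_left D' scaleC_mult_right scaleC_add_left algebra_simps)
  have combine: "(x *\<^sub>C p - y *\<^sub>C r + z *\<^sub>C s) + (x' *\<^sub>C p - y' *\<^sub>C r + z' *\<^sub>C s) =
      (x + x') *\<^sub>C p - (y + y') *\<^sub>C r + (z + z') *\<^sub>C s" for x y z x' y' z' and p r s :: 'r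
    by (simp add: scaleC_add_left)
  have tu: "D (t i * (t j * u)) = t i * D (t j * u) + t j * u * D (t i)" for i j
  proof -
    have "t i * D (t j * u) = of_int (j + 2) *\<^sub>C t (i + j + 3) -
        (2 * c * of_int (j + 1)) *\<^sub>C t (i + j + 1) + of_int j *\<^sub>C t (i + j - 1)"
      by (simp add: D'(2) distrib_left right_diff_distrib scaleC_mult_right t_add add.assoc add_diff_eq)
    moreover have "t j * u * D (t i) =
        of_int i *\<^sub>C t (i + j + 3) - (2 * c * of_int i) *\<^sub>C t (i + j + 1) + of_int i *\<^sub>C t (i + j - 1)"
    proof -
      have "j + (i - 1) + 4 = i + j + 3" "j + (i - 1) + 2 = i + j + 1" "j + (i - 1) = i + j - 1"
        by simp_all
      then show ?thesis
        by (simp only: D'(1) scaleC_mult_right t_u_t_u t_u_u scaleC_add_right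
            cvec.scale_right_diff_distrib scaleC_scaleC mult.commute[of "of_int i"])
    qed
    moreover have "D (t i * (t j * u)) = of_int (i + j + 2) *\<^sub>C t (i + j + 3) -
        (2 * c * of_int (i + j + 1)) *\<^sub>C t (i + j + 1) + of_int (i + j) *\<^sub>C t (i + j - 1)"
      by (simp only: t_add_left D'(2))
    moreover have "of_int (j + 2) + of_int i = (of_int (i + j + 2) :: complex)"
      "2 * c * of_int (j + 1) + 2 * c * of_int i = 2 * c * of_int (i + j + 1)"
      "of_int j + of_int i = (of_int (i + j) :: complex)"
      by (simp_all add: algebra_simps)
    ultimately show ?thesis
      by (simp only: combine)
  qed
  have uu: "D (t i * u * (t j * u)) = t i * u * D (t j * u) + t j * u * D (t i * u)" for i j
  proof -
    have r: "t i * u * D (t j * u) = of_int (j + 2) *\<^sub>C (t (i + j + 3) * u) -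
        (2 * c * of_int (j + 1)) *\<^sub>C (t (i + j + 1) * u) + of_int j *\<^sub>C (t (i + j - 1) * u)" for i j
      by (simp add: D'(2) distrib_left right_diff_distrib scaleC_mult_right t_u_t add.assoc add_diff_eq)
    have idx: "i + j + 4 - 1 = i + j + 3" "i + j + 2 - 1 = i + j + 1"
      by simp_all
    have "D (t i * u * (t j * u)) = of_int (i + j + 4) *\<^sub>C (t (i + j + 3) * u) -
        (2 * c * of_int (i + j + 2)) *\<^sub>C (t (i + j + 1) * u) +
        of_int (i + j) *\<^sub>C (t (i + j - 1) * u)"
      by (simp only: t_u_t_u t_u_u clinear_simps(1,2,5)[OF D(1)] D'(1) idx scaleC_scaleC)
    moreover have "of_int (j + 2) + of_int (i + 2) = (of_int (i + j + 4) :: complex)"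
      "2 * c * of_int (j + 1) + 2 * c * of_int (i + 1) = 2 * c * of_int (i + j + 2)"
      "of_int j + of_int i = (of_int (i + j) :: complex)"
      by (simp_all add: algebra_simps)
    ultimately show ?thesis
      by (simp only: r[of i j] r[of j i] add.commute[of j i] combine)
  qed
  have mult_lin: "clinear (\<lambda>x. y * x)" "clinear (\<lambda>x. x * y)" for y :: 'r
    by (simp_all add: clinear_def algebra_simps scaleC_mult_left scaleC_mult_right)
  have "D (f * g) = f * D g + g * D f" for f g
  proof (rule clinear2_ring_eqI[of "\<lambda>f g. D (f * g)" "\<lambda>f g. f * D g + g * D f"])
    show "cbilinear (\<lambda>f g. D (f * g))"
      by (rule cbilinear_comp_linear[OF cbilinearI[OF mult_lin] D(1)])
    show "cbilinear (\<lambda>f g. f * D g + g * D f)"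
      by (intro cbilinear_plus cbilinearI mult_lin clinear_comp[OF mult_lin(1) D(1)])
    show "D (x * y) = x * D y + y * D x" if "x \<in> basis_elems" "y \<in> basis_elems" for x y
      using that tu tt uu by (auto simp: basis_elems_def)
        (metis add.commute mult.commute)
  qed
  with D show thesis
    using that by blast
qed

lemma ex_functional:
  fixes A :: "int \<Rightarrow> complex"
  obtains M :: "'r kaehler_mod_exact \<Rightarrow> complex"
  where "clinear M" "\<forall>k\<in>{- 4..0}. M (omega q k) = A k"
proof -
  let ?d = "1 - c ^ 2"
  have d: "?d \<noteq> 0"
    using discriminant_nonzero by auto
  \<comment> \<open>The solution of h(-1) - c h(1) = A(-1), h(1) - c h(-1) = A(-3) and of h(2) - c
    h(0) = A(-2)/2, h(0) - c h(2) = 3 A(-4)/2; the last branch is meant for m = 0.\<close>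
  define h :: "int \<Rightarrow> complex" where "h m = (if m = 1 then (A (- 3) + c * A (- 1)) / ?d
    else if m = - 1 then (A (- 1) + c * A (- 3)) / ?d
    else if m = 2 then (A (- 2) / 2 + c * (3 / 2 * A (- 4))) / ?d
    else (3 / 2 * A (- 4) + c * (A (- 2) / 2)) / ?d)" for m
  let ?l = "functional_seq c h"
  \<comment> \<open>D(t^i) = i t^(i-1) u never involves t^(-1) u, so the value there is free. It is
    the value on \<open>omega q 0\<close>, since D t = u.\<close>
  obtain L :: "'r \<Rightarrow> complex" where L: "clinear L" "\<forall>i. L (t i) = ?l i"
    "\<forall>i. L (t i * u) = (if i = - 1 then A 0 else 0)"
    by (rule ex_linear_extension)
  note L' = L(2)[rule_format] L(3)[rule_format]
  obtain D where D: "clinear D" "\<forall>i. D (t i) = of_int i *\<^sub>C (t (i - 1) * u)"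
    "\<forall>i. D (t i * u) = of_int (i + 2) *\<^sub>C t (i + 3) - (2 * c * of_int (i + 1)) *\<^sub>C t (i + 1)
      + of_int i *\<^sub>C t (i - 1)"
    "\<forall>f g. D (f * g) = f * D g + g * D f"
    by (rule ex_derivation)
  note D' = D(2)[rule_format] D(3)[rule_format] D(4)[rule_format]
  have LD: "L (D r) = 0" for r
  proof (rule clinear_ring_eqI[OF clinear_comp[OF L(1) D(1)] clinear_const_zero])
    show "L (D (t i)) = 0" for i
      by (simp add: D'(1) L' clinear_scale[OF L(1)] scaleC_complex_def)
    show "L (D (t i * u)) = 0" for i
      using functional_seq_recursion[of "i + 1" c h]
      by (simp add: D'(2) L' clinear_simps(1,2,5)[OF L(1)] scaleC_complex_def)
        (simp add: algebra_simps)
  qed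
  have mult_lin: "clinear (\<lambda>x. y * x)" "clinear (\<lambda>x. x * y)" for y :: 'r
    by (simp_all add: clinear_def algebra_simps scaleC_mult_left scaleC_mult_right)
  have "cbilinear (\<lambda>f g. L (f * D g))"
    by (intro cbilinearI clinear_comp[OF L(1) mult_lin(2)]
        clinear_comp[OF clinear_comp[OF L(1) mult_lin(1)] D(1)])
  moreover have "L (k * D (f * g)) = L (k * f * D g) + L (k * g * D f)" for f g k
    by (simp add: D'(3) distrib_left mult.assoc clinear_add[OF L(1)])
  moreover have "L (1 * D f) = 0" for f
    by (simp add: LD)
  ultimately obtain M where M: "clinear M" "\<forall>f g. M (diff_class f g) = L (f * D g)"
    by (rule diff_class_universal)
  have D1: "D (t 1) = u"
    by (simp add: D'(1) t_zero scaleC_one)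
  have M0: "M (omega q 0) = A 0"
    by (simp add: omega_0 M D1 L')
  \<comment> \<open>The class of t^k u dt goes to L(t^k u^2); the three terms are those of
    u^2.\<close>
  have MJ: "M (J k) = ?l (k + 4) - 2 * c * ?l (k + 2) + ?l k" for k
    by (simp add: J_def M D1 mult.assoc u_squared distrib_left right_diff_distrib scaleC_mult_right
        t_add clinear_simps(1,2,5)[OF L(1)] L' scaleC_complex_def)
  have h: "h (- 1) - c * h 1 = A (- 1)" "2 * h 2 - 2 * c * h 0 = A (- 2)"
    "h 1 - c * h (- 1) = A (- 3)" "(2 * h 0 - 2 * c * h 2) / 3 = A (- 4)"
    using d by (simp_all add: h_def divide_simps) (simp_all add: algebra_simps power2_eq_square)
  have "M (omega q (- 1)) = A (- 1)" "M (omega q (- 2)) = A (- 2)"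
    "M (omega q (- 3)) = A (- 3)" "M (omega q (- 4)) = A (- 4)"
    by (simp_all add: omega_J MJ functional_seq_values flip: h) (simp_all add: algebra_simps divide_simps)
  moreover have "{- 4..0 :: int} = {- 4, - 3, - 2, - 1, 0}"
    by auto
  ultimately have "\<forall>k\<in>{- 4..0}. M (omega q k) = A k"
    using M0 by simp
  with M(1) show thesis
    by (rule that)
qed

lemma inj_omega: "inj_on (omega q) {- 4..0}"
proof (rule inj_onI)
  fix i j :: int assume ij: "i \<in> {- 4..0}" "j \<in> {- 4..0}" "omega q i = omega q j"
  obtain M where "\<forall>k\<in>{- 4..0}. M (omega q k) = (if k = i then 1 else 0 :: complex)"
    by (rule ex_functional[of "\<lambda>k. if k = i then 1 else 0"])
  then show "i = j"
    using ij by (metis zero_neq_one)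
qed

lemma independent_omega: "cvec.independent (omega q ` {- 4..0})"
proof
  assume "cvec.dependent (omega q ` {- 4..0})"
  then obtain w where w: "\<exists>v\<in>omega q ` {- 4..0}. w v \<noteq> 0" "(\<Sum>v\<in>omega q ` {- 4..0}. w v *\<^sub>C v) = 0"
    by (auto simp: cvec.dependent_finite)
  then obtain i where i: "i \<in> {- 4..0}" "w (omega q i) \<noteq> 0"
    by blast
  obtain M where M: "clinear M" "\<forall>k\<in>{- 4..0}. M (omega q k) = (if k = i then 1 else 0 :: complex)"
    by (rule ex_functional[of "\<lambda>k. if k = i then 1 else 0"])
  have "0 = M (\<Sum>k\<in>{- 4..0}. w (omega q k) *\<^sub>C omega q k)"
    using w(2) by (simp add: sum.reindex[OF inj_omega] clinear_zero[OF M(1)])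
  also have "\<dots> = (\<Sum>k\<in>{- 4..0}. if k = i then w (omega q k) else 0)"
    unfolding clinear_sum[OF M(1)] clinear_scale[OF M(1)]
    by (intro sum.cong) (use M(2) in \<open>auto simp: scaleC_complex_def\<close>)
  also have "\<dots> = w (omega q i)"
    using i(1) by (subst sum.delta) auto
  finally show False
    using i(2) by simp
qed


section \<open>The parity decomposition\<close>

abbreviation R0 :: "'r set" where "R0 \<equiv> range (\<lambda>f. q [:f:])"
abbreviation R1 :: "'r set" where "R1 \<equiv> range (\<lambda>f. q [:f:] * u)"
abbreviation W0 where "W0 \<equiv> cvec.span {omega q 0}"
abbreviation W1 where "W1 \<equiv> cvec.span {omega q (- 4), omega q (- 3), omega q (- 2), omega q (- 1)}"

text \<open>Every clause of \<open>psi\<close> visibly lies in \<open>W1\<close>, and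
  \<open>psi_J\<close> with indices k + 2 and 0 identifies it with J k.\<close>

lemma J_W1: "J k \<in> W1"
proof -
  have mem: "omega q (- 4) \<in> W1" "omega q (- 3) \<in> W1" "omega q (- 2) \<in> W1" "omega q (- 1) \<in> W1"
    by (auto intro: cvec.span_base)
  have "k + 2 \<in> {1, 0, - 1, - 2} \<Longrightarrow> k = - 1 \<or> k = - 2 \<or> k = - 3 \<or> k = - 4"
    by auto
  then have "psi q c (k + 2) 0 \<in> W1"
    unfolding psi_def Let_def using mem
    by (auto intro!: cvec.span_add cvec.span_scale)
  then show ?thesis
    by (simp add: psi_J)
qed

lemma diff_class_parity:
  "x \<in> R0 \<Longrightarrow> y \<in> R0 \<Longrightarrow> diff_class x y \<in> W0"
  "x \<in> R0 \<Longrightarrow> y \<in> R1 \<Longrightarrow> diff_class x y \<in> W1"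
  "x \<in> R1 \<Longrightarrow> y \<in> R0 \<Longrightarrow> diff_class x y \<in> W1"
  "x \<in> R1 \<Longrightarrow> y \<in> R1 \<Longrightarrow> diff_class x y \<in> W0"
proof -
  note mem = cbilinear_span_mem[OF cbilinear_diff_class cvec.subspace_span]
  have 0: "omega q 0 \<in> W0"
    by (simp add: cvec.span_base)
  show "diff_class x y \<in> W0" if "x \<in> R0" "y \<in> R0"
    using that by (auto intro!: mem[OF _ q_const_span q_const_span] cvec.span_scale 0
        simp only: diff_class_t_t' imageE)
  show 10: "diff_class x y \<in> W1" if "x \<in> R1" "y \<in> R0" for x y
    using that by (auto intro!: mem[OF _ q_const_u_span q_const_span] cvec.span_scale J_W1
        simp: diff_class_tu_t)
  show "diff_class x y \<in> W1" if "x \<in> R0" "y \<in> R1"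
    using 10[OF that(2,1)] by (subst diff_class_swap) (rule cvec.span_neg)
  show "diff_class x y \<in> W0" if "x \<in> R1" "y \<in> R1"
    using that by (auto intro!: mem[OF _ q_const_u_span q_const_u_span] cvec.span_scale 0
        simp only: diff_class_tu_tu imageE)
qed

lemma R_parity:
  "x \<in> R0 \<Longrightarrow> y \<in> R0 \<Longrightarrow> x * y \<in> R0"
  "x \<in> R0 \<Longrightarrow> y \<in> R1 \<Longrightarrow> x * y \<in> R1"
  "x \<in> R1 \<Longrightarrow> y \<in> R0 \<Longrightarrow> x * y \<in> R1"
  "x \<in> R1 \<Longrightarrow> y \<in> R1 \<Longrightarrow> x * y \<in> R0"
proof -
  show "x * y \<in> R0" if "x \<in> R0" "y \<in> R0"
    using that by (auto simp flip: q_const_mult)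
  show 01: "x * y \<in> R1" if xy: "x \<in> R0" "y \<in> R1" for x y
  proof -
    obtain f g where "x = q [:f:]" "y = q [:g:] * u"
      using xy by blast
    then have "x * y = q [:f * g:] * u"
      by (simp only: q_const_mult mult.assoc)
    then show ?thesis by blast
  qed
  show "x * y \<in> R1" if "x \<in> R1" "y \<in> R0"
    using 01[OF that(2,1)] by (simp only: mult.commute)
  show "x * y \<in> R0" if xy: "x \<in> R1" "y \<in> R1"
  proof -
    obtain f g where "x = q [:f:] * u" "y = q [:g:] * u"
      using xy by blast
    then have "x * y = q [:f * g * u_square:]"
      by (simp only: q_const_mult u_squared_const[symmetric] ac_simps)
    then show ?thesis by blast
  qed
qed

lemma kaehler_decomp: "\<exists>v\<in>W0. \<exists>w\<in>W1. W = v + w"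
proof -
  have "W \<in> cvec.span ({omega q 0} \<union> {omega q (- 4), omega q (- 3), omega q (- 2), omega q (- 1)})"
    (is "_ \<in> ?W")
  proof -
    have W0: "W0 \<subseteq> ?W" and W1: "W1 \<subseteq> ?W"
      by (auto intro!: cvec.span_mono)
    have "diff_class f g \<in> ?W" for f g
    proof (rule cbilinear_span_mem[OF cbilinear_diff_class cvec.subspace_span])
      show "f \<in> cvec.span basis_elems" "g \<in> cvec.span basis_elems"
        by (simp_all only: span_basis_elems UNIV_I)
      fix x y assume "x \<in> basis_elems" "y \<in> basis_elems"
      moreover have "basis_elems \<subseteq> R0 \<union> R1"
        by (auto simp: basis_elems_def tpow_def)
      ultimately show "diff_class x y \<in> ?W"
        using diff_class_parity[of x y] W0 W1 by blast
    qed
    then have "{diff_class f g | f g. True} \<subseteq> ?W"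
      by blast
    then have "cvec.span {diff_class f g | f g. True} \<subseteq> ?W"
      by (rule cvec.span_minimal[OF _ cvec.subspace_span])
    then show ?thesis
      unfolding span_diff_class by blast
  qed
  then show ?thesis
    unfolding cvec.span_Un by blast
qed

lemma W0_W1_disjoint: "W0 \<inter> W1 = {0}"
proof -
  have "w = 0" if w: "w \<in> W0" "w \<in> W1" for w
  proof -
    obtain z where z: "w = z *\<^sub>C omega q 0"
      using w(1) by (auto simp: cvec.span_singleton)
    obtain M where M: "clinear M" "\<forall>k\<in>{- 4..0}. M (omega q k) = (if k = 0 then 1 else 0 :: complex)"
      by (rule ex_functional[of "\<lambda>k. if k = 0 then 1 else 0"])
    have "M w = 0"
      using M(1) clinear_const_zero _ w(2)
      by (rule clinear_eq_on_span) (use M(2) in auto)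
    then have "z = 0"
      using M by (simp add: z clinear_scale[OF M(1)] scaleC_complex_def)
    then show ?thesis
      by (simp add: z)
  qed
  then show ?thesis
    by (auto intro: cvec.span_zero)
qed

definition T0 :: "('g::complex_vector, 'r) tensor set" where
  "T0 = cvec.span {x \<otimes>\<^sub>C q [:f:] | x f. True}"
definition T1 :: "('g::complex_vector, 'r) tensor set" where
  "T1 = cvec.span {x \<otimes>\<^sub>C (q [:f:] * u) | x f. True}"

lemma hat_eq: "hat0 q = T0 \<times> W0" "hat1 q = T1 \<times> W1"
  by (simp_all add: hat0_def hat1_def T0_def T1_def)

lemma subspace_T: "cvec.subspace T0" "cvec.subspace T1"
  by (simp_all add: T0_def T1_def)

lemma tensor_decomp: "\<exists>Y\<in>T0. \<exists>Z\<in>T1. X = Y + Z"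
proof -
  let ?S0 = "{x \<otimes>\<^sub>C q [:f:] | x f. True}" and ?S1 = "{x \<otimes>\<^sub>C (q [:f:] * u) | x f. True}"
  have "x \<otimes>\<^sub>C r \<in> cvec.span (?S0 \<union> ?S1)" for x and r :: 'r
  proof -
    obtain f g where "r = q [:f:] + q [:g:] * u"
      using ex_parts by blast
    then have "x \<otimes>\<^sub>C r = x \<otimes>\<^sub>C q [:f:] + x \<otimes>\<^sub>C (q [:g:] * u)"
      by (simp only: tensor_of_add_right)
    moreover have "x \<otimes>\<^sub>C q [:f:] \<in> cvec.span (?S0 \<union> ?S1)"
      by (rule cvec.span_base) blast
    moreover have "x \<otimes>\<^sub>C (q [:g:] * u) \<in> cvec.span (?S0 \<union> ?S1)"
      by (rule cvec.span_base) blast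
    ultimately show ?thesis
      by (simp only: cvec.span_add)
  qed
  then have "{x \<otimes>\<^sub>C r | x r. True} \<subseteq> cvec.span (?S0 \<union> ?S1)"
    by blast
  then have "cvec.span {x \<otimes>\<^sub>C r | x r. True} \<subseteq> cvec.span (?S0 \<union> ?S1)"
    by (rule cvec.span_minimal[OF _ cvec.subspace_span])
  then have "X \<in> cvec.span (?S0 \<union> ?S1)"
    unfolding span_tensor by blast
  then show ?thesis
    unfolding cvec.span_Un T0_def T1_def by blast
qed

text \<open>The underlying space is that of Kassel's extension, so \<open>kassel\<close> applies to
  it directly.\<close>

lemma hat_UNIV: "hat q = UNIV"
proof -
  have "P \<in> hat q" for P :: "('g::complex_vector, 'r) tensor \<times> 'r kaehler_mod_exact"
  proof -
    obtain Y Z where X: "Y \<in> T0" "Z \<in> T1" "fst P = Y + Z"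
      using tensor_decomp by blast
    obtain v w where W: "v \<in> W0" "w \<in> W1" "snd P = v + w"
      using kaehler_decomp by blast
    have "P = (Y, v) + (Z, w)"
      using X(3) W(3) by (simp add: prod_eq_iff)
    moreover have "(Y, v) \<in> hat0 q" "(Z, w) \<in> hat1 q"
      using X W by (simp_all add: hat_eq)
    ultimately show ?thesis
      unfolding hat_def subspace_sum_def by blast
  qed
  then show ?thesis by blast
qed

text \<open>The projection p of R onto its Laurent part induces a map on the tensor product that is
  the identity on \<open>T0\<close> and zero on \<open>T1\<close>.\<close>

lemma T0_T1_disjoint: "T0 \<inter> T1 = ({0} :: ('g::complex_vector, 'r) tensor set)"
proof -
  obtain p :: "'r \<Rightarrow> 'r" where p: "clinear p" "\<forall>i. p (t i) = t i" "\<forall>i. p (t i * u) = 0"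
    by (rule ex_linear_extension)
  have p0: "p (q [:f:]) = q [:f:]" for f
    using p(1) clinear_ident _ q_const_span[of f]
    by (rule clinear_eq_on_span) (use p(2) in auto)
  have p1: "p (q [:f:] * u) = 0" for f
    using p(1) clinear_const_zero _ q_const_u_span[of f]
    by (rule clinear_eq_on_span) (use p(3) in auto)
  have bil: "cbilinear (\<lambda>x r. x \<otimes>\<^sub>C p r :: ('g, 'r) tensor)"
    by (intro cbilinearI clinear_comp[OF cbilinearD(1)[OF cbilinear_tensor_of] p(1)]
        cbilinearD(2)[OF cbilinear_tensor_of])
  let ?P = "tensor_lift (\<lambda>x r. x \<otimes>\<^sub>C p r) :: ('g, 'r) tensor \<Rightarrow> ('g, 'r) tensor"
  note L = clinear_tensor_lift[OF bil] and T = tensor_lift_tensor_of[OF bil]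
  have "X = 0" if X: "X \<in> T0" "X \<in> T1" for X :: "('g, 'r) tensor"
  proof -
    have "?P X = X"
      using L clinear_ident _ X(1)[unfolded T0_def]
      by (rule clinear_eq_on_span) (auto simp: T p0)
    moreover have "?P X = 0"
      using L clinear_const_zero _ X(2)[unfolded T1_def]
      by (rule clinear_eq_on_span) (auto simp: T p1 clinear_zero[OF cbilinearD(1)[OF cbilinear_tensor_of]])
    ultimately show ?thesis by simp
  qed
  then show ?thesis
    using cvec.subspace_0[OF subspace_T(1)] cvec.subspace_0[OF subspace_T(2)] by blast
qed

end

section \<open>Grading, explicit formulas and uniqueness of the bracket\<close>

locale djkm_algebra = djkm a b q c + simple_lie br
  for a b c :: complex and q :: "laurent poly \<Rightarrow> 'r::complex_comm_algebra"
    and br :: "'g::complex_vector \<Rightarrow> 'g \<Rightarrow> 'g"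
begin

lemma current_parity:
  "X \<in> T0 \<Longrightarrow> Y \<in> T0 \<Longrightarrow> current_bracket br X Y \<in> T0"
  "X \<in> T0 \<Longrightarrow> Y \<in> T1 \<Longrightarrow> current_bracket br X Y \<in> T1"
  "X \<in> T1 \<Longrightarrow> Y \<in> T0 \<Longrightarrow> current_bracket br X Y \<in> T1"
  "X \<in> T1 \<Longrightarrow> Y \<in> T1 \<Longrightarrow> current_bracket br X Y \<in> T0"
proof -
  have T0: "x \<otimes>\<^sub>C r \<in> T0" if "r \<in> R0" for x :: 'g and r
    unfolding T0_def using that by (intro cvec.span_base) blast
  have T1: "x \<otimes>\<^sub>C r \<in> T1" if "r \<in> R1" for x :: 'g and r
    unfolding T1_def using that by (intro cvec.span_base) blast
  note mem' = cbilinear_span_mem[OF cbilinear_current_bracket[OF bilinear]]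
  show "current_bracket br X Y \<in> T0" if "X \<in> T0" "Y \<in> T0"
    using subspace_T(1) _ that[unfolded T0_def]
  proof (rule mem')
    show "current_bracket br Z Z' \<in> T0"
      if "Z \<in> {x \<otimes>\<^sub>C q [:f:] | x f. True}" "Z' \<in> {x \<otimes>\<^sub>C q [:f:] | x f. True}" for Z Z' :: "('g, 'r) tensor"
      using that by clarify (simp only: current_tensor, intro T0 R_parity(1) rangeI)
  qed
  show "current_bracket br X Y \<in> T1" if "X \<in> T0" "Y \<in> T1"
    using subspace_T(2) _ that[unfolded T0_def T1_def]
  proof (rule mem')
    show "current_bracket br Z Z' \<in> T1"
      if "Z \<in> {x \<otimes>\<^sub>C q [:f:] | x f. True}" "Z' \<in> {x \<otimes>\<^sub>C (q [:f:] * u) | x f. True}" for Z Z' :: "('g, 'r) tensor"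
      using that by clarify (simp only: current_tensor, intro T1 R_parity(2) rangeI)
  qed
  show "current_bracket br X Y \<in> T1" if "X \<in> T1" "Y \<in> T0"
    using subspace_T(2) _ that[unfolded T0_def T1_def]
  proof (rule mem')
    show "current_bracket br Z Z' \<in> T1"
      if "Z \<in> {x \<otimes>\<^sub>C (q [:f:] * u) | x f. True}" "Z' \<in> {x \<otimes>\<^sub>C q [:f:] | x f. True}" for Z Z' :: "('g, 'r) tensor"
      using that by clarify (simp only: current_tensor, intro T1 R_parity(3) rangeI)
  qed
  show "current_bracket br X Y \<in> T0" if "X \<in> T1" "Y \<in> T1"
    using subspace_T(1) _ that[unfolded T1_def]
  proof (rule mem')
    show "current_bracket br Z Z' \<in> T0"
      if "Z \<in> {x \<otimes>\<^sub>C (q [:f:] * u) | x f. True}" "Z' \<in> {x \<otimes>\<^sub>C (q [:f:] * u) | x f. True}" for Z Z' :: "('g, 'r) tensor"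
      using that by clarify (simp only: current_tensor, intro T0 R_parity(4) rangeI)
  qed
qed

lemma cocycle_parity:
  "X \<in> T0 \<Longrightarrow> Y \<in> T0 \<Longrightarrow> killing_cocycle br X Y \<in> W0"
  "X \<in> T0 \<Longrightarrow> Y \<in> T1 \<Longrightarrow> killing_cocycle br X Y \<in> W1"
  "X \<in> T1 \<Longrightarrow> Y \<in> T0 \<Longrightarrow> killing_cocycle br X Y \<in> W1"
  "X \<in> T1 \<Longrightarrow> Y \<in> T1 \<Longrightarrow> killing_cocycle br X Y \<in> W0"
proof -
  note mem' = cbilinear_span_mem[OF cbilinear_killing_cocycle]
  show "killing_cocycle br X Y \<in> W0" if "X \<in> T0" "Y \<in> T0"
    using cvec.subspace_span _ that[unfolded T0_def]
  proof (rule mem')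
    show "killing_cocycle br Z Z' \<in> W0"
      if "Z \<in> {x \<otimes>\<^sub>C q [:f:] | x f. True}" "Z' \<in> {x \<otimes>\<^sub>C q [:f:] | x f. True}" for Z Z' :: "('g, 'r) tensor"
      using that by clarify (simp only: killing_cocycle_tensor, intro cvec.span_scale diff_class_parity(1) rangeI)
  qed
  show "killing_cocycle br X Y \<in> W1" if "X \<in> T0" "Y \<in> T1"
    using cvec.subspace_span _ that[unfolded T0_def T1_def]
  proof (rule mem')
    show "killing_cocycle br Z Z' \<in> W1"
      if "Z \<in> {x \<otimes>\<^sub>C q [:f:] | x f. True}" "Z' \<in> {x \<otimes>\<^sub>C (q [:f:] * u) | x f. True}" for Z Z' :: "('g, 'r) tensor"
      using that by clarify (simp only: killing_cocycle_tensor, intro cvec.span_scale diff_class_parity(2) rangeI)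
  qed
  show "killing_cocycle br X Y \<in> W1" if "X \<in> T1" "Y \<in> T0"
    using cvec.subspace_span _ that[unfolded T0_def T1_def]
  proof (rule mem')
    show "killing_cocycle br Z Z' \<in> W1"
      if "Z \<in> {x \<otimes>\<^sub>C (q [:f:] * u) | x f. True}" "Z' \<in> {x \<otimes>\<^sub>C q [:f:] | x f. True}" for Z Z' :: "('g, 'r) tensor"
      using that by clarify (simp only: killing_cocycle_tensor, intro cvec.span_scale diff_class_parity(3) rangeI)
  qed
  show "killing_cocycle br X Y \<in> W0" if "X \<in> T1" "Y \<in> T1"
    using cvec.subspace_span _ that[unfolded T1_def]
  proof (rule mem')
    show "killing_cocycle br Z Z' \<in> W0"
      if "Z \<in> {x \<otimes>\<^sub>C (q [:f:] * u) | x f. True}" "Z' \<in> {x \<otimes>\<^sub>C (q [:f:] * u) | x f. True}" for Z Z' :: "('g, 'r) tensor"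
      using that by clarify (simp only: killing_cocycle_tensor, intro cvec.span_scale diff_class_parity(4) rangeI)
  qed
qed

lemma z2_graded_kassel: "z2_graded (hat q) (hat0 q) (hat1 q) (kassel_bracket br)"
proof -
  have "cvec.subspace (hat0 q :: (('g, 'r) tensor \<times> _) set)"
    "cvec.subspace (hat1 q :: (('g, 'r) tensor \<times> _) set)"
    unfolding hat_eq using subspace_T
    by (auto simp: cvec.subspace_def zero_prod_def intro: cvec.span_zero cvec.span_add cvec.span_scale)
  moreover have "(hat0 q :: (('g, 'r) tensor \<times> _) set) \<inter> hat1 q = {0}"
    unfolding hat_eq Times_Int_Times T0_T1_disjoint W0_W1_disjoint by (simp add: zero_prod_def)
  ultimately show ?thesis
    unfolding z2_graded_def hat_def hat_eq
    by (auto simp: kassel_bracket_def intro: current_parity cocycle_parity)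
qed

lemma is_hat_bracket_kassel: "is_hat_bracket q c br (kassel_bracket br)"
proof -
  note lie_k = lie_algebraD[OF lie_algebra_kassel[where 'r = 'r]]
  have bil: "bilinear_on (hat q) (kassel_bracket br :: ('g, 'r) tensor \<times> _ \<Rightarrow> _)"
    unfolding hat_UNIV using lie_algebra_kassel[where 'r = 'r] by (simp add: lie_algebra_def)
  have uu: "t (i - 1) * u * (t (j - 1) * u) = t (i + j + 2) - (2 * c) *\<^sub>C t (i + j) + t (i + j - 2)" for i j
  proof -
    have "i - 1 + (j - 1) + 4 = i + j + 2" "i - 1 + (j - 1) + 2 = i + j" "i - 1 + (j - 1) = i + j - 2"
      by simp_all
    then show ?thesis
      by (simp only: t_u_t_u t_u_u)
  qed
  have idx: "i - 1 + (j - 1) = - 4 \<longleftrightarrow> i + j = - 2" "i - 1 + (j - 1) = - 2 \<longleftrightarrow> i + j = 0"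
      "i - 1 + (j - 1) = 0 \<longleftrightarrow> i + j = 2" for i j :: int
    by auto
  show ?thesis
    unfolding is_hat_bracket_def
  proof (intro conjI allI ballI)
    show "bilinear_on (hat q) (kassel_bracket br :: ('g, 'r) tensor \<times> _ \<Rightarrow> _)"
      by (rule bil)
    show "kassel_bracket br X X = 0" for X :: "('g, 'r) tensor \<times> 'r kaehler_mod_exact"
      by (rule lie_k(2))
    show "kassel_bracket br (0, omega q k) X = 0" for k and X :: "('g, 'r) tensor \<times> 'r kaehler_mod_exact"
      by (simp add: kassel_bracket_def zero_prod_def
          clinear_zero[OF cbilinearD(2)[OF cbilinear_killing_cocycle]]
          clinear_zero[OF cbilinearD(2)[OF cbilinear_current_bracket[OF bilinear]]])
    fix x y :: 'g and i j :: int
    show "kassel_bracket br (x \<otimes>\<^sub>C t i, 0) (y \<otimes>\<^sub>C t j, 0) = (br x y \<otimes>\<^sub>C t (i + j),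
        ((if i + j = 0 then of_int j else 0) * K x y) *\<^sub>C omega q 0)"
      by (simp add: kassel_bracket_def t_add diff_class_t_t' scaleC_scaleC mult.commute)
    show "kassel_bracket br (x \<otimes>\<^sub>C (t (i - 1) * u), 0) (y \<otimes>\<^sub>C (t (j - 1) * u), 0) =
        (br x y \<otimes>\<^sub>C (t (i + j + 2) - (2 * c) *\<^sub>C t (i + j) + t (i + j - 2)),
         (((if i + j = - 2 then of_int (j + 1) else 0) - (if i + j = 0 then 2 * c * of_int j else 0)
           + (if i + j = 2 then of_int (j - 1) else 0)) * K x y) *\<^sub>C omega q 0)"
      unfolding kassel_bracket_def fst_conv current_tensor killing_cocycle_tensor uu
        diff_class_tu_tu idx by (simp add: scaleC_scaleC mult.commute)
    show "kassel_bracket br (x \<otimes>\<^sub>C (t (i - 1) * u), 0) (y \<otimes>\<^sub>C t j, 0) =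
        (br x y \<otimes>\<^sub>C (t (i + j - 1) * u), (of_int j * K x y) *\<^sub>C psi q c i j)"
    proof -
      have "t (i - 1) * u * t j = t (i + j - 1) * u"
        unfolding t_u_t by (simp add: add.commute add_diff_eq)
      moreover have "i - 1 + j - 1 = i + j - 2"
        by simp
      ultimately show ?thesis
        unfolding kassel_bracket_def fst_conv current_tensor killing_cocycle_tensor
          diff_class_tu_t psi_J by (simp only: scaleC_scaleC mult.commute)
    qed
  qed
qed

text \<open>The formulas cover three of the four parity combinations; the fourth follows by
  antisymmetry, and central components drop out. Bilinearity then fixes the bracket everywhere, so
  what holds for Kassel's bracket holds for any \<open>B\<close> with these formulas.\<close>

lemma is_hat_bracket_unique:
  assumes "is_hat_bracket q c br B"
  shows "B = kassel_bracket br"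
proof -
  have eqs: "B (x \<otimes>\<^sub>C t i, 0) (y \<otimes>\<^sub>C t j, 0) = kassel_bracket br (x \<otimes>\<^sub>C t i, 0) (y \<otimes>\<^sub>C t j, 0)"
    "B (x \<otimes>\<^sub>C (t (i - 1) * u), 0) (y \<otimes>\<^sub>C (t (j - 1) * u), 0) =
      kassel_bracket br (x \<otimes>\<^sub>C (t (i - 1) * u), 0) (y \<otimes>\<^sub>C (t (j - 1) * u), 0)"
    "B (x \<otimes>\<^sub>C (t (i - 1) * u), 0) (y \<otimes>\<^sub>C t j, 0) =
      kassel_bracket br (x \<otimes>\<^sub>C (t (i - 1) * u), 0) (y \<otimes>\<^sub>C t j, 0)" for x y i j
    using assms is_hat_bracket_kassel by (simp_all add: is_hat_bracket_def)
  have bil: "bilinear_on (hat q) C \<Longrightarrow> cbilinear C" for C :: "('g, 'r) tensor \<times> 'r kaehler_mod_exact \<Rightarrow> _"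
    by (simp add: hat_UNIV bilinear_on_def cbilinear_def clinear_def del: split_paired_All)
  have central_span: "(0 :: ('g, 'r) tensor, w) \<in> cvec.span ((\<lambda>k. (0, omega q k)) ` {- 4..0})" for w
  proof -
    have lin: "clinear (\<lambda>w. (0 :: ('g, 'r) tensor, w :: 'r kaehler_mod_exact))"
      by (simp add: clinear_def)
    obtain v v' where w: "w = v + v'" "v \<in> W0" "v' \<in> W1"
      using kaehler_decomp by blast
    have "(0 :: ('g, 'r) tensor, v) \<in> cvec.span ((\<lambda>k. (0, omega q k)) ` {- 4..0})"
      using lin cvec.subspace_span _ w(2)
      by (rule clinear_span_subset) (auto intro!: cvec.span_base imageI)
    moreover have "(0 :: ('g, 'r) tensor, v') \<in> cvec.span ((\<lambda>k. (0, omega q k)) ` {- 4..0})"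
      using lin cvec.subspace_span _ w(3)
      by (rule clinear_span_subset) (auto intro!: cvec.span_base imageI)
    ultimately show ?thesis
      using cvec.span_add[of "(0, v)" _ "(0, v')"] w(1) by simp
  qed
  \<comment> \<open>Proved for an arbitrary \<open>C\<close>, to be used for \<open>B\<close> and
    for Kassel's bracket alike.\<close>
  have anti: "C P Q = - C Q P" and central: "C (0, w) Q = 0" "C Q (0, w) = 0"
    if C: "is_hat_bracket q c br C" for C and P Q :: "('g, 'r) tensor \<times> 'r kaehler_mod_exact" and w
  proof -
    have bilC: "cbilinear C"
      using C by (intro bil) (simp add: is_hat_bracket_def)
    note L = cbilinearD[OF bilC]
    have alt: "C P P = 0" for P
      using C by (simp add: is_hat_bracket_def hat_UNIV del: split_paired_All)
    show anti: "C P Q = - C Q P" for P Q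
      using alt[of "P + Q"] alt[of P] alt[of Q]
      by (simp add: clinear_add[OF L(1)] clinear_add[OF L(2)] eq_neg_iff_add_eq_0 add.commute)
    show central: "C (0, w) Q = 0" for w
      using L(2) clinear_const_zero _ central_span[of w]
      by (rule clinear_eq_on_span) (use C in \<open>auto simp: is_hat_bracket_def hat_UNIV simp del: split_paired_All\<close>)
    show "C Q (0, w) = 0"
      using anti[of Q "(0, w)"] central by simp
  qed
  have bilC: "cbilinear C" if "is_hat_bracket q c br C" for C :: "('g, 'r) tensor \<times> 'r kaehler_mod_exact \<Rightarrow> _"
    using that by (intro bil) (simp add: is_hat_bracket_def)
  have reduce: "C P Q = C (fst P, 0) (fst Q, 0)" if C: "is_hat_bracket q c br C" for C P Q
  proof -
    note L = cbilinearD[OF bilC[OF C]]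
    have "C ((fst P, 0) + (0, snd P)) Q = C (fst P, 0) Q"
      by (simp only: clinear_add[OF L(2)] central[OF C] add_0_right)
    moreover have "C (fst P, 0) ((fst Q, 0) + (0, snd Q)) = C (fst P, 0) (fst Q, 0)"
      by (simp only: clinear_add[OF L(1)] central[OF C] add_0_right)
    ultimately show ?thesis
      by simp
  qed
  have lin: "clinear (\<lambda>X :: ('g, 'r) tensor. (X, 0 :: 'r kaehler_mod_exact))"
    by (simp add: clinear_def)
  have bilT: "cbilinear (\<lambda>X Y. C (X, 0) (Y, 0))" if "is_hat_bracket q c br C" for C
    using cbilinearD[OF bilC[OF that]]
    by (intro cbilinearI clinear_comp[OF _ lin])
  have eq_tensor: "B (x \<otimes>\<^sub>C r, 0) (y \<otimes>\<^sub>C s, 0) = kassel_bracket br (x \<otimes>\<^sub>C r, 0) (y \<otimes>\<^sub>C s, 0)" for x y r s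
  proof (rule clinear2_ring_eqI[of "\<lambda>r s. B (x \<otimes>\<^sub>C r, 0) (y \<otimes>\<^sub>C s, 0)"
        "\<lambda>r s. kassel_bracket br (x \<otimes>\<^sub>C r, 0) (y \<otimes>\<^sub>C s, 0)"])
    have bilR: "cbilinear (\<lambda>r s. C (x \<otimes>\<^sub>C r, 0) (y \<otimes>\<^sub>C s, 0))" if "is_hat_bracket q c br C" for C
      using cbilinearD[OF bilT[OF that]]
      by (intro cbilinearI clinear_comp[OF _ cbilinearD(1)[OF cbilinear_tensor_of]])
    show "cbilinear (\<lambda>r s. B (x \<otimes>\<^sub>C r, 0) (y \<otimes>\<^sub>C s, 0))"
      by (rule bilR[OF assms])
    show "cbilinear (\<lambda>r s :: 'r. kassel_bracket br (x \<otimes>\<^sub>C r, 0) (y \<otimes>\<^sub>C s, 0))"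
      by (rule bilR[OF is_hat_bracket_kassel])
    fix r s assume rs: "r \<in> basis_elems" "s \<in> basis_elems"
    \<comment> \<open>The bracket formulas index odd elements as t^(i-1) u, the basis as t^i
      u.\<close>
    have shift: "(\<exists>i. x = t i) \<or> (\<exists>i. x = t (i - 1) * u)" if "x \<in> basis_elems" for x
    proof -
      have "t i * u = t (i + 1 - 1) * u" for i
        by simp
      then show ?thesis
        using that unfolding basis_elems_def by blast
    qed
    from shift[OF rs(1)] shift[OF rs(2)]
    show "B (x \<otimes>\<^sub>C r, 0) (y \<otimes>\<^sub>C s, 0) = kassel_bracket br (x \<otimes>\<^sub>C r, 0) (y \<otimes>\<^sub>C s, 0)"
    proof (elim disjE exE)
      fix i j assume "r = t i" "s = t (j - 1) * u"
      then show ?thesis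
        by (simp only: anti[OF assms, of "(x \<otimes>\<^sub>C t i, 0)"]
            anti[OF is_hat_bracket_kassel, of "(x \<otimes>\<^sub>C t i, 0)"] eqs(3))
    qed (simp_all only: eqs)
  qed
  have eq_zero: "B (X, 0) (Y, 0) = kassel_bracket br (X, 0) (Y, 0)" for X Y
    by (rule clinear2_eqI[OF bilT[OF assms] bilT[OF is_hat_bracket_kassel]]) (rule eq_tensor)
  show ?thesis
    by (intro ext) (rule trans[OF reduce[OF assms] trans[OF eq_zero
          reduce[OF is_hat_bracket_kassel, symmetric]]])
qed

end

theorem theorem4p0p2:
  fixes a b c :: complex
    and q :: "laurent poly \<Rightarrow> 'r::complex_comm_algebra"
    and br :: "'g::complex_vector \<Rightarrow> 'g \<Rightarrow> 'g"
  assumes "a \<noteq> b" and "a \<noteq> - b" and "a ^ 2 * b ^ 2 = 1"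
    and "c = (a ^ 2 + b ^ 2) / 2"
    and "djkm_ring a b q"
    and "simple_lie_algebra UNIV br"
    and "finite_dimensional (UNIV :: 'g set)"
  shows "inj_on (omega q) {-4..0} \<and> cvec.independent (omega q ` {-4..0}) \<and>
    (\<exists>B. is_hat_bracket q c br B) \<and>
    (\<forall>B. is_hat_bracket q c br B \<longrightarrow>
      lie_algebra (hat q) B \<and>
      z2_graded (hat q) (hat0 q) (hat1 q) B \<and>
      universal_central_extension TYPE('f::complex_vector)
        (hat q) B (UNIV :: ('g, 'r) tensor set) (current_bracket br) fst)"
proof -
  interpret djkm_ring a b q
    by (rule assms(5))
  interpret djkm_algebra a b c q br
    by unfold_locales (use assms in auto)
  show ?thesis
  proof (intro conjI allI impI)
    show "inj_on (omega q) {-4..0}"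
      by (rule inj_omega)
    show "cvec.independent (omega q ` {-4..0})"
      by (rule independent_omega)
    show "\<exists>B. is_hat_bracket q c br B"
      using is_hat_bracket_kassel by blast
    fix B assume "is_hat_bracket q c br B"
    then have B: "B = kassel_bracket br"
      by (rule is_hat_bracket_unique)
    show "lie_algebra (hat q) B"
      unfolding B hat_UNIV by (rule lie_algebra_kassel)
    show "z2_graded (hat q) (hat0 q) (hat1 q) B"
      unfolding B by (rule z2_graded_kassel)
    show "universal_central_extension TYPE('f) (hat q) B (UNIV :: ('g, 'r) tensor set)
        (current_bracket br) fst"
      unfolding B hat_UNIV by (rule kassel)
  qed
qed

end
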